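(* Let $\mathbf{k}$ be an algebraically closed field of characteristic 2, $V$ a $2n$-dimensional $\mathbf{k}$-vector space with a non-degenerate symplectic form $\beta$, $G=Sp(V)$ and $\mathfrak{g}=\mathfrak{sp}(V)$. Two nilpotent elements $\xi,\zeta\in\mathfrak{g}^*$ lie in the same $G$-orbit if and only if $T_\xi,T_\zeta$ are conjugate in $GL(V)$ and $\chi_{V_\xi}=\chi_{V_\zeta}$.
   Context: $G=\{g\in GL(V)\mid\beta(gv,gw)=\beta(v,w)\ \forall v,w\}$, $\mathfrak{g}=\{x\in\mathfrak{gl}(V)\mid\beta(xv,w)+\beta(v,xw)=0\ \forall v,w\}$, and $G$ acts on $\mathfrak{g}^*$ by $(g.\xi)(x)=\xi(\mathrm{Ad}(g)^{-1}x)$. An element $\xi\in\mathfrak{g}^*$ is nilpotent if there is $g\in G$ such that $g.\xi$ vanishes on $\mathfrak{b}$, the Lie algebra of a fixed Borel subgroup. For $\xi\in\mathfrak{g}^*$ choose $X\in\mathfrak{gl}(V)$ with $\xi(x)=\mathrm{tr}(Xx)$ for all $x\in\mathfrak{g}$ and set $\alpha_\xi(v)=\beta(v,Xv)$, a quadratic form independent of the choice of $X$. Let $\beta_\xi(v,w)=\alpha_\xi(v+w)+\alpha_\xi(v)+\alpha_\xi(w)$ and define $T_\xi:V\to V$ by $\beta(T_\xi v,w)=\beta_\xi(v,w)$. For $\xi$ nilpotent, $T_\xi$ is nilpotent. $V_\xi$ denotes $(V,\beta,\alpha_\xi)$, and its index function is $\chi_{V_\xi}(m)=\min\{i\ge0\mid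 T_\xi^mv=0\Rightarrow\alpha_\xi(T_\xi^iv)=0\}$ (the implication being required for all $v\in V$), for integers $m\ge0$. *)

theory Defs
  imports
    "HOL-Algebra.Solvable_Groups"
    "HOL-Algebra.Group_Action"
    "HOL-Analysis.Function_Topology"
    "HOL-Computational_Algebra.Polynomial"
begin

text \<open>
  The vector space \<open>V\<close> is a whole type \<open>'v\<close> with scalar multiplication \<open>scl\<close> over \<open>'k\<close>;
  \<open>Basis\<close> is a finite basis, used only for computing traces.
\<close>

definition symplectic_form ::
    "('k::field \<Rightarrow> 'v::ab_group_add \<Rightarrow> 'v) \<Rightarrow> ('v \<Rightarrow> 'v \<Rightarrow> 'k) \<Rightarrow> bool" where
  "symplectic_form scl \<beta> \<longleftrightarrow>
     (\<forall>v. Vector_Spaces.linear scl (*) (\<lambda>w. \<beta> v w)) \<and>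
     (\<forall>w. Vector_Spaces.linear scl (*) (\<lambda>v. \<beta> v w)) \<and>
     (\<forall>v. \<beta> v v = 0) \<and>
     (\<forall>v. (\<forall>w. \<beta> v w = 0) \<longrightarrow> v = 0)"

definition gl :: "('k::field \<Rightarrow> 'v::ab_group_add \<Rightarrow> 'v) \<Rightarrow> ('v \<Rightarrow> 'v) set" where
  "gl scl = {x. Vector_Spaces.linear scl scl x}"

definition GL :: "('k::field \<Rightarrow> 'v::ab_group_add \<Rightarrow> 'v) \<Rightarrow> ('v \<Rightarrow> 'v) monoid" where
  "GL scl = \<lparr>carrier = {g \<in> gl scl. bij g}, monoid.mult = (\<circ>), monoid.one = id\<rparr>"

definition Sp ::
    "('k::field \<Rightarrow> 'v::ab_group_add \<Rightarrow> 'v) \<Rightarrow> ('v \<Rightarrow> 'v \<Rightarrow> 'k) \<Rightarrow> ('v \<Rightarrow> 'v) monoid" where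
  "Sp scl \<beta> =
     GL scl\<lparr>carrier := {g \<in> carrier (GL scl). \<forall>v w. \<beta> (g v) (g w) = \<beta> v w}\<rparr>"

definition sp ::
    "('k::field \<Rightarrow> 'v::ab_group_add \<Rightarrow> 'v) \<Rightarrow> ('v \<Rightarrow> 'v \<Rightarrow> 'k) \<Rightarrow> ('v \<Rightarrow> 'v) set" where
  "sp scl \<beta> = {x \<in> gl scl. \<forall>v w. \<beta> (x v) w + \<beta> v (x w) = 0}"

text \<open>
  Functionals on \<open>\<gg>\<close> are extensional (\<open>undefined\<close> outside \<open>sp scl \<beta>\<close>), so that
  equality of functionals is HOL equality.
\<close>

definition sp_dual ::
    "('k::field \<Rightarrow> 'v::ab_group_add \<Rightarrow> 'v) \<Rightarrow> ('v \<Rightarrow> 'v \<Rightarrow> 'k) \<Rightarrow> (('v \<Rightarrow> 'v) \<Rightarrow> 'k) set" where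
  "sp_dual scl \<beta> =
     {\<xi> \<in> extensional (sp scl \<beta>).
        (\<forall>x \<in> sp scl \<beta>. \<forall>y \<in> sp scl \<beta>. \<xi> (\<lambda>v. x v + y v) = \<xi> x + \<xi> y) \<and>
        (\<forall>c. \<forall>x \<in> sp scl \<beta>. \<xi> (\<lambda>v. scl c (x v)) = c * \<xi> x)}"

definition coadjoint ::
    "('k::field \<Rightarrow> 'v::ab_group_add \<Rightarrow> 'v) \<Rightarrow> ('v \<Rightarrow> 'v \<Rightarrow> 'k) \<Rightarrow>
     ('v \<Rightarrow> 'v) \<Rightarrow> (('v \<Rightarrow> 'v) \<Rightarrow> 'k) \<Rightarrow> (('v \<Rightarrow> 'v) \<Rightarrow> 'k)" where
  "coadjoint scl \<beta> g \<xi> = restrict (\<lambda>x. \<xi> (inv_into UNIV g \<circ> x \<circ> g)) (sp scl \<beta>)"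

text \<open>
  Polynomial functions on the affine space \<open>\<gg>\<ll>(V)\<close>: the algebra generated by the linear
  functionals \<open>x \<mapsto> \<phi> (x v)\<close>, which span the dual of \<open>\<gg>\<ll>(V)\<close>.
\<close>

inductive_set polyfun ::
    "('k::field \<Rightarrow> 'v::ab_group_add \<Rightarrow> 'v) \<Rightarrow> (('v \<Rightarrow> 'v) \<Rightarrow> 'k) set"
  for scl :: "'k::field \<Rightarrow> 'v::ab_group_add \<Rightarrow> 'v" where
  const: "(\<lambda>x. c) \<in> polyfun scl"
| entry: "Vector_Spaces.linear scl (*) \<phi> \<Longrightarrow> (\<lambda>x. \<phi> (x v)) \<in> polyfun scl"
| add: "f \<in> polyfun scl \<Longrightarrow> h \<in> polyfun scl \<Longrightarrow> (\<lambda>x. f x + h x) \<in> polyfun scl"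
| mult: "f \<in> polyfun scl \<Longrightarrow> h \<in> polyfun scl \<Longrightarrow> (\<lambda>x. f x * h x) \<in> polyfun scl"

definition zariski ::
    "('k::field \<Rightarrow> 'v::ab_group_add \<Rightarrow> 'v) \<Rightarrow> ('v \<Rightarrow> 'v) topology" where
  "zariski scl = topology_generated_by {{x \<in> gl scl. f x \<noteq> 0} |f. f \<in> polyfun scl}"

text \<open>
  The Lie algebra of a closed subgroup \<open>H\<close> of \<open>GL(V)\<close>, as the tangent space of \<open>H\<close> at the
  identity inside \<open>\<gg>\<ll>(V)\<close>: the directions in which the derivative at \<open>id\<close> of every polynomial
  function vanishing on \<open>H\<close> is zero. For linear \<open>x\<close>, the function \<open>t \<mapsto> f (id + t x)\<close> is a
  polynomial function of \<open>t\<close>, and over an infinite field the polynomial \<open>p\<close> is unique.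
\<close>

definition Lie ::
    "('k::field \<Rightarrow> 'v::ab_group_add \<Rightarrow> 'v) \<Rightarrow> ('v \<Rightarrow> 'v) set \<Rightarrow> ('v \<Rightarrow> 'v) set" where
  "Lie scl H =
     {x \<in> gl scl. \<forall>f \<in> polyfun scl. (\<forall>h \<in> H. f h = 0) \<longrightarrow>
        (\<forall>p. (\<forall>t. f (\<lambda>v. v + scl t (x v)) = poly p t) \<longrightarrow> poly (pderiv p) 0 = 0)}"

definition closed_connected_solvable ::
    "('k::field \<Rightarrow> 'v::ab_group_add \<Rightarrow> 'v) \<Rightarrow> ('v \<Rightarrow> 'v \<Rightarrow> 'k) \<Rightarrow> ('v \<Rightarrow> 'v) set \<Rightarrow> bool" where
  "closed_connected_solvable scl \<beta> H \<longleftrightarrow>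
     subgroup H (Sp scl \<beta>) \<and>
     closedin (subtopology (zariski scl) (carrier (Sp scl \<beta>))) H \<and>
     connectedin (zariski scl) H \<and>
     solvable (Sp scl \<beta>\<lparr>carrier := H\<rparr>)"

definition borel_subgroup ::
    "('k::field \<Rightarrow> 'v::ab_group_add \<Rightarrow> 'v) \<Rightarrow> ('v \<Rightarrow> 'v \<Rightarrow> 'k) \<Rightarrow> ('v \<Rightarrow> 'v) set \<Rightarrow> bool" where
  "borel_subgroup scl \<beta> B \<longleftrightarrow>
     closed_connected_solvable scl \<beta> B \<and>
     (\<forall>H. closed_connected_solvable scl \<beta> H \<and> B \<subseteq> H \<longrightarrow> H = B)"

text \<open>
  \<open>Lie scl B\<close> is contained in \<open>sp scl \<beta>\<close> because \<open>B\<close> consists of symplectic maps.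
\<close>

definition nilpotent_dual ::
    "('k::field \<Rightarrow> 'v::ab_group_add \<Rightarrow> 'v) \<Rightarrow> ('v \<Rightarrow> 'v \<Rightarrow> 'k) \<Rightarrow> ('v \<Rightarrow> 'v) set \<Rightarrow>
     (('v \<Rightarrow> 'v) \<Rightarrow> 'k) \<Rightarrow> bool" where
  "nilpotent_dual scl \<beta> B \<xi> \<longleftrightarrow>
     (\<exists>g \<in> carrier (Sp scl \<beta>). \<forall>x \<in> Lie scl B. coadjoint scl \<beta> g \<xi> x = 0)"

definition lin_trace ::
    "('k::field \<Rightarrow> 'v::ab_group_add \<Rightarrow> 'v) \<Rightarrow> 'v set \<Rightarrow> ('v \<Rightarrow> 'v) \<Rightarrow> 'k" where
  "lin_trace scl Basis X = (\<Sum>b\<in>Basis. module.representation scl Basis (X b) b)"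

text \<open>
  The following quadratic form does not depend on the \<open>X\<close> chosen when \<open>'k\<close> has characteristic 2:
  \<open>\<beta> v (X v)\<close> is then the value of \<open>\<xi>\<close> at the element \<open>w \<mapsto> \<beta> v w \<cdot> v\<close> of \<open>sp scl \<beta>\<close>.
\<close>

definition alpha ::
    "('k::field \<Rightarrow> 'v::ab_group_add \<Rightarrow> 'v) \<Rightarrow> 'v set \<Rightarrow> ('v \<Rightarrow> 'v \<Rightarrow> 'k) \<Rightarrow>
     (('v \<Rightarrow> 'v) \<Rightarrow> 'k) \<Rightarrow> 'v \<Rightarrow> 'k" where
  "alpha scl Basis \<beta> \<xi> v =
     \<beta> v ((SOME X. X \<in> gl scl \<and> (\<forall>x \<in> sp scl \<beta>. \<xi> x = lin_trace scl Basis (X \<circ> x))) v)"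

definition beta_xi ::
    "('k::field \<Rightarrow> 'v::ab_group_add \<Rightarrow> 'v) \<Rightarrow> 'v set \<Rightarrow> ('v \<Rightarrow> 'v \<Rightarrow> 'k) \<Rightarrow>
     (('v \<Rightarrow> 'v) \<Rightarrow> 'k) \<Rightarrow> 'v \<Rightarrow> 'v \<Rightarrow> 'k" where
  "beta_xi scl Basis \<beta> \<xi> v w =
     alpha scl Basis \<beta> \<xi> (v + w) + alpha scl Basis \<beta> \<xi> v + alpha scl Basis \<beta> \<xi> w"

definition T_xi ::
    "('k::field \<Rightarrow> 'v::ab_group_add \<Rightarrow> 'v) \<Rightarrow> 'v set \<Rightarrow> ('v \<Rightarrow> 'v \<Rightarrow> 'k) \<Rightarrow>
     (('v \<Rightarrow> 'v) \<Rightarrow> 'k) \<Rightarrow> 'v \<Rightarrow> 'v" where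
  "T_xi scl Basis \<beta> \<xi> v = (THE u. \<forall>w. \<beta> u w = beta_xi scl Basis \<beta> \<xi> v w)"

text \<open>
  For nilpotent \<open>\<xi>\<close> the set of admissible \<open>i\<close> is nonempty, since \<open>T_xi\<close> is then nilpotent.
\<close>

definition index_fun ::
    "('k::field \<Rightarrow> 'v::ab_group_add \<Rightarrow> 'v) \<Rightarrow> 'v set \<Rightarrow> ('v \<Rightarrow> 'v \<Rightarrow> 'k) \<Rightarrow>
     (('v \<Rightarrow> 'v) \<Rightarrow> 'k) \<Rightarrow> nat \<Rightarrow> nat" where
  "index_fun scl Basis \<beta> \<xi> m =
     (LEAST i. \<forall>v. (T_xi scl Basis \<beta> \<xi> ^^ m) v = 0 \<longrightarrow>
                   alpha scl Basis \<beta> \<xi> ((T_xi scl Basis \<beta> \<xi> ^^ i) v) = 0)"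

definition GL_conjugate ::
    "('k::field \<Rightarrow> 'v::ab_group_add \<Rightarrow> 'v) \<Rightarrow> ('v \<Rightarrow> 'v) \<Rightarrow> ('v \<Rightarrow> 'v) \<Rightarrow> bool" where
  "GL_conjugate scl S T \<longleftrightarrow> (\<exists>h \<in> carrier (GL scl). T = h \<circ> S \<circ> inv_into UNIV h)"

end

theory Submission
  imports Defs
begin

text \<open>
  The functional \<open>\<xi>\<close> and the quadratic form \<open>\<alpha>_\<xi>\<close> carry the same information. The Lie
  algebra is spanned by the rank one maps \<open>x_v : u \<mapsto> \<beta>(v,u) v\<close>, one has
  \<open>\<alpha>_\<xi>(v) = \<xi>(x_v)\<close>, and conjugation by \<open>g\<close> takes \<open>x_v\<close> to \<open>x_{g v}\<close>. Hence \<open>\<zeta>\<close> lies in the orbit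
  of \<open>\<xi>\<close> exactly when some isometry \<open>g\<close> of \<open>\<beta>\<close> satisfies \<open>\<alpha>_\<zeta>(g v) = \<alpha>_\<xi>(v)\<close>
  (\<open>alpha_eq\<close>, \<open>dual_eqI\<close>, \<open>alpha_coadjoint\<close>). One direction of the theorem is then clear, and the
  other one is a classification of the triples \<open>(V, \<beta>, \<alpha>)\<close> with nilpotent \<open>T\<close>.

  The operator \<open>T\<close> is self-adjoint and \<open>\<beta>(T^i v, v) = 0\<close> for all \<open>i\<close>, so \<open>V\<close>, as a module over the
  polynomial ring in \<open>T\<close>, is an orthogonal sum of blocks \<open>A v + A w\<close> with \<open>A v\<close> and \<open>A w\<close>
  totally isotropic and dual to each other. On a cyclic submodule \<open>\<alpha>\<close> is semilinear:
  \<open>\<alpha>(\<Sum> c_i T^i v) = \<Sum> c_i^2 \<alpha>(T^i v)\<close>. Let \<open>m\<close> be the nilpotency degree of \<open>T\<close> and \<open>l = \<chi>(m)\<close>.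
  There is a block of length \<open>m\<close> in which \<open>\<alpha>(T^a v)\<close> is \<open>1\<close> for \<open>a = l - 1\<close> and \<open>0\<close> otherwise,
  and in which \<open>\<alpha>\<close> vanishes on all \<open>T^a w\<close>. The decisive point is the second condition: replacing \<open>w\<close> by
  \<open>w + \<Sum> c_i T^i v\<close> changes \<open>\<alpha>(T^a w)\<close> by \<open>c_{l-1-a}^2 + c_{m-2-2a}\<close>, and because
  \<open>m \<le> 2l + 1\<close> these equations form a triangular system, each step of which is linear, a
  square root or an Artin-Schreier equation (\<open>adjust_partner\<close>). Up to isometry such a block depends
  on \<open>(m, l)\<close> only.

  The block does not determine its orthogonal complement \<open>U\<close>, and the index function of \<open>U\<close> may be smaller
  than that of \<open>V\<close>. However, on kernels of powers of \<open>T\<close> the block contributes nothing beyond the values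
  \<open>l - (m - j)\<close>, and by mixing the block with a block of \<open>U\<close> one can arrange that \<open>U\<close> attains
  these values as well (\<open>adapted_pair_exists\<close>). Then the Jordan type and the index function of
  \<open>U\<close> are determined by those of \<open>V\<close> (\<open>index_on_cyclic_perp\<close>), and induction on the dimension
  produces the isometry (\<open>form_modules_isometric\<close>).

  It remains to see that \<open>T_\<xi>\<close> is nilpotent when \<open>\<xi>\<close> vanishes on the Lie algebra of a Borel subgroup
  \<open>B\<close>. By a Lie-Kolchin argument \<open>B\<close> stabilises a flag \<open>F_1 < F_2 < ...\<close> ending in a Lagrangian
  subspace (\<open>common_eigenvector\<close>, \<open>Lagrangian_flag_exists\<close>). The stabiliser of the flag is closed and
  solvable, so maximality makes \<open>B\<close> its identity component, which contains the rational curves whose tangent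
  vectors at the identity are the maps \<open>u \<mapsto> \<beta>(v,u) w + \<beta>(w,u) v\<close> with \<open>v\<close> in \<open>F_i\<close> and
  \<open>w\<close> orthogonal to \<open>F_{i-1}\<close>. The vanishing of \<open>\<xi>\<close> on them says that \<open>T_\<xi>\<close> maps \<open>F_i\<close> into
  \<open>F_{i-1}\<close>, and self-adjointness gives nilpotency on all of \<open>V\<close>
  (\<open>nilpotent_if_vanishes_on_Lie\<close>).
\<close>

section \<open>Symplectic spaces in characteristic 2\<close>

lemma infinite_UNIV_alg_closed: "infinite (UNIV :: 'k::alg_closed_field set)"
proof
  assume fin: "finite (UNIV :: 'k set)"
  define p where "p = (\<Prod>a\<in>(UNIV :: 'k set). [:-a, 1:]) + 1"
  have "degree (\<Prod>a\<in>(UNIV :: 'k set). [:-a, 1:]) = card (UNIV :: 'k set)"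
    by (subst degree_prod_eq_sum_degree) auto
  moreover have "card (UNIV :: 'k set) > 0"
    using fin by (simp add: card_gt_0_iff)
  ultimately have "degree p > 0"
    unfolding p_def by (subst degree_add_eq_left) auto
  then obtain x where "poly p x = 0"
    using alg_closed_imp_poly_has_root by blast
  moreover have "poly p x = 1"
    using fin by (simp add: p_def poly_prod)
  ultimately show False
    by simp
qed

text \<open>
  Needed because the curves considered below have a pole, so that polynomial identities are known
  only off a finite set.
\<close>
lemma poly_eq_if_cofinite:
  fixes p q :: "'k::alg_closed_field poly"
  assumes "finite S" and "\<And>t. t \<notin> S \<Longrightarrow> poly p t = poly q t"
  shows "p = q"
proof (rule ccontr)
  assume "p \<noteq> q"
  then have "finite {t. poly (p - q) t = 0}"
    by (intro poly_roots_finite) simp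
  moreover have "UNIV \<subseteq> S \<union> {t. poly (p - q) t = 0}"
    using assms(2) by auto
  ultimately show False
    using assms(1) infinite_UNIV_alg_closed by (metis finite_UnI finite_subset)
qed

locale symplectic_char2 = finite_dimensional_vector_space scl Basis
  for scl :: "'k::alg_closed_field \<Rightarrow> 'v::ab_group_add \<Rightarrow> 'v" and Basis :: "'v set" +
  fixes \<beta> :: "'v \<Rightarrow> 'v \<Rightarrow> 'k"
  assumes char2: "CHAR('k) = 2" and symp: "symplectic_form scl \<beta>"
begin

abbreviation lin :: "('v \<Rightarrow> 'v) \<Rightarrow> bool" where "lin \<equiv> Vector_Spaces.linear scl scl"
abbreviation lfun :: "('v \<Rightarrow> 'k) \<Rightarrow> bool" where "lfun \<equiv> Vector_Spaces.linear scl (*)"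

text \<open>
  The following simplification rules replace every sign by a plus and cancel equal summands, for
  scalars and for vectors.
\<close>
lemma two_eq_zero: "(1::'k) + 1 = 0"
  using of_nat_CHAR[where 'a = 'k] char2 by simp

lemma add_self [simp]: "(x::'k) + x = 0"
  using two_eq_zero by (metis distrib_left mult.right_neutral mult_zero_right)

lemma two_zero [simp]: "(2::'k) = 0"
  using two_eq_zero by (simp only: one_add_one)

lemma neg_eq [simp]: "- (x::'k) = x"
  using add_self by (metis add_eq_0_iff)

lemma diff_eq [simp]: "(x::'k) - y = x + y"
  by (metis diff_conv_add_uminus neg_eq)

lemma add_self_left [simp]: "(x::'k) + (x + y) = y"
  by (simp add: add.assoc[symmetric])

lemma add_eq_zero [simp]: "(x::'k) + y = 0 \<longleftrightarrow> x = y"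
  by (metis add_eq_0_iff neg_eq)

lemma vadd_self [simp]: "(x::'v) + x = 0"
proof -
  have "x + x = scl (1 + 1) x"
    by (simp only: scale_left_distrib scale_one)
  then show ?thesis
    by (simp only: two_eq_zero scale_zero_left)
qed

lemma vneg_eq [simp]: "- (x::'v) = x"
  using vadd_self by (metis add_eq_0_iff)

lemma vdiff_eq [simp]: "(x::'v) - y = x + y"
  by (metis diff_conv_add_uminus vneg_eq)

lemma vadd_self_left [simp]: "(x::'v) + (x + y) = y"
  by (simp add: add.assoc[symmetric])

lemma vadd_eq_zero [simp]: "(x::'v) + y = 0 \<longleftrightarrow> x = y"
  by (metis add_eq_0_iff vneg_eq)

lemma vector_space_field: "vector_space ((*) :: 'k \<Rightarrow> 'k \<Rightarrow> 'k)"
  by unfold_locales (simp_all add: algebra_simps)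

lemma functional_pair: "vector_space_pair scl ((*) :: 'k \<Rightarrow> 'k \<Rightarrow> 'k)"
  using vector_space_field vector_space_axioms by (simp add: vector_space_pair_def)

lemma linI:
  assumes "\<And>x y. f (x + y) = f x + f y" "\<And>c x. f (scl c x) = scl c (f x)"
  shows "lin f"
  using assms vector_space_axioms by (simp add: Vector_Spaces.linear_iff)

lemma lfunI:
  assumes "\<And>x y. f (x + y) = f x + f y" "\<And>c x. f (scl c x) = c * f x"
  shows "lfun f"
  using assms vector_space_axioms vector_space_field by (simp add: Vector_Spaces.linear_iff)

lemma lin_add: "lin f \<Longrightarrow> f (x + y) = f x + f y"
  and lin_scale: "lin f \<Longrightarrow> f (scl c x) = scl c (f x)"
  and lfun_add: "lfun h \<Longrightarrow> h (x + y) = h x + h y"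
  and lfun_scale: "lfun h \<Longrightarrow> h (scl c x) = c * h x"
  by (simp_all add: Vector_Spaces.linear_iff)

lemma lin_0: "lin f \<Longrightarrow> f 0 = 0"
  using lin_scale[of f 0 0] by simp

lemma lfun_0: "lfun f \<Longrightarrow> f 0 = 0"
  using lfun_scale[of f 0 0] by simp

lemma lin_sum: "lin f \<Longrightarrow> f (\<Sum>a\<in>A. g a) = (\<Sum>a\<in>A. f (g a))"
  by (induction A rule: infinite_finite_induct) (simp_all add: lin_0 lin_add)

lemma lfun_sum: "lfun f \<Longrightarrow> f (\<Sum>a\<in>A. g a) = (\<Sum>a\<in>A. f (g a))"
  by (induction A rule: infinite_finite_induct) (simp_all add: lfun_0 lfun_add)

lemma lin_id [simp]: "lin (\<lambda>x. x)" "lin id"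
  by (auto intro: linI)

lemma lin_comp: "lin f \<Longrightarrow> lin g \<Longrightarrow> lin (\<lambda>x. f (g x))"
  by (rule linI) (simp_all add: lin_add lin_scale)

lemma lin_plus: "lin f \<Longrightarrow> lin g \<Longrightarrow> lin (\<lambda>x. f x + g x)"
  by (rule linI) (simp_all add: lin_add lin_scale algebra_simps scale_right_distrib)

lemma lin_funpow: "lin f \<Longrightarrow> lin (f ^^ i)"
  by (induction i) (auto simp: o_def intro: lin_comp linI)

lemma beta_lfun: "lfun (\<lambda>w. \<beta> v w)" "lfun (\<lambda>v. \<beta> v w)"
  using symp by (auto simp: symplectic_form_def)

lemma beta_self [simp]: "\<beta> v v = 0"
  using symp by (simp add: symplectic_form_def)

lemma beta_add_right [simp]: "\<beta> v (x + y) = \<beta> v x + \<beta> v y"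
  and beta_add_left [simp]: "\<beta> (x + y) w = \<beta> x w + \<beta> y w"
  and beta_scale_right [simp]: "\<beta> v (scl c x) = c * \<beta> v x"
  and beta_scale_left [simp]: "\<beta> (scl c x) w = c * \<beta> x w"
  and beta_zero_right [simp]: "\<beta> v 0 = 0"
  and beta_zero_left [simp]: "\<beta> 0 w = 0"
  and beta_sum_right: "\<beta> v (\<Sum>a\<in>A. g a) = (\<Sum>a\<in>A. \<beta> v (g a))"
  and beta_sum_left: "\<beta> (\<Sum>a\<in>A. g a) w = (\<Sum>a\<in>A. \<beta> (g a) w)"
  using lfun_add[OF beta_lfun(1)] lfun_add[OF beta_lfun(2)] lfun_scale[OF beta_lfun(1)]
    lfun_scale[OF beta_lfun(2)] lfun_0[OF beta_lfun(1)] lfun_0[OF beta_lfun(2)]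
    lfun_sum[OF beta_lfun(1)] lfun_sum[OF beta_lfun(2)]
  by auto

lemma beta_sym: "\<beta> v w = \<beta> w v"
  using beta_self[of "v + w"] by (simp del: beta_self) simp

lemma nondegenerate: "(\<And>w. \<beta> v w = 0) \<Longrightarrow> v = 0"
  using symp by (auto simp: symplectic_form_def)

lemma beta_left_cancel: "(\<And>w. \<beta> u w = \<beta> v w) \<Longrightarrow> u = v"
  using nondegenerate[of "u + v"] by simp

lemma lfun_eq_on_Basis: "lfun f \<Longrightarrow> lfun h \<Longrightarrow> (\<And>b. b \<in> Basis \<Longrightarrow> f b = h b) \<Longrightarrow> f v = h v"
  using vector_space_pair.linear_eq_on[OF functional_pair, of f h v Basis] span_Basis by auto

text \<open>
  The linear map \<open>u \<mapsto> \<Sum> \<beta>(u,b) b\<close> over the basis is injective by nondegeneracy, hence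
  surjective, and a preimage of \<open>\<Sum> \<phi>(b) b\<close> represents \<open>\<phi>\<close>.
\<close>
lemma functional_representation:
  assumes "lfun \<phi>"
  obtains u where "\<And>v. \<phi> v = \<beta> u v"
proof -
  define \<Phi> where "\<Phi> u = (\<Sum>b\<in>Basis. scl (\<beta> u b) b)" for u
  have coeff: "(\<Sum>b\<in>Basis. scl (c b) b) = (\<Sum>b\<in>Basis. scl (d b) b) \<Longrightarrow> b \<in> Basis \<Longrightarrow> c b = d b"
    for c d and b
  proof -
    assume eq: "(\<Sum>b\<in>Basis. scl (c b) b) = (\<Sum>b\<in>Basis. scl (d b) b)" and b: "b \<in> Basis"
    have "(\<Sum>b\<in>Basis. scl (c b + d b) b) = 0"
      using eq by (simp add: scale_left_distrib sum.distrib)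
    then have "c b + d b = 0"
      using independentD[OF independent_Basis finite_Basis subset_refl _ b, of "\<lambda>b. c b + d b"] by simp
    then show "c b = d b" by simp
  qed
  have lin: "lin \<Phi>"
    by (rule linI) (simp_all add: \<Phi>_def scale_left_distrib sum.distrib scale_sum_right)
  have "inj \<Phi>"
  proof (rule injI)
    fix x y assume "\<Phi> x = \<Phi> y"
    then have "\<And>b. b \<in> Basis \<Longrightarrow> \<beta> x b = \<beta> y b"
      unfolding \<Phi>_def by (rule coeff)
    then show "x = y"
      using beta_left_cancel lfun_eq_on_Basis[OF beta_lfun(1) beta_lfun(1)] by blast
  qed
  then have "surj \<Phi>"
    using lin by (rule linear_inj_imp_surj[rotated])
  then obtain u where "\<Phi> u = (\<Sum>b\<in>Basis. scl (\<phi> b) b)"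
    by (metis surjD)
  then have "\<And>b. b \<in> Basis \<Longrightarrow> \<phi> b = \<beta> u b"
    using coeff[of "\<lambda>b. \<beta> u b" \<phi>] unfolding \<Phi>_def by simp
  then have "\<phi> v = \<beta> u v" for v
    by (rule lfun_eq_on_Basis[OF assms beta_lfun(1)])
  then show ?thesis by (rule that)
qed

lemma separating_vector:
  assumes "subspace U" "w \<notin> U"
  obtains u where "\<And>x. x \<in> U \<Longrightarrow> \<beta> u x = 0" "\<beta> u w = 1"
proof -
  obtain C where C: "C \<subseteq> U" "independent C" "U \<subseteq> span C"
    using basis_exists by metis
  have "span C = U"
    using C assms(1) by (metis span_minimal subset_antisym)
  then have "independent (insert w C)"
    using C assms(2) by (intro independent_insertI) auto
  then obtain \<phi> where \<phi>: "lfun \<phi>" "\<forall>x\<in>insert w C. \<phi> x = (if x = w then 1 else 0)"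
    using vector_space_pair.linear_independent_extend[OF functional_pair, of "insert w C" "\<lambda>x. if x = w then 1 else 0"] by auto
  obtain u where u: "\<And>v. \<phi> v = \<beta> u v"
    using functional_representation[OF \<phi>(1)] by metis
  have "\<phi> x = 0" if "x \<in> C" for x
    using that \<phi>(2) C assms(2) by auto
  then have "\<beta> u x = 0" if "x \<in> U" for x
    using vector_space_pair.linear_eq_0_on_span[OF functional_pair \<phi>(1), of C x] that C u by auto
  then show ?thesis
    using that \<phi>(2) u by (metis insertI1)
qed

definition perp :: "'v set \<Rightarrow> 'v set" where
  "perp U = {v. \<forall>u\<in>U. \<beta> v u = 0}"

lemma subspace_perp: "subspace (perp U)"
  by (auto simp: perp_def subspace_def)

lemma perp_perp:
  assumes U: "subspace U" shows "perp (perp U) = U"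
proof
  show "perp (perp U) \<subseteq> U"
  proof
    fix w assume w: "w \<in> perp (perp U)"
    show "w \<in> U"
    proof (rule ccontr)
      assume "w \<notin> U"
      then obtain u where u: "\<And>x. x \<in> U \<Longrightarrow> \<beta> u x = 0" "\<beta> u w = 1"
        using separating_vector[OF U] by metis
      then have "\<beta> w u = 0"
        using w by (simp add: perp_def)
      then show False
        using u(2) beta_sym[of w u] by simp
    qed
  qed
  show "U \<subseteq> perp (perp U)"
    unfolding perp_def by (auto intro: trans[OF beta_sym])
qed

end

section \<open>Normal pairs in form modules\<close>

text \<open>
  The equation with number \<open>k\<close> involves only unknowns up to index \<open>p k\<close> and can be solved for that last unknown;
  unknowns outside the range of \<open>p\<close> are free. The successive choices do not disturb earlier equations
  since \<open>p\<close> is strictly increasing.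
\<close>
lemma triangular_system_solvable:
  fixes p :: "nat \<Rightarrow> nat" and Q :: "nat \<Rightarrow> (nat \<Rightarrow> 'a) \<Rightarrow> bool"
  assumes mono: "\<And>j k. j < k \<Longrightarrow> k < N \<Longrightarrow> p j < p k"
    and dep: "\<And>k c d. k < N \<Longrightarrow> (\<And>i. i \<le> p k \<Longrightarrow> c i = d i) \<Longrightarrow> Q k c \<Longrightarrow> Q k d"
    and solv: "\<And>k c. k < N \<Longrightarrow> \<exists>x. Q k (c(p k := x))"
  shows "\<exists>c. \<forall>k<N. Q k c"
  using assms
proof (induction N)
  case (Suc N)
  then obtain c where c: "\<forall>k<N. Q k c"
    by (metis less_SucI)
  obtain x where x: "Q N (c(p N := x))"
    using Suc.prems(3)[of N c] by blast
  have "Q k (c(p N := x))" if "k < N" for k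
  proof (rule Suc.prems(2)[of k c])
    show "c i = (c(p N := x)) i" if "i \<le> p k" for i
      using Suc.prems(1)[OF \<open>k < N\<close>] that by auto
  qed (use c that in auto)
  then show ?case
    using x less_Suc_eq by metis
qed auto

text \<open>
  A sequence that ends at a nonzero entry generates, under shifting, the same module as the sequence
  with a single \<open>1\<close> at that place; \<open>d\<close> is the coefficient sequence of the unit of the power series ring
  that carries one to the other.
\<close>
lemma unit_multiplier:
  fixes s :: "nat \<Rightarrow> 'a::field"
  assumes "s n \<noteq> 0"
  obtains d where "\<And>a. a \<le> n \<Longrightarrow> (\<Sum>i\<le>n - a. d i * s (a + i)) = (if a = n then 1 else 0)"
proof -
  define Q where "Q k d \<longleftrightarrow> (\<Sum>i\<le>k. d i * s (n - k + i)) = (if k = 0 then 1 else 0)" for k d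
  have "\<exists>d. \<forall>k<Suc n. Q k d"
  proof (rule triangular_system_solvable[where p = id])
    fix k and c d :: "nat \<Rightarrow> 'a"
    assume "\<And>i. i \<le> id k \<Longrightarrow> c i = d i" and "Q k c"
    then show "Q k d"
      unfolding Q_def by (metis (no_types, lifting) atMost_iff id_apply sum.cong)
  next
    fix k and c :: "nat \<Rightarrow> 'a" assume k: "k < Suc n"
    define r where "r = (\<Sum>i<k. c i * s (n - k + i))"
    have "(\<Sum>i\<le>k. (c(k := x)) i * s (n - k + i)) = r + x * s n" for x
    proof -
      have "(\<Sum>i\<le>k. (c(k := x)) i * s (n - k + i))
          = (\<Sum>i<k. (c(k := x)) i * s (n - k + i)) + x * s n"
        using k by (simp add: lessThan_Suc_atMost[symmetric])
      then show ?thesis by (simp add: r_def)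
    qed
    then have "Q k (c(k := ((if k = 0 then 1 else 0) - r) / s n))"
      using assms by (simp add: Q_def)
    then show "\<exists>x. Q k (c(id k := x))" by auto
  qed simp
  then obtain d where d: "\<forall>k<Suc n. Q k d" by blast
  have "(\<Sum>i\<le>n - a. d i * s (a + i)) = (if a = n then 1 else 0)" if "a \<le> n" for a
    using d[rule_format, of "n - a"] that by (auto simp: Q_def)
  then show ?thesis by (rule that)
qed

lemma ex_sqrt: "\<exists>x::'k::alg_closed_field. x ^ 2 = c"
  using alg_closed_imp_poly_has_root[of "[:-c, 0, 1:]"] by (auto simp: power2_eq_square)

lemma ex_artin_schreier: "\<exists>x::'k::alg_closed_field. x ^ 2 + x = c"
  using alg_closed_imp_poly_has_root[of "[:-c, 1, 1:]"] by (auto simp: power2_eq_square algebra_simps)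

context symplectic_char2
begin

text \<open>
  The pairings inside the cyclic module of \<open>v\<close>, and inside that of \<open>w\<close>, vanish for the operators
  considered here (\<open>beta_P_P_self\<close>), so this fixes the form on the sum of the two modules.
\<close>
definition hyperbolic_pair :: "('v \<Rightarrow> 'v) \<Rightarrow> nat \<Rightarrow> 'v \<Rightarrow> 'v \<Rightarrow> bool" where
  "hyperbolic_pair T m v w \<longleftrightarrow> (T ^^ m) v = 0 \<and> (T ^^ m) w = 0 \<and>
     (\<forall>a. \<beta> ((T ^^ a) v) w = (if Suc a = m then 1 else 0))"

definition cyclic_perp :: "('v \<Rightarrow> 'v) \<Rightarrow> 'v set \<Rightarrow> 'v \<Rightarrow> 'v \<Rightarrow> 'v set" where
  "cyclic_perp T U v w = {u \<in> U. \<forall>a. \<beta> ((T ^^ a) v) u = 0 \<and> \<beta> ((T ^^ a) w) u = 0}"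

text \<open>
  The submodule generated by \<open>v\<close> and \<open>w\<close>, parametrised by coefficient sequences. All formulas
  about a block are expressed through these sequences, so that blocks of two different form modules can be
  compared by using the same sequences.
\<close>
definition comb :: "('v \<Rightarrow> 'v) \<Rightarrow> nat \<Rightarrow> 'v \<Rightarrow> 'v \<Rightarrow> (nat \<Rightarrow> 'k) \<Rightarrow> (nat \<Rightarrow> 'k) \<Rightarrow> 'v" where
  "comb T m v w c d = (\<Sum>a<m. scl (c a) ((T ^^ a) v)) + (\<Sum>a<m. scl (d a) ((T ^^ a) w))"

definition nilp_degree :: "('v \<Rightarrow> 'v) \<Rightarrow> 'v set \<Rightarrow> nat" where
  "nilp_degree T U = (LEAST m. \<forall>u\<in>U. (T ^^ m) u = 0)"

text \<open>
  The index function of a submodule, so that it can be followed through orthogonal decompositions.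
\<close>
definition index_on :: "('v \<Rightarrow> 'k) \<Rightarrow> ('v \<Rightarrow> 'v) \<Rightarrow> 'v set \<Rightarrow> nat \<Rightarrow> nat" where
  "index_on \<alpha> T U j = (LEAST i. \<forall>v\<in>U. (T ^^ j) v = 0 \<longrightarrow> \<alpha> ((T ^^ i) v) = 0)"

definition nondeg_submodule :: "('v \<Rightarrow> 'v) \<Rightarrow> 'v set \<Rightarrow> bool" where
  "nondeg_submodule T U \<longleftrightarrow> subspace U \<and> (\<forall>u\<in>U. T u \<in> U) \<and>
     (\<forall>u\<in>U. (\<forall>w\<in>U. \<beta> u w = 0) \<longrightarrow> u = 0)"

lemma comb_add: "comb T m v w c d + comb T m v w c' d' = comb T m v w (\<lambda>a. c a + c' a) (\<lambda>a. d a + d' a)"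
  by (simp add: comb_def scale_left_distrib sum.distrib algebra_simps)

lemma comb_scale: "scl x (comb T m v w c d) = comb T m v w (\<lambda>a. x * c a) (\<lambda>a. x * d a)"
  by (simp add: comb_def scale_sum_right scale_right_distrib)

end

locale form_module = symplectic_char2 scl Basis \<beta>
  for scl :: "'k::alg_closed_field \<Rightarrow> 'v::ab_group_add \<Rightarrow> 'v" and Basis :: "'v set"
    and \<beta> :: "'v \<Rightarrow> 'v \<Rightarrow> 'k" +
  fixes \<alpha> :: "'v \<Rightarrow> 'k" and T :: "'v \<Rightarrow> 'v"
  assumes lin_T: "lin T"
    and alpha_scale: "\<alpha> (scl c v) = c ^ 2 * \<alpha> v"
    and alpha_add: "\<alpha> (v + w) = \<alpha> v + \<alpha> w + \<beta> (T v) w"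
    and nilpotent_T: "\<exists>N. \<forall>v. (T ^^ N) v = 0"
begin

abbreviation P :: "nat \<Rightarrow> 'v \<Rightarrow> 'v" where "P i \<equiv> T ^^ i"

lemma lin_P: "lin (P i)"
  by (rule lin_funpow[OF lin_T])

lemmas P_add [simp] = lin_add[OF lin_P] and P_scale [simp] = lin_scale[OF lin_P]
  and P_zero [simp] = lin_0[OF lin_P] and P_sum = lin_sum[OF lin_P]
lemmas T_add [simp] = lin_add[OF lin_T] and T_scale [simp] = lin_scale[OF lin_T]
  and T_zero [simp] = lin_0[OF lin_T] and T_sum = lin_sum[OF lin_T]

lemma P_P: "P i (P j v) = P (i + j) v"
  by (simp add: funpow_add)

lemma P_T: "P i (T v) = P (Suc i) v"
  by (simp add: funpow_swap1)

lemma alpha_zero [simp]: "\<alpha> 0 = 0"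
  using alpha_scale[of 0 0] by simp

lemma beta_T_self [simp]: "\<beta> (T v) v = 0"
  using alpha_add[of v v] by simp

lemma beta_T_sym: "\<beta> (T v) w = \<beta> v (T w)"
proof -
  have "\<beta> (T v) w = \<beta> (T w) v"
    using alpha_add[of v w] alpha_add[of w v] by (simp add: add.commute)
  then show ?thesis by (simp add: beta_sym)
qed

lemma beta_P_sym: "\<beta> (P i v) w = \<beta> v (P i w)"
proof (induction i arbitrary: w)
  case (Suc i)
  show ?case
    using Suc[of "T w"] by (simp add: beta_T_sym P_T)
qed simp

lemma beta_P_P: "\<beta> (P i v) (P j w) = \<beta> (P (i + j) v) w"
  using beta_P_sym[of j "P i v" w] by (simp add: P_P add.commute)

lemma beta_P_swap: "\<beta> (P i w) v = \<beta> (P i v) w"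
  by (metis beta_P_sym beta_sym)

text \<open>
  For even \<open>i\<close> this is the alternating property of \<open>\<beta>\<close>, for odd \<open>i\<close> that of the
  polarisation \<open>\<beta>(T v, w)\<close> of \<open>\<alpha>\<close>, after half of the powers has been moved to the other side.
\<close>
lemma beta_P_self [simp]: "\<beta> (P i v) v = 0"
proof (cases "even i")
  case True
  then obtain j where "i = j + j" by (metis evenE mult_2)
  then show ?thesis using beta_P_P[of j v j v] by simp
next
  case False
  then obtain j where "i = Suc (j + j)" by (metis oddE mult_2 Suc_eq_plus1)
  then have "\<beta> (P i v) v = \<beta> (T (P j v)) (P j v)"
    using beta_P_P[of "Suc j" v j v] by simp
  then show ?thesis by simp
qed

lemma beta_P_P_self [simp]: "\<beta> (P i v) (P j v) = 0"
  by (simp add: beta_P_P)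

lemma P_large: "P m v = 0 \<Longrightarrow> m \<le> i \<Longrightarrow> P i v = 0"
  using P_P[of "i - m" m v] by simp

lemma alpha_P_add: "\<alpha> (P i (v + w)) = \<alpha> (P i v) + \<alpha> (P i w) + \<beta> (P (Suc (2 * i)) v) w"
  using beta_P_P[of "Suc i" v i w] by (simp add: alpha_add mult_2)

text \<open>
  The polarisation of \<open>\<alpha>\<close> vanishes on a cyclic submodule, so \<open>\<alpha>\<close> is semilinear there.
\<close>
lemma alpha_polynomial:
  "\<alpha> (P a (\<Sum>i<n. scl (c i) (P i x))) = (\<Sum>i<n. c i ^ 2 * \<alpha> (P (a + i) x))"
proof (induction n)
  case (Suc n)
  have "\<beta> (P (Suc (2 * a)) (\<Sum>i<n. scl (c i) (P i x))) (scl (c n) (P n x)) = 0"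
    by (simp add: P_sum beta_sum_left P_P del: funpow.simps)
  then show ?case
    using Suc by (simp add: alpha_P_add alpha_scale P_P del: P_add funpow.simps)
qed simp

lemma nilp_degree_zero: "u \<in> U \<Longrightarrow> nilp_degree T U \<le> i \<Longrightarrow> P i u = 0"
proof -
  assume u: "u \<in> U" "nilp_degree T U \<le> i"
  have "\<forall>u\<in>U. P (nilp_degree T U) u = 0"
    unfolding nilp_degree_def by (rule LeastI_ex) (use nilpotent_T in blast)
  then show ?thesis using u P_large by blast
qed

lemma nilp_degree_le: "(\<And>u. u \<in> U \<Longrightarrow> P i u = 0) \<Longrightarrow> nilp_degree T U \<le> i"
  unfolding nilp_degree_def by (rule Least_le) blast

lemma nilp_degree_witness:
  assumes "i < nilp_degree T U" obtains u where "u \<in> U" "P i u \<noteq> 0"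
  using assms nilp_degree_le[of U i] by (meson not_less)

lemma submodule_P: "nondeg_submodule T U \<Longrightarrow> u \<in> U \<Longrightarrow> P i u \<in> U"
  by (induction i) (auto simp: nondeg_submodule_def)

lemma index_on_ex: "\<exists>i. \<forall>v\<in>U. P j v = 0 \<longrightarrow> \<alpha> (P i v) = 0"
  using P_large[of j _ j] by (intro exI[of _ j]) auto

text \<open>
  The vanishing condition in the definition of the index persists for larger exponents, because
  kernels of powers of \<open>T\<close> are \<open>T\<close>-stable.
\<close>
lemma index_on_zero:
  assumes U: "nondeg_submodule T U" and v: "v \<in> U" "P j v = 0" "index_on \<alpha> T U j \<le> i"
  shows "\<alpha> (P i v) = 0"
proof -
  have "\<forall>v\<in>U. P j v = 0 \<longrightarrow> \<alpha> (P (index_on \<alpha> T U j) v) = 0"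
    unfolding index_on_def by (rule LeastI_ex[OF index_on_ex])
  moreover have "P j (P (i - index_on \<alpha> T U j) v) = 0"
    using v(2) P_large[OF v(2)] by (simp add: P_P)
  ultimately have "\<alpha> (P (index_on \<alpha> T U j) (P (i - index_on \<alpha> T U j) v)) = 0"
    using submodule_P[OF U v(1)] by blast
  then show ?thesis using v(3) by (simp add: P_P)
qed

lemma index_on_le: "(\<And>v. v \<in> U \<Longrightarrow> P j v = 0 \<Longrightarrow> \<alpha> (P i v) = 0) \<Longrightarrow> index_on \<alpha> T U j \<le> i"
  unfolding index_on_def by (rule Least_le) blast

lemma index_on_witness:
  assumes "i < index_on \<alpha> T U j" obtains v where "v \<in> U" "P j v = 0" "\<alpha> (P i v) \<noteq> 0"
  using assms index_on_le[of U j i] by (meson not_less)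

lemma index_on_le_self: "index_on \<alpha> T U j \<le> j"
  by (rule index_on_le) simp

lemma index_on_stable:
  assumes "nilp_degree T U \<le> j"
  shows "index_on \<alpha> T U j = index_on \<alpha> T U (nilp_degree T U)"
  unfolding index_on_def using nilp_degree_zero[of _ U] assms by (metis (no_types, lifting) order_refl)

lemma hyperbolic_pair_sym: "hyperbolic_pair T m v w \<Longrightarrow> hyperbolic_pair T m w v"
  by (simp add: hyperbolic_pair_def beta_P_swap)

lemma hyperbolic_pair_beta:
  assumes "hyperbolic_pair T m v w"
  shows "\<beta> (P a v) (P b w) = (if Suc (a + b) = m then 1 else 0)"
    and "\<beta> (P a w) (P b v) = (if Suc (a + b) = m then 1 else 0)"
  using assms hyperbolic_pair_sym[OF assms] by (simp_all add: beta_P_P hyperbolic_pair_def)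

lemma comb_pairing:
  assumes "hyperbolic_pair T m v w" "b < m"
  shows "\<beta> (comb T m v w c d) (P (m - 1 - b) w) = c b"
    and "\<beta> (comb T m v w c d) (P (m - 1 - b) v) = d b"
proof -
  have *: "Suc (a + (m - 1 - b)) = m \<longleftrightarrow> a = b" if "a < m" for a
    using assms(2) that by auto
  have eq: "(\<Sum>a<m. c a * (if Suc (a + (m - 1 - b)) = m then 1 else 0)) = c b" for c :: "nat \<Rightarrow> 'k"
    using assms(2) by (subst sum.cong[OF refl, of _ _ "\<lambda>a. if a = b then c b else 0"]) (auto simp: *)
  show "\<beta> (comb T m v w c d) (P (m - 1 - b) w) = c b"
    and "\<beta> (comb T m v w c d) (P (m - 1 - b) v) = d b"
    unfolding comb_def beta_add_left beta_sum_left beta_scale_left hyperbolic_pair_beta[OF assms(1)]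
      beta_P_P_self eq by simp_all
qed

lemma beta_sum_sum:
  "\<beta> (\<Sum>a<m. scl (c a) (f a)) (\<Sum>b<n. scl (d b) (g b)) = (\<Sum>a<m. \<Sum>b<n. c a * d b * \<beta> (f a) (g b))"
  by (subst beta_sum_left, subst beta_sum_right, subst beta_scale_left, subst beta_scale_right,
      subst mult.assoc) (rule refl)

text \<open>
  The right-hand side mentions neither \<open>v\<close> and \<open>w\<close> nor \<open>T\<close>: the form on a block is
  determined by its length. The next lemma has the same purpose for \<open>\<alpha>\<close>.
\<close>
lemma comb_beta:
  assumes "hyperbolic_pair T m v w"
  shows "\<beta> (comb T m v w c d) (comb T m v w c' d')
    = (\<Sum>a<m. \<Sum>b<m. c a * d' b * (if Suc (a + b) = m then 1 else 0))
    + (\<Sum>a<m. \<Sum>b<m. d a * c' b * (if Suc (a + b) = m then 1 else 0))"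
  unfolding comb_def beta_add_left beta_add_right beta_sum_sum hyperbolic_pair_beta[OF assms] by simp

lemma comb_alpha:
  assumes "hyperbolic_pair T m v w"
    and "\<And>a. \<alpha> (P a v) = (if Suc a = l then 1 else 0)" "\<And>a. \<alpha> (P a w) = 0"
  shows "\<alpha> (comb T m v w c d) = (\<Sum>a<m. c a ^ 2 * (if Suc a = l then 1 else 0))
    + (\<Sum>a<m. \<Sum>b<m. c a * d b * (if Suc (Suc a + b) = m then 1 else 0))"
proof -
  have T: "T (\<Sum>a<m. scl (c a) (P a v)) = (\<Sum>a<m. scl (c a) (P (Suc a) v))"
    by (simp add: T_sum)
  have \<alpha>: "\<alpha> (\<Sum>a<m. scl (c a) (P a x)) = (\<Sum>a<m. c a ^ 2 * \<alpha> (P a x))" for c x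
    using alpha_polynomial[of 0] by simp
  have "(\<Sum>a<m. d a ^ 2 * \<alpha> (P a w)) = 0"
    using assms(3) by simp
  then show ?thesis
    unfolding comb_def alpha_add T beta_sum_sum hyperbolic_pair_beta(1)[OF assms(1)] \<alpha> assms(2) by simp
qed

text \<open>
  The operator \<open>T\<close> shifts coefficient sequences; the top coefficient is lost because \<open>T^m\<close> kills
  both generators.
\<close>
lemma T_comb:
  assumes "P m v = 0" "P m w = 0"
  shows "T (comb T m v w c d) = comb T m v w (case_nat 0 c) (case_nat 0 d)"
proof -
  have "T (\<Sum>a<m. scl (c a) (P a x)) = (\<Sum>a<m. scl (case_nat 0 c a) (P a x))"
    if "P m x = 0" for c x
  proof -
    have "(\<Sum>a<m. scl (case_nat 0 c a) (P a x)) = (\<Sum>a<Suc m. scl (case_nat 0 c a) (P a x))"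
      using that by simp
    also have "\<dots> = (\<Sum>a<m. scl (c a) (P (Suc a) x))"
      by (subst sum.lessThan_Suc_shift) simp
    finally show ?thesis by (simp add: T_sum)
  qed
  then show ?thesis using assms by (simp add: comb_def)
qed

lemma P_comb:
  assumes "P m v = 0" "P m w = 0"
  shows "P j (comb T m v w c d) = comb T m v w ((case_nat 0 ^^ j) c) ((case_nat 0 ^^ j) d)"
  using assms by (induction j) (simp_all add: T_comb)

lemma comb_orthogonal:
  assumes "u \<in> cyclic_perp T U v w"
  shows "\<beta> (comb T m v w c d) u = 0"
  using assms by (simp add: comb_def cyclic_perp_def beta_sum_left)

lemma comb_mem:
  assumes U: "nondeg_submodule T U" and "v \<in> U" "w \<in> U"
  shows "comb T m v w c d \<in> U"
proof -
  have sub: "subspace U"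
    using U by (simp add: nondeg_submodule_def)
  have "(\<Sum>a<m. scl (e a) (P a x)) \<in> U" if "x \<in> U" for e x
    by (rule subspace_sum[OF sub], rule subspace_scale[OF sub], rule submodule_P[OF U that])
  then show ?thesis
    unfolding comb_def using assms(2,3) subspace_add[OF sub] by blast
qed

(* From here on powers of T stay folded, so that the rules for pairings of powers apply. *)
declare funpow.simps(2) [simp del]

lemma shift_power: "(case_nat 0 ^^ r) (c :: nat \<Rightarrow> 'k) a = (if a < r then 0 else c (a - r))"
  by (induction r arbitrary: a) (auto simp: funpow.simps(2) split: nat.split)

lemma cyclic_perp_mem:
  "u \<in> cyclic_perp T U v w \<longleftrightarrow> u \<in> U \<and> (\<forall>a. \<beta> (P a v) u = 0) \<and> (\<forall>a. \<beta> (P a w) u = 0)"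
  by (auto simp: cyclic_perp_def)

text \<open>
  Nondegeneracy gives \<open>w\<close> that pairs nontrivially with \<open>T^n v\<close>; a unit multiple of it has the
  required pairings.
\<close>
lemma hyperbolic_partner:
  assumes U: "nondeg_submodule T U" and v: "v \<in> U" "P n v \<noteq> 0"
    and m: "\<And>u. u \<in> U \<Longrightarrow> P (Suc n) u = 0"
  obtains w where "w \<in> U" "hyperbolic_pair T (Suc n) v w"
proof -
  have "P n v \<in> U"
    using submodule_P[OF U v(1)] .
  then obtain w0 where w0: "w0 \<in> U" "\<beta> (P n v) w0 \<noteq> 0"
    using U v(2) by (auto simp: nondeg_submodule_def)
  obtain d where d: "\<And>a. a \<le> n \<Longrightarrow> (\<Sum>i\<le>n - a. d i * \<beta> (P (a + i) v) w0) = (if a = n then 1 else 0)"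
    using unit_multiplier[of "\<lambda>i. \<beta> (P i v) w0" n] w0(2) by blast
  define w where "w = (\<Sum>i<Suc n. scl (d i) (P i w0))"
  have sub: "subspace U"
    using U by (simp add: nondeg_submodule_def)
  have w: "w \<in> U"
    unfolding w_def by (rule subspace_sum[OF sub], rule subspace_scale[OF sub], rule submodule_P[OF U w0(1)])
  have "\<beta> (P a v) w = (if Suc a = Suc n then 1 else 0)" for a
  proof (cases "a \<le> n")
    case True
    have "\<beta> (P a v) w = (\<Sum>i<Suc n. d i * \<beta> (P (a + i) v) w0)"
      unfolding w_def beta_sum_right beta_scale_right beta_P_P ..
    also have "\<dots> = (\<Sum>i\<le>n - a. d i * \<beta> (P (a + i) v) w0)"
    proof (rule sum.mono_neutral_right)
      show "\<forall>i\<in>{..<Suc n} - {..n - a}. d i * \<beta> (P (a + i) v) w0 = 0"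
        using P_large[OF m[OF v(1)]] by (auto simp: not_le)
    qed auto
    finally show ?thesis
      using d[OF True] by simp
  next
    case False
    then show ?thesis
      using P_large[OF m[OF v(1)], of a] by simp
  qed
  then have "hyperbolic_pair T (Suc n) v w"
    using m[OF v(1)] m[OF w] unfolding hyperbolic_pair_def by blast
  then show ?thesis using that w by blast
qed

text \<open>
  If \<open>\<alpha>(T^l u) = 0\<close> for all \<open>u\<close>, then polarising gives \<open>\<beta>(T^(2l+1) u, w) = 0\<close>, so
  \<open>T^(2l+1) = 0\<close>. This is the inequality that makes the equations in \<open>adjust_partner\<close> solvable.
\<close>
lemma nilp_degree_le_index:
  assumes U: "nondeg_submodule T U"
  defines "m \<equiv> nilp_degree T U"
  shows "m \<le> 2 * index_on \<alpha> T U m + 1"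
proof -
  define l where "l = index_on \<alpha> T U m"
  have sub: "subspace U"
    using U by (simp add: nondeg_submodule_def)
  have z: "\<alpha> (P l u) = 0" if "u \<in> U" for u
    using index_on_zero[OF U that, of m l] nilp_degree_zero[OF that] by (simp add: l_def m_def)
  have "P (Suc (2 * l)) u = 0" if u: "u \<in> U" for u
  proof -
    have "\<beta> (P (Suc (2 * l)) u) w = 0" if w: "w \<in> U" for w
      using alpha_P_add[of l u w] z[OF u] z[OF w] z[OF subspace_add[OF sub u w]] by simp
    then show ?thesis
      using U submodule_P[OF U u] unfolding nondeg_submodule_def by blast
  qed
  then show ?thesis
    using nilp_degree_le[of U "Suc (2 * l)"] by (simp add: m_def l_def)
qed

text \<open>
  A vector where the index is attained need not generate a block of maximal length. Adding it to a
  generator works unless the index has its smallest possible value; in that case \<open>T w\<close>, for a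
  suitable \<open>w\<close>, can be added instead.
\<close>
lemma generator_attaining_index:
  assumes U: "nondeg_submodule T U" and m: "nilp_degree T U = Suc n"
  obtains v where "v \<in> U" "P n v \<noteq> 0"
    "index_on \<alpha> T U (Suc n) = Suc q \<Longrightarrow> \<alpha> (P q v) \<noteq> 0"
proof (cases "index_on \<alpha> T U (Suc n) = Suc q")
  case False
  obtain v where "v \<in> U" "P n v \<noteq> 0"
    using nilp_degree_witness[of n U] m by auto
  then show ?thesis
    using that False by blast
next
  case True
  have kill: "P (Suc n) u = 0" if "u \<in> U" for u
    using nilp_degree_zero[OF that, of "Suc n"] m by (simp)
  have sub: "subspace U"
    using U by (simp add: nondeg_submodule_def)
  obtain x where x: "x \<in> U" "\<alpha> (P q x) \<noteq> 0"
    using index_on_witness[of q U "Suc n"] True by auto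
  obtain v0 where v0: "v0 \<in> U" "P n v0 \<noteq> 0"
    using nilp_degree_witness[of n U] m by auto
  have le: "n \<le> 2 * q + 2"
    using nilp_degree_le_index[OF U] m True by simp
  (* In the third case the cross term beta(T^(2q+1) x, v0) vanishes; in the fourth it may not,
     and n = 2 q + 2 is the only possibility left by le. *)
  consider "\<alpha> (P q v0) \<noteq> 0" | "P n x \<noteq> 0"
    | "\<alpha> (P q v0) = 0" "P n x = 0" "n \<le> 2 * q + 1"
    | "\<alpha> (P q v0) = 0" "n = 2 * q + 2"
    using le by linarith
  then show ?thesis
  proof cases
    case 1
    then show ?thesis using that v0 by blast
  next
    case 2
    then show ?thesis using that x by blast
  next
    case 3
    have "P (Suc (2 * q)) x = 0"
      using P_large[OF 3(2), of "Suc (2 * q)"] 3(3) by simp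
    then have "\<alpha> (P q (x + v0)) \<noteq> 0"
      using 3(1) x(2) unfolding alpha_P_add by simp
    moreover have "P n (x + v0) \<noteq> 0"
      using 3(2) v0(2) by simp
    ultimately show ?thesis
      using that[of "x + v0"] subspace_add[OF sub x(1) v0(1)] by blast
  next
    case 4
    obtain w where w: "w \<in> U" "\<beta> (P n v0) w \<noteq> 0"
      using U v0(2) submodule_P[OF U v0(1), of n] unfolding nondeg_submodule_def by blast
    have Tw: "T w \<in> U"
      using U w(1) by (simp add: nondeg_submodule_def)
    have "P n (T w) = 0"
      using kill[OF w(1)] by (simp add: P_T)
    then have ne: "P n (v0 + T w) \<noteq> 0"
      using v0(2) by simp
    have "\<alpha> (P q (T w)) = 0"
      using index_on_zero[OF U w(1) kill[OF w(1)], of "Suc q"] True by (simp add: P_T)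
    then have "\<alpha> (P q (v0 + T w)) = \<beta> (P (Suc (2 * q)) v0) (T w)"
      using 4(1) unfolding alpha_P_add by simp
    also have "\<dots> = \<beta> (P n v0) w"
      using 4(2) by (simp add: beta_T_sym[symmetric] funpow.simps(2))
    finally have "\<alpha> (P q (v0 + T w)) \<noteq> 0"
      using w(2) by (simp del: P_add)
    then show ?thesis
      using ne that[of "v0 + T w"] subspace_add[OF sub v0(1) Tw] by blast
  qed
qed

text \<open>
  Multiplication by a unit normalises the sequence \<open>\<alpha>(T^a v)\<close>. Since \<open>\<alpha>\<close> is semilinear on
  the cyclic submodule, the coefficients of this unit are square roots of those in \<open>unit_multiplier\<close>.
\<close>
lemma normalised_generator:
  assumes U: "nondeg_submodule T U" and m: "nilp_degree T U = Suc n"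
    and l: "index_on \<alpha> T U (Suc n) = l"
  obtains v where "v \<in> U" "P n v \<noteq> 0" "\<And>a. \<alpha> (P a v) = (if Suc a = l then 1 else 0)"
proof -
  obtain v where v: "v \<in> U" "P n v \<noteq> 0" "l \<noteq> 0 \<Longrightarrow> \<alpha> (P (l - 1) v) \<noteq> 0"
    using generator_attaining_index[OF U m, of "l - 1"] l by (metis Suc_pred' neq0_conv)
  have kill: "P (Suc n) u = 0" if "u \<in> U" for u
    using nilp_degree_zero[OF that, of "Suc n"] m by (simp)
  have vanish: "\<alpha> (P a u) = 0" if "u \<in> U" "l \<le> a" for u a
    using index_on_zero[OF U that(1) kill[OF that(1)], of a] that(2) l by simp
  show ?thesis
  proof (cases l)
    case 0
    then show ?thesis using that[OF v(1,2)] vanish[OF v(1)] by simp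
  next
    case (Suc q)
    obtain e where e: "\<And>a. a \<le> q \<Longrightarrow> (\<Sum>i\<le>q - a. e i * \<alpha> (P (a + i) v)) = (if a = q then 1 else 0)"
      using unit_multiplier[of "\<lambda>i. \<alpha> (P i v)" q] v(3) Suc by auto
    define d where "d i = (SOME x. x ^ 2 = e i)" for i
    have d: "d i ^ 2 = e i" for i
      unfolding d_def by (rule someI_ex[OF ex_sqrt])
    define v' where "v' = (\<Sum>i<Suc q. scl (d i) (P i v))"
    have sub: "subspace U"
      using U by (simp add: nondeg_submodule_def)
    have v': "v' \<in> U"
      unfolding v'_def by (rule subspace_sum[OF sub], rule subspace_scale[OF sub], rule submodule_P[OF U v(1)])
    have "\<alpha> (P a v') = (if Suc a = l then 1 else 0)" for a
    proof (cases "a \<le> q")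
      case True
      have "\<alpha> (P a v') = (\<Sum>i<Suc q. e i * \<alpha> (P (a + i) v))"
        unfolding v'_def alpha_polynomial d ..
      also have "\<dots> = (\<Sum>i\<le>q - a. e i * \<alpha> (P (a + i) v))"
      proof (rule sum.mono_neutral_right)
        show "\<forall>i\<in>{..<Suc q} - {..q - a}. e i * \<alpha> (P (a + i) v) = 0"
          using vanish[OF v(1)] Suc by (auto simp: not_le)
      qed auto
      finally show ?thesis
        using e[OF True] Suc by simp
    next
      case False
      then show ?thesis using vanish[OF v', of a] Suc by simp
    qed
    moreover have "P n v' \<noteq> 0"
    proof -
      have "e 0 * \<alpha> (P q v) = 1"
        using e[of q] by simp
      then have "d 0 \<noteq> 0"
        using d[of 0] by auto
      moreover have "P (n + Suc i) v = 0" for i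
        using P_large[OF kill[OF v(1)], of "n + Suc i"] by simp
      then have "P n v' = scl (d 0) (P n v)"
        unfolding v'_def P_sum P_scale P_P by (subst sum.lessThan_Suc_shift) simp
      ultimately show ?thesis using v(2) by simp
    qed
    ultimately show ?thesis using that[OF v'] by blast
  qed
qed

definition normal_pair :: "nat \<Rightarrow> nat \<Rightarrow> 'v \<Rightarrow> 'v \<Rightarrow> bool" where
  "normal_pair m l v w \<longleftrightarrow> hyperbolic_pair T m v w \<and>
     (\<forall>a. \<alpha> (P a v) = (if Suc a = l then 1 else 0)) \<and> (\<forall>a. \<alpha> (P a w) = 0)"

text \<open>
  The core of the classification. For \<open>a = l - 1 - k\<close> the condition \<open>\<alpha>(T^a w') = 0\<close> is an equation between
  \<open>c_k^2\<close> and \<open>c_{m+2k-2l}\<close> with prescribed constant term. The larger of the two indices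
  grows strictly with \<open>k\<close>, so the system is triangular.
\<close>
lemma adjust_partner:
  assumes vw: "hyperbolic_pair T m v w" and lm: "l \<le> m" "m \<le> 2 * l + 1"
    and v: "\<And>a. \<alpha> (P a v) = (if Suc a = l then 1 else 0)"
    and w: "\<And>a. l \<le> a \<Longrightarrow> \<alpha> (P a w) = 0"
  obtains c where "normal_pair m l v (w + (\<Sum>i<m. scl (c i) (P i v)))"
proof -
  define p where "p k = max k (m + 2 * k - 2 * l)" for k
  define Q where "Q k c \<longleftrightarrow> \<alpha> (P (l - Suc k) w) + (c k ^ 2
      + (if 2 * l \<le> m + 2 * k then c (m + 2 * k - 2 * l) else 0)) = 0" for k c
  have "\<exists>c. \<forall>k<l. Q k c"
  proof (rule triangular_system_solvable[where p = p])
    fix j k :: nat assume "j < k" then show "p j < p k"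
      by (auto simp: p_def max_def)
  next
    fix k and c d :: "nat \<Rightarrow> 'k" assume cd: "\<And>i. i \<le> p k \<Longrightarrow> c i = d i" and "Q k c"
    moreover have "c k = d k" "c (m + 2 * k - 2 * l) = d (m + 2 * k - 2 * l)"
      by (rule cd, simp add: p_def)+
    ultimately show "Q k d"
      unfolding Q_def by metis
  next
    fix k and c :: "nat \<Rightarrow> 'k" assume k: "k < l"
    define r where "r = \<alpha> (P (l - Suc k) w)"
    (* The last unknown occurs linearly, as c^2 + c, only squared, or only squared with the linear
       term absent. *)
    consider "2 * l \<le> m + 2 * k" "k < m + 2 * k - 2 * l" | "2 * l \<le> m + 2 * k" "k = m + 2 * k - 2 * l"
      | "2 * l \<le> m + 2 * k" "m + 2 * k - 2 * l < k" | "\<not> 2 * l \<le> m + 2 * k"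
      by linarith
    then show "\<exists>x. Q k (c(p k := x))"
    proof cases
      case 1
      then show ?thesis
        by (intro exI[of _ "r + c k ^ 2"]) (simp add: Q_def p_def r_def max_def)
    next
      case 2
      obtain x where "x ^ 2 + x = r"
        using ex_artin_schreier by blast
      then show ?thesis
        using 2 by (intro exI[of _ x]) (simp add: Q_def p_def r_def)
    next
      case 3
      obtain x where "x ^ 2 = r + c (m + 2 * k - 2 * l)"
        using ex_sqrt by blast
      then show ?thesis
        using 3 by (intro exI[of _ x]) (simp add: Q_def p_def r_def max_def)
    next
      case 4
      obtain x where "x ^ 2 = r"
        using ex_sqrt by blast
      then show ?thesis
        using 4 by (intro exI[of _ x]) (simp add: Q_def p_def r_def max_def)
    qed
  qed
  then obtain c where c: "\<And>k. k < l \<Longrightarrow> Q k c" by blast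
  define S where "S = (\<Sum>i<m. scl (c i) (P i v))"
  have killv: "P m v = 0" and killw: "P m w = 0"
    using vw by (auto simp: hyperbolic_pair_def)
  have "P m (w + S) = 0"
    unfolding S_def P_add P_sum P_scale P_P using killw P_large[OF killv] by simp
  moreover have "\<beta> (P a v) (w + S) = \<beta> (P a v) w" for a
    unfolding S_def beta_add_right beta_sum_right beta_scale_right beta_P_P_self by simp
  ultimately have "hyperbolic_pair T m v (w + S)"
    using vw by (simp add: hyperbolic_pair_def)
  moreover have "\<alpha> (P a (w + S)) = 0" for a
  proof -
    have \<alpha>S: "\<alpha> (P a S) = (\<Sum>i<m. if Suc (a + i) = l then c i ^ 2 else 0)"
      unfolding S_def alpha_polynomial v by (rule sum.cong) auto
    have \<beta>S: "\<beta> (P (Suc (2 * a)) w) S = (\<Sum>i<m. if Suc (Suc (2 * a) + i) = m then c i else 0)"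
      unfolding S_def beta_sum_right beta_scale_right hyperbolic_pair_beta[OF vw] by (rule sum.cong) auto
    show ?thesis
    proof (cases "a < l")
      case True
      define k where "k = l - Suc a"
      have "\<alpha> (P a S) = (\<Sum>i<m. if i = k then c k ^ 2 else 0)"
        unfolding \<alpha>S by (rule sum.cong) (use True in \<open>auto simp: k_def\<close>)
      then have 1: "\<alpha> (P a S) = c k ^ 2"
        using True lm(1) by (simp add: k_def)
      have 2: "\<beta> (P (Suc (2 * a)) w) S = (if 2 * l \<le> m + 2 * k then c (m + 2 * k - 2 * l) else 0)"
      proof (cases "2 * l \<le> m + 2 * k")
        case le: True
        have "\<beta> (P (Suc (2 * a)) w) S = (\<Sum>i<m. if i = m + 2 * k - 2 * l then c (m + 2 * k - 2 * l) else 0)"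
          unfolding \<beta>S by (rule sum.cong) (use True le in \<open>auto simp: k_def\<close>)
        then show ?thesis
          using True le by (simp add: k_def)
      next
        case False
        then show ?thesis
          unfolding \<beta>S using True by (auto simp: k_def intro!: sum.neutral)
      qed
      have "k < l" "l - Suc k = a"
        using True by (auto simp: k_def)
      then show ?thesis
        using c[of k] unfolding alpha_P_add 1 2 Q_def by (simp add: add.assoc)
    next
      case False
      then have "\<alpha> (P a S) = 0" "\<beta> (P (Suc (2 * a)) w) S = 0"
        unfolding \<alpha>S \<beta>S using lm(2) by (auto intro!: sum.neutral)
      then show ?thesis
        using w[of a] False unfolding alpha_P_add by simp
    qed
  qed
  ultimately show ?thesis
    using that[of c] v unfolding normal_pair_def S_def by blast
qed

text \<open>
  The second summand is the orthogonal projection of \<open>u\<close> to the block; subtraction is addition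
  here.
\<close>
lemma residue_mem:
  assumes U: "nondeg_submodule T U" and v: "v \<in> U" and w: "w \<in> U" and vw: "hyperbolic_pair T m v w" and u: "u \<in> U"
  shows "u + comb T m v w (\<lambda>a. \<beta> u (P (m - 1 - a) w)) (\<lambda>a. \<beta> u (P (m - 1 - a) v)) \<in> cyclic_perp T U v w"
    (is "u + ?p \<in> _")
proof -
  have sub: "subspace U"
    using U by (simp add: nondeg_submodule_def)
  have kill: "P m v = 0" "P m w = 0"
    using vw by (auto simp: hyperbolic_pair_def)
  have *: "\<beta> (u + ?p) (P b v) = 0 \<and> \<beta> (u + ?p) (P b w) = 0" for b
  proof (cases "b < m")
    case True
    then show ?thesis
      using comb_pairing[OF vw, of "m - 1 - b"] by simp
  next
    case False
    then show ?thesis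
      using P_large[OF kill(1), of b] P_large[OF kill(2), of b] by simp
  qed
  have "\<beta> (P b v) (u + ?p) = 0" "\<beta> (P b w) (u + ?p) = 0" for b
    using *[of b] by (simp_all only: beta_sym[of "P b _"])
  then show ?thesis
    using subspace_add[OF sub u comb_mem[OF U v w]] unfolding cyclic_perp_mem by blast
qed

lemma cyclic_perp_submodule:
  assumes U: "nondeg_submodule T U" and v: "v \<in> U" and w: "w \<in> U" and vw: "hyperbolic_pair T m v w"
  shows "nondeg_submodule T (cyclic_perp T U v w)"
proof -
  have sub: "subspace U" and stable: "\<And>u. u \<in> U \<Longrightarrow> T u \<in> U"
    and nd: "\<And>u. u \<in> U \<Longrightarrow> (\<And>w. w \<in> U \<Longrightarrow> \<beta> u w = 0) \<Longrightarrow> u = 0"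
    using U by (auto simp: nondeg_submodule_def)
  have "subspace (cyclic_perp T U v w)"
    using subspace_add[OF sub] subspace_scale[OF sub] subspace_0[OF sub]
    by (auto simp: subspace_def cyclic_perp_mem)
  moreover have "T u \<in> cyclic_perp T U v w" if "u \<in> cyclic_perp T U v w" for u
    using that stable by (simp add: cyclic_perp_mem beta_T_sym[symmetric])
      (metis funpow.simps(2) o_apply)
  moreover have "u = 0" if u: "u \<in> cyclic_perp T U v w"
    and orth: "\<forall>y\<in>cyclic_perp T U v w. \<beta> u y = 0" for u
  proof (rule nd)
    show "u \<in> U" using u by (simp add: cyclic_perp_mem)
    fix y assume "y \<in> U"
    then have "\<beta> u (y + comb T m v w (\<lambda>a. \<beta> y (P (m - 1 - a) w)) (\<lambda>a. \<beta> y (P (m - 1 - a) v))) = 0"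
      using orth residue_mem[OF U v w vw] by blast
    then show "\<beta> u y = 0"
      using comb_orthogonal[OF u] by (simp add: beta_sym)
  qed
  ultimately show ?thesis
    by (simp add: nondeg_submodule_def)
qed

end

section \<open>Adapted pairs and the index function of the complement\<close>

context form_module
begin

lemma normal_pair_exists:
  assumes U: "nondeg_submodule T U" and m: "nilp_degree T U = Suc n"
  obtains v w where "v \<in> U" "w \<in> U" "normal_pair (Suc n) (index_on \<alpha> T U (Suc n)) v w"
proof -
  define l where "l = index_on \<alpha> T U (Suc n)"
  have sub: "subspace U"
    using U by (simp add: nondeg_submodule_def)
  have kill: "P (Suc n) u = 0" if "u \<in> U" for u
    using nilp_degree_zero[OF that, of "Suc n"] m by simp
  obtain v where v: "v \<in> U" "P n v \<noteq> 0" "\<And>a. \<alpha> (P a v) = (if Suc a = l then 1 else 0)"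
    using normalised_generator[OF U m l_def[symmetric]] by blast
  obtain w where w: "w \<in> U" "hyperbolic_pair T (Suc n) v w"
    using hyperbolic_partner[OF U v(1,2) kill] by blast
  have "\<alpha> (P a w) = 0" if "l \<le> a" for a
    using index_on_zero[OF U w(1) kill[OF w(1)]] that by (simp add: l_def)
  moreover have "l \<le> Suc n" "Suc n \<le> 2 * l + 1"
    using index_on_le_self[of U "Suc n"] nilp_degree_le_index[OF U] m by (simp_all add: l_def)
  ultimately obtain c where c: "normal_pair (Suc n) l v (w + (\<Sum>i<Suc n. scl (c i) (P i v)))"
    using adjust_partner[OF w(2) _ _ v(3)] by blast
  have "(\<Sum>i<Suc n. scl (c i) (P i v)) \<in> U"
    by (rule subspace_sum[OF sub], rule subspace_scale[OF sub], rule submodule_P[OF U v(1)])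
  then show ?thesis
    using that[OF v(1) subspace_add[OF sub w(1)]] c by (simp add: l_def)
qed

lemma cyclic_perp_subset: "cyclic_perp T U v w \<subseteq> U"
  by (auto simp: cyclic_perp_mem)

lemma submodule_decomposition:
  assumes U: "nondeg_submodule T U" and v: "v \<in> U" and w: "w \<in> U" and vw: "hyperbolic_pair T m v w"
    and u: "u \<in> U"
  obtains c d u1 where "u = comb T m v w c d + u1" "u1 \<in> cyclic_perp T U v w"
proof
  let ?p = "comb T m v w (\<lambda>a. \<beta> u (P (m - 1 - a) w)) (\<lambda>a. \<beta> u (P (m - 1 - a) v))"
  show "u + ?p \<in> cyclic_perp T U v w"
    by (rule residue_mem[OF U v w vw u])
  show "u = ?p + (u + ?p)"
    by (simp add: add.left_commute)
qed

text \<open>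
  The block is a free module over the polynomials in \<open>T\<close> modulo \<open>T^m\<close>, so an element killed by
  \<open>T^j\<close> is divisible by \<open>T^(m-j)\<close>.
\<close>
lemma comb_divisible:
  assumes vw: "hyperbolic_pair T m v w" and j: "j \<le> m" and kill: "P j (comb T m v w c d) = 0"
  obtains c' d' where "comb T m v w c d = P (m - j) (comb T m v w c' d')"
proof -
  have zero: "c a = 0 \<and> d a = 0" if "a < m - j" for a
  proof -
    have "P (m - 1 - a) (comb T m v w c d) = 0"
      using P_large[OF kill] that by simp
    moreover have "a < m" using that by simp
    ultimately show ?thesis
      using comb_pairing[OF vw, of a c d] by (simp add: beta_P_sym[symmetric])
  qed
  let ?sh = "\<lambda>e a. e (a + (m - j))"
  have "(case_nat 0 ^^ (m - j)) (?sh c) = c" "(case_nat 0 ^^ (m - j)) (?sh d) = d"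
    using zero by (auto simp: shift_power)
  then have "comb T m v w c d = P (m - j) (comb T m v w (?sh c) (?sh d))"
    using P_comb[of m v w "m - j" "?sh c" "?sh d"] vw by (simp add: hyperbolic_pair_def)
  then show ?thesis by (rule that)
qed

text \<open>
  The element \<open>T^(m-j) v\<close> of the kernel of \<open>T^j\<close> forces the index of \<open>U\<close> at \<open>j\<close> to be at least
  \<open>l - (m - j)\<close>. The pair is adapted if, for \<open>j\<close> the nilpotency degree of the complement, the
  complement itself witnesses this lower bound. The truncated subtraction is harmless because the bound is
  only required when it is positive.
\<close>
definition adapted_pair :: "'v set \<Rightarrow> nat \<Rightarrow> nat \<Rightarrow> 'v \<Rightarrow> 'v \<Rightarrow> bool" where
  "adapted_pair U m l v w \<longleftrightarrow> v \<in> U \<and> w \<in> U \<and> normal_pair m l v w \<and>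
     (let k = l + nilp_degree T (cyclic_perp T U v w) in
        m < k \<longrightarrow> (\<exists>u\<in>cyclic_perp T U v w. \<alpha> (P (k - m - 1) u) \<noteq> 0))"

text \<open>
  If the complement of a normal pair \<open>(v, w)\<close> violates the bound, take a block \<open>(x, y)\<close> of maximal length
  \<open>m1\<close> in the complement and pass to \<open>x' = x + T^(m-m1) v\<close>. Now \<open>\<alpha>(T^q x') = 1\<close> for the relevant
  exponent \<open>q\<close>. To keep \<open>x'\<close> in the complement, \<open>w\<close> must be replaced by \<open>w + y\<close>, and then be
  adjusted by a multiple of \<open>v\<close>, which is orthogonal to \<open>x'\<close>.
\<close>
lemma adapted_pair_exists:
  assumes U: "nondeg_submodule T U" and m: "nilp_degree T U = Suc n"
  obtains v w where "adapted_pair U (Suc n) (index_on \<alpha> T U (Suc n)) v w"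
proof -
  define l where "l = index_on \<alpha> T U (Suc n)"
  have sub: "subspace U"
    using U by (simp add: nondeg_submodule_def)
  have kill: "P (Suc n) u = 0" if "u \<in> U" for u
    using nilp_degree_zero[OF that, of "Suc n"] m by simp
  obtain v w where v: "v \<in> U" and w: "w \<in> U" and vw: "normal_pair (Suc n) l v w"
    using normal_pair_exists[OF U m] by (auto simp: l_def)
  have hyp: "hyperbolic_pair T (Suc n) v w" and \<alpha>v: "\<And>a. \<alpha> (P a v) = (if Suc a = l then 1 else 0)"
    using vw by (auto simp: normal_pair_def)
  define U1 where "U1 = cyclic_perp T U v w"
  define m1 where "m1 = nilp_degree T U1"
  have U1: "nondeg_submodule T U1"
    unfolding U1_def by (rule cyclic_perp_submodule[OF U v w hyp])
  have l: "l \<le> Suc n" "Suc n \<le> 2 * l + 1"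
    using index_on_le_self[of U "Suc n"] nilp_degree_le_index[OF U] m by (simp_all add: l_def)
  show ?thesis
  proof (cases "Suc n < l + m1 \<longrightarrow> (\<exists>u\<in>U1. \<alpha> (P (l + m1 - Suc n - 1) u) \<noteq> 0)")
    case True
    then show ?thesis
      using that[of v w] v w vw by (simp add: adapted_pair_def Let_def U1_def m1_def l_def)
  next
    case False
    define q where "q = l + m1 - Suc n - 1"
    have lt: "Suc n < l + m1" and vanish: "\<And>u. u \<in> U1 \<Longrightarrow> \<alpha> (P q u) = 0"
      using False by (auto simp: q_def)
    obtain n1 where n1: "m1 = Suc n1"
      using lt l(1) by (cases m1) auto
    have m1: "m1 \<le> Suc n"
      unfolding m1_def by (rule nilp_degree_le) (auto simp: U1_def cyclic_perp_mem kill)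
    have kill1: "P m1 u = 0" if "u \<in> U1" for u
      using nilp_degree_zero[OF that, of m1] by (simp add: m1_def)
    obtain x where x: "x \<in> U1" "P n1 x \<noteq> 0"
      using nilp_degree_witness[of n1 U1] n1 by (auto simp: m1_def)
    obtain y where y: "y \<in> U1" "hyperbolic_pair T m1 x y"
      using hyperbolic_partner[OF U1 x(1,2)] kill1 n1 by metis
    have xU: "x \<in> U" and yU: "y \<in> U"
      using x(1) y(1) by (auto simp: U1_def cyclic_perp_mem)
    have orth: "\<beta> (P a v) x = 0" "\<beta> (P a w) x = 0" "\<beta> (P a v) y = 0" "\<beta> (P a w) y = 0" for a
      using x(1) y(1) by (auto simp: U1_def cyclic_perp_mem)
    define x' where "x' = x + P (Suc n - m1) v"
    (* Orthogonality of x' to w + y comes from T^(m-m1) v and x having the same pairings with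
       w and y respectively, which cancel in characteristic 2. *)
    have x'U: "x' \<in> U"
      unfolding x'_def by (rule subspace_add[OF sub xU submodule_P[OF U v]])
    have hyp': "hyperbolic_pair T (Suc n) v (w + y)"
      using hyp kill[OF yU] orth(3) by (simp add: hyperbolic_pair_def)
    have "\<alpha> (P a (w + y)) = 0" if "l \<le> a" for a
      using index_on_zero[OF U subspace_add[OF sub w yU] kill[OF subspace_add[OF sub w yU]], of a] that
      by (simp add: l_def)
    then obtain c where c: "normal_pair (Suc n) l v (w + y + (\<Sum>i<Suc n. scl (c i) (P i v)))"
      using adjust_partner[OF hyp' l \<alpha>v] by blast
    define S where "S = (\<Sum>i<Suc n. scl (c i) (P i v))"
    have S: "S \<in> U"
      unfolding S_def
      by (rule subspace_sum[OF sub], rule subspace_scale[OF sub], rule submodule_P[OF U v])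
    define w' where "w' = w + y + S"
    have w': "w' \<in> U" "normal_pair (Suc n) l v w'"
      using c subspace_add[OF sub subspace_add[OF sub w yU] S] by (simp_all add: w'_def S_def)
    define U2 where "U2 = cyclic_perp T U v w'"
    define m2 where "m2 = nilp_degree T U2"
    have hyp'': "hyperbolic_pair T (Suc n) v w'"
      using w'(2) by (simp add: normal_pair_def)
    have U2: "nondeg_submodule T U2"
      unfolding U2_def by (rule cyclic_perp_submodule[OF U v w'(1) hyp''])
    have Sv: "\<beta> (P a v) S = 0" for a
      unfolding S_def beta_sum_right beta_scale_right beta_P_P_self by simp
    have Sx: "\<beta> (P a S) x = 0" for a
      unfolding S_def P_sum P_scale P_P beta_sum_left beta_scale_left orth by simp
    have "\<beta> (P a w') x' = 0" for a
    proof -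
      have "\<beta> (P a w) (P (Suc n - m1) v) = (if Suc (a + (Suc n - m1)) = Suc n then 1 else 0)"
        by (rule hyperbolic_pair_beta(2)[OF hyp])
      moreover have "\<beta> (P a y) x = (if Suc a = m1 then 1 else 0)"
        using y(2) hyperbolic_pair_beta(2)[OF y(2), of a 0] by simp
      moreover have "\<beta> (P a y) (P (Suc n - m1) v) = 0"
        using orth(3) by (simp add: beta_P_P beta_P_swap[of _ y v])
      moreover have "\<beta> (P a S) (P (Suc n - m1) v) = 0"
        using Sv by (simp add: beta_P_P beta_P_swap[of _ S v])
      moreover have "Suc (a + (Suc n - m1)) = Suc n \<longleftrightarrow> Suc a = m1"
        using m1 n1 by auto
      ultimately show ?thesis
        using orth(2) Sx by (simp add: w'_def x'_def)
    qed
    moreover have "\<beta> (P a v) x' = 0" for a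
      using orth(1) by (simp add: x'_def)
    ultimately have x'2: "x' \<in> U2"
      using x'U by (simp add: U2_def cyclic_perp_mem)
    (* The new complement has no larger nilpotency degree: T^m1 u lies in the old block and is
       orthogonal to all of it. *)
    have le: "m2 \<le> m1"
      unfolding m2_def
    proof (rule nilp_degree_le)
      fix u assume u: "u \<in> U2"
      then have uU: "u \<in> U" and uv: "\<And>a. \<beta> (P a v) u = 0" and uw: "\<And>a. \<beta> (P a w') u = 0"
        by (auto simp: U2_def cyclic_perp_mem)
      obtain e f u1 where u1: "u = comb T (Suc n) v w e f + u1" "u1 \<in> U1"
        using submodule_decomposition[OF U v w hyp uU] unfolding U1_def by metis
      define z where "z = P m1 u"
      have z: "z = P m1 (comb T (Suc n) v w e f)"
        using u1 kill1 by (simp add: z_def)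
      obtain e' f' where z': "z = comb T (Suc n) v w e' f'"
        using P_comb[of "Suc n" v w m1 e f] kill[OF v] kill[OF w] z by metis
      have zv: "\<beta> z (P a v) = 0" for a
        using uv by (simp add: z_def beta_P_P beta_P_swap[of _ u v])
      have zw': "\<beta> z (P a w') = 0" for a
        using uw by (simp add: z_def beta_P_P beta_P_swap[of _ u w'])
      have zy: "\<beta> z (P a y) = 0" for a
        unfolding z beta_P_P beta_P_sym[of _ "comb T (Suc n) v w e f"]
        by (rule comb_orthogonal[of _ U]) (use submodule_P[OF U1 y(1)] in \<open>simp add: U1_def\<close>)
      have zS: "\<beta> z (P a S) = 0" for a
        unfolding S_def P_sum P_scale P_P beta_sum_right beta_scale_right zv by simp
      have "P a w = P a w' + P a y + P a S" for a
        by (simp add: w'_def add.assoc add.left_commute)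
      then have zw: "\<beta> z (P a w) = 0" for a
        using zw' zy zS by simp
      have "e' b = 0 \<and> f' b = 0" if "b < Suc n" for b
        using comb_pairing[OF hyp that, of e' f'] zv zw z' by simp
      then have "z = 0"
        unfolding z' comb_def by (simp del: sum.lessThan_Suc)
      then show "P m1 u = 0" by (simp add: z_def)
    qed
    have "\<alpha> (P q x') \<noteq> 0"
    proof -
      have "\<alpha> (P q (P (Suc n - m1) v)) = 1"
        using lt m1 n1 by (simp add: P_P \<alpha>v q_def)
      moreover have "\<beta> (P (Suc (2 * q)) x) (P (Suc n - m1) v) = 0"
        using orth(1) by (simp add: beta_P_P beta_P_swap[of _ x v])
      ultimately show ?thesis
        using vanish[OF x(1)] unfolding x'_def alpha_P_add by simp
    qed
    then have "Suc n < l + m2 \<longrightarrow> \<alpha> (P (l + m2 - Suc n - 1) (P (m1 - m2) x')) \<noteq> 0"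
      using le by (simp add: P_P q_def)
    moreover have "P (m1 - m2) x' \<in> U2"
      by (rule submodule_P[OF U2 x'2])
    ultimately show ?thesis
      using that[of v w'] v w' by (auto simp: adapted_pair_def Let_def U2_def m2_def l_def)
  qed
qed

text \<open>
  Let \<open>j\<close> be at most the nilpotency degree of the complement. Elements of the block killed by \<open>T^j\<close> are
  multiples of \<open>T^(m-j)\<close>, hence do not contribute beyond \<open>l - (m - j)\<close>, and an adapted complement already reaches this value.
\<close>
lemma index_on_cyclic_perp:
  assumes U: "nondeg_submodule T U" and m: "nilp_degree T U = m" and l: "index_on \<alpha> T U m = l"
    and vw: "adapted_pair U m l v w"
  defines "U1 \<equiv> cyclic_perp T U v w"
  shows "index_on \<alpha> T U1 j = index_on \<alpha> T U (min j (nilp_degree T U1))"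
proof -
  define m1 where "m1 = nilp_degree T U1"
  have v: "v \<in> U" and w: "w \<in> U" and hyp: "hyperbolic_pair T m v w"
    using vw by (auto simp: adapted_pair_def normal_pair_def)
  have U1: "nondeg_submodule T U1"
    unfolding U1_def by (rule cyclic_perp_submodule[OF U v w hyp])
  have kill: "P m u = 0" if "u \<in> U" for u
    using nilp_degree_zero[OF that, of m] m by simp
  have kill1: "P m1 u = 0" if "u \<in> U1" for u
    using nilp_degree_zero[OF that, of m1] by (simp add: m1_def)
  have m1: "m1 \<le> m"
    unfolding m1_def by (rule nilp_degree_le) (auto simp: U1_def cyclic_perp_mem kill)
  have *: "index_on \<alpha> T U1 j = index_on \<alpha> T U j" if j: "j \<le> m1" for j
  proof (rule antisym)
    show "index_on \<alpha> T U1 j \<le> index_on \<alpha> T U j"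
    proof (rule index_on_le)
      fix u assume "u \<in> U1" "P j u = 0"
      then show "\<alpha> (P (index_on \<alpha> T U j) u) = 0"
        using index_on_zero[OF U _ _ order_refl, of u j] by (auto simp: U1_def cyclic_perp_mem)
    qed
    define i where "i = index_on \<alpha> T U1 j"
    have i: "l + j \<le> i + m"
    proof (rule ccontr)
      assume neg: "\<not> l + j \<le> i + m"
      then have "m < l + m1" using j by simp
      then obtain u where u: "u \<in> U1" "\<alpha> (P (l + m1 - m - 1) u) \<noteq> 0"
        using vw by (auto simp: adapted_pair_def Let_def U1_def m1_def)
      have "P j (P (m1 - j) u) = 0"
        using kill1[OF u(1)] j by (simp add: P_P)
      then have "\<alpha> (P (l + j - m - 1) (P (m1 - j) u)) = 0"
        using index_on_zero[OF U1 submodule_P[OF U1 u(1)], of j "m1 - j" "l + j - m - 1"] neg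
        by (simp add: i_def)
      then show False
        using u(2) neg j by (simp add: P_P)
    qed
    show "index_on \<alpha> T U j \<le> index_on \<alpha> T U1 j"
      unfolding i_def[symmetric]
    proof (rule index_on_le)
      fix u assume u: "u \<in> U" "P j u = 0"
      obtain c d u1 where u1: "u = comb T m v w c d + u1" "u1 \<in> U1"
        using submodule_decomposition[OF U v w hyp u(1)] unfolding U1_def by metis
      let ?p = "comb T m v w c d"
      have eq: "P j ?p = P j u1"
        using u(2) u1(1) by simp
      have "\<beta> (P j u1) y = 0" if "y \<in> U1" for y
        unfolding eq[symmetric] beta_P_sym
        by (rule comb_orthogonal[of _ U]) (use submodule_P[OF U1 that] in \<open>simp add: U1_def\<close>)
      then have z1: "P j u1 = 0"
        using U1 submodule_P[OF U1 u1(2)] by (auto simp: nondeg_submodule_def)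
      then have zp: "P j ?p = 0"
        using eq by simp
      obtain c' d' where p: "?p = P (m - j) (comb T m v w c' d')"
        using comb_divisible[OF hyp _ zp] j m1 by (metis order_trans)
      have "\<alpha> (P (i + (m - j)) (comb T m v w c' d')) = 0"
        using index_on_zero[OF U comb_mem[OF U v w] kill[OF comb_mem[OF U v w]]] i j m1 l by simp
      then have "\<alpha> (P i ?p) = 0"
        unfolding p P_P .
      moreover have "\<alpha> (P i u1) = 0"
        using index_on_zero[OF U1 u1(2) z1] by (simp add: i_def)
      moreover have "\<beta> (P (Suc (2 * i)) ?p) u1 = 0"
        unfolding beta_P_sym
        by (rule comb_orthogonal[of _ U]) (use submodule_P[OF U1 u1(2)] in \<open>simp add: U1_def\<close>)
      ultimately show "\<alpha> (P i u) = 0"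
        unfolding u1(1) alpha_P_add by simp
    qed
  qed
  show ?thesis
  proof (cases "j \<le> m1")
    case True
    then show ?thesis using *[OF True] by (simp add: m1_def min_def)
  next
    case False
    then show ?thesis
      using index_on_stable[of U1 j] *[of m1] by (simp add: m1_def min_def)
  qed
qed

end

section \<open>Classification of form modules\<close>

context symplectic_char2
begin

sublocale endo: finite_dimensional_vector_space_pair scl Basis scl Basis
  by unfold_locales

definition block :: "('v \<Rightarrow> 'v) \<Rightarrow> nat \<Rightarrow> 'v \<Rightarrow> 'v \<Rightarrow> 'v set" where
  "block T m v w = {x. \<exists>c d. x = comb T m v w c d}"

lemma subspace_block: "subspace (block T m v w)"
proof (rule subspaceI)
  show "0 \<in> block T m v w"
    unfolding block_def by (auto simp: comb_def intro!: exI[of _ "\<lambda>_. 0"])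
  show "x + y \<in> block T m v w" if "x \<in> block T m v w" "y \<in> block T m v w" for x y
    using that comb_add[of T m v w] unfolding block_def mem_Collect_eq by metis
  show "scl c x \<in> block T m v w" if "x \<in> block T m v w" for c x
    using that comb_scale[of c T m v w] unfolding block_def mem_Collect_eq by metis
qed

lemma subspace_lin_image: "lin f \<Longrightarrow> subspace S \<Longrightarrow> subspace (f ` S)"
  using endo.linear_subspace_image[of f S] .

lemma comb_cong:
  "(\<And>a. a < m \<Longrightarrow> c a = c' a) \<Longrightarrow> (\<And>a. a < m \<Longrightarrow> d a = d' a) \<Longrightarrow> comb T m v w c d = comb T m v w c' d'"
  unfolding comb_def by (auto intro!: arg_cong2[where f = "(+)"] sum.cong)

text \<open>
  On the block generated by \<open>v\<close> and \<open>w\<close> this is the map with \<open>T^a v \<mapsto> T'^a v'\<close> and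
  \<open>T^a w \<mapsto> T'^a w'\<close>; on the complement of the block it is zero. For \<open>T' = T\<close>, \<open>v' = v\<close>
  and \<open>w' = w\<close> it is the orthogonal projection to the block.
\<close>
definition transport :: "nat \<Rightarrow> ('v \<Rightarrow> 'v) \<Rightarrow> 'v \<Rightarrow> 'v \<Rightarrow> ('v \<Rightarrow> 'v) \<Rightarrow> 'v \<Rightarrow> 'v \<Rightarrow> 'v \<Rightarrow> 'v" where
  "transport m T v w T' v' w' u =
     comb T' m v' w' (\<lambda>a. \<beta> u ((T ^^ (m - 1 - a)) w)) (\<lambda>a. \<beta> u ((T ^^ (m - 1 - a)) v))"

lemma lin_transport: "lin (transport m T v w T' v' w')"
  by (rule linI) (simp_all add: transport_def comb_add comb_scale)

end

context form_module
begin

lemma transport_comb: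
  assumes "hyperbolic_pair T m v w"
  shows "transport m T v w T' v' w' (comb T m v w c d) = comb T' m v' w' c d"
  unfolding transport_def using comb_pairing[OF assms] by (intro comb_cong) auto

text \<open>
  Transport of coefficients maps the image of \<open>T^j\<close> on one block onto that of \<open>T'^j\<close> on the other. By
  symmetry the two dimensions agree, which lets blocks be cancelled from Jordan types without counting.
\<close>
lemma dim_block_le:
  assumes "form_module scl Basis \<beta> \<alpha>' T'"
    and vw: "hyperbolic_pair T m v w" and vw': "hyperbolic_pair T' m v' w'"
  shows "dim ((T' ^^ j) ` block T' m v' w') \<le> dim (P j ` block T m v w)"
proof -
  interpret B: form_module scl Basis \<beta> \<alpha>' T' by fact
  let ?f = "transport m T v w T' v' w'"
  have "(T' ^^ j) (comb T' m v' w' c d) = ?f (P j (comb T m v w c d))" for c d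
    using P_comb[of m v w j c d] B.P_comb[of m v' w' j c d] vw vw'
    by (simp add: hyperbolic_pair_def transport_comb[OF vw])
  then have "(T' ^^ j) ` block T' m v' w' = ?f ` (P j ` block T m v w)"
    by (auto simp: block_def image_iff) metis+
  then show ?thesis
    using endo.dim_image_le[OF lin_transport] by simp
qed

lemma dim_P_image:
  assumes U: "nondeg_submodule T U" and v: "v \<in> U" and w: "w \<in> U" and vw: "hyperbolic_pair T m v w"
  shows "dim (P j ` U) = dim (P j ` block T m v w) + dim (P j ` cyclic_perp T U v w)"
proof -
  let ?W = "block T m v w" and ?U1 = "cyclic_perp T U v w"
  have kill: "P m v = 0" "P m w = 0"
    using vw by (auto simp: hyperbolic_pair_def)
  have U1: "nondeg_submodule T ?U1"
    by (rule cyclic_perp_submodule[OF U v w vw])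
  have "P j ` U = {x + y |x y. x \<in> P j ` ?W \<and> y \<in> P j ` ?U1}" (is "_ = ?sum")
  proof
    show "P j ` U \<subseteq> ?sum"
    proof
      fix z assume "z \<in> P j ` U"
      then obtain u where u: "u \<in> U" "z = P j u" by blast
      obtain c d u1 where "u = comb T m v w c d + u1" "u1 \<in> ?U1"
        using submodule_decomposition[OF U v w vw u(1)] by metis
      moreover have "comb T m v w c d \<in> ?W"
        by (auto simp: block_def)
      ultimately show "z \<in> ?sum"
        using u(2) by auto
    qed
    show "?sum \<subseteq> P j ` U"
    proof
      fix z assume "z \<in> ?sum"
      then obtain x y where "x \<in> ?W" "y \<in> ?U1" "z = P j (x + y)" by auto
      moreover have "x + y \<in> U"
        using \<open>x \<in> ?W\<close> \<open>y \<in> ?U1\<close> U comb_mem[OF U v w] subspace_add[of U]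
        by (auto simp: block_def cyclic_perp_mem nondeg_submodule_def)
      ultimately show "z \<in> P j ` U" by blast
    qed
  qed
  moreover have "P j ` ?W \<inter> P j ` ?U1 \<subseteq> {0}"
  proof
    fix z assume z: "z \<in> P j ` ?W \<inter> P j ` ?U1"
    then obtain x where x: "z = P j x" "x \<in> ?W" by blast
    then obtain c d where z1: "z = P j (comb T m v w c d)"
      by (auto simp: block_def)
    from z obtain u where "z = P j u" "u \<in> ?U1" by blast
    then have "z \<in> ?U1"
      using submodule_P[OF U1] by blast
    moreover have "\<beta> z y = 0" if "y \<in> ?U1" for y
      unfolding z1 P_comb[OF kill] by (rule comb_orthogonal[OF that])
    ultimately show "z \<in> {0}"
      using U1 by (auto simp: nondeg_submodule_def)
  qed
  then have "dim (P j ` ?W \<inter> P j ` ?U1) = 0"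
    by simp
  moreover have "subspace (P j ` ?W)" "subspace (P j ` ?U1)"
    using subspace_lin_image[OF lin_P] subspace_block U1 by (auto simp: nondeg_submodule_def)
  ultimately show ?thesis
    using dim_sums_Int[of "P j ` ?W" "P j ` ?U1"] by (metis add.right_neutral)
qed

lemma nilp_degree_dim: "nilp_degree T U = (LEAST m. dim (P m ` U) = 0)"
  unfolding nilp_degree_def dim_eq_0 by (rule arg_cong[where f = Least]) auto

end

context symplectic_char2
begin

text \<open>
  The numbers \<open>dim (T^j U)\<close> encode the Jordan type. Both modules are split by adapted pairs with the
  same \<open>(m, l)\<close>; the complements again have equal invariants, and the isometry between them given by induction
  is combined with the transport of the blocks.
\<close>
theorem form_modules_isometric:
  assumes A: "form_module scl Basis \<beta> \<alpha> T" and B: "form_module scl Basis \<beta> \<alpha>' T'"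
    and "nondeg_submodule T U" "nondeg_submodule T' U'"
    and "\<And>j. dim ((T ^^ j) ` U) = dim ((T' ^^ j) ` U')"
    and "\<And>j. index_on \<alpha> T U j = index_on \<alpha>' T' U' j"
  shows "\<exists>g. lin g \<and> (\<forall>u\<in>U. g u \<in> U' \<and> \<alpha>' (g u) = \<alpha> u) \<and> (\<forall>u\<in>U. \<forall>y\<in>U. \<beta> (g u) (g y) = \<beta> u y)"
  using assms(3-6)
proof (induction "dim U" arbitrary: U U' rule: less_induct)
  case less
  interpret A: form_module scl Basis \<beta> \<alpha> T by fact
  interpret B: form_module scl Basis \<beta> \<alpha>' T' by fact
  note U = less.prems(1) and U' = less.prems(2) and dims = less.prems(3) and index = less.prems(4)
  define m where "m = nilp_degree T U"
  have m': "nilp_degree T' U' = m"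
    unfolding m_def A.nilp_degree_dim B.nilp_degree_dim dims ..
  show ?case
  proof (cases m)
    case 0
    then have "U \<subseteq> {0}" "U' \<subseteq> {0}"
      using A.nilp_degree_zero[of _ U 0] B.nilp_degree_zero[of _ U' 0] m' by (auto simp: m_def)
    moreover have "0 \<in> U'"
      using U' subspace_0 by (auto simp: nondeg_submodule_def)
    ultimately show ?thesis
      by (intro exI[of _ "\<lambda>_. 0"]) (auto intro: linI)
  next
    case (Suc n)
    define l where "l = index_on \<alpha> T U m"
    have l': "index_on \<alpha>' T' U' m = l"
      using index by (simp add: l_def)
    obtain v w where ad: "A.adapted_pair U m l v w"
      using A.adapted_pair_exists[OF U, of n] Suc by (auto simp: m_def l_def)
    obtain v' w' where ad': "B.adapted_pair U' m l v' w'"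
      using B.adapted_pair_exists[OF U', of n] Suc m' l' by auto
    define U1 where "U1 = cyclic_perp T U v w"
    define U1' where "U1' = cyclic_perp T' U' v' w'"
    have v: "v \<in> U" and w: "w \<in> U" and np: "A.normal_pair m l v w"
      and v': "v' \<in> U'" and w': "w' \<in> U'" and np': "B.normal_pair m l v' w'"
      using ad ad' by (auto simp: A.adapted_pair_def B.adapted_pair_def)
    have hyp: "hyperbolic_pair T m v w" and hyp': "hyperbolic_pair T' m v' w'"
      using np np' by (auto simp: A.normal_pair_def B.normal_pair_def)
    have U1: "nondeg_submodule T U1" and U1': "nondeg_submodule T' U1'"
      unfolding U1_def U1'_def
      using A.cyclic_perp_submodule[OF U v w hyp] B.cyclic_perp_submodule[OF U' v' w' hyp'] .
    have "dim ((T ^^ j) ` block T m v w) = dim ((T' ^^ j) ` block T' m v' w')" for j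
      using A.dim_block_le[OF B hyp hyp'] B.dim_block_le[OF A hyp' hyp] by (rule antisym[rotated])
    note dims_block = this
    have dims1: "dim ((T ^^ j) ` U1) = dim ((T' ^^ j) ` U1')" for j
      using dims[of j] dims_block[of j] A.dim_P_image[OF U v w hyp, of j] B.dim_P_image[OF U' v' w' hyp', of j]
      unfolding U1_def U1'_def by linarith
    have deg1: "nilp_degree T U1 = nilp_degree T' U1'"
      unfolding A.nilp_degree_dim B.nilp_degree_dim dims1 ..
    have index1: "index_on \<alpha> T U1 j = index_on \<alpha>' T' U1' j" for j
      using A.index_on_cyclic_perp[OF U m_def[symmetric] l_def[symmetric] ad, of j]
        B.index_on_cyclic_perp[OF U' m' l' ad', of j] index deg1
      by (simp add: U1_def U1'_def)
    have "U1 \<subset> U"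
    proof -
      have "\<beta> ((T ^^ n) w) v = 1"
        using A.hyperbolic_pair_beta(2)[OF hyp, of n 0] Suc by simp
      then have "v \<notin> U1"
        unfolding U1_def A.cyclic_perp_mem by (metis zero_neq_one)
      then show ?thesis
        using v A.cyclic_perp_subset[of U v w] by (auto simp: U1_def)
    qed
    moreover have "subspace U" "subspace U1"
      using U U1 by (auto simp: nondeg_submodule_def)
    ultimately have "dim U1 < dim U"
      using dim_psubset[of U1 U] by (metis span_eq_iff)
    then obtain g1 where g1: "lin g1" "\<And>u. u \<in> U1 \<Longrightarrow> g1 u \<in> U1'" "\<And>u. u \<in> U1 \<Longrightarrow> \<alpha>' (g1 u) = \<alpha> u"
      "\<And>u y. u \<in> U1 \<Longrightarrow> y \<in> U1 \<Longrightarrow> \<beta> (g1 u) (g1 y) = \<beta> u y"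
      using less.hyps[OF _ U1 U1' dims1 index1] by blast
    define f where "f = transport m T v w T' v' w'"
    (* The projection to the complement of the block. *)
    define pr where "pr u = u + transport m T v w T v w u" for u
    define g where "g u = f u + g1 (pr u)" for u
    have "lin pr"
      unfolding pr_def by (intro lin_plus lin_id lin_transport)
    then have "lin g"
      unfolding g_def f_def using lin_plus[OF lin_transport lin_comp[OF g1(1)]] by blast
    have split: "\<exists>c d u1. u = comb T m v w c d + u1 \<and> u1 \<in> U1 \<and> g u = comb T' m v' w' c d + g1 u1"
      if u: "u \<in> U" for u
    proof -
      have "pr u \<in> U1"
        unfolding pr_def transport_def U1_def by (rule A.residue_mem[OF U v w hyp u])
      moreover have "u = transport m T v w T v w u + pr u"
        by (simp add: pr_def add.left_commute)
      ultimately show ?thesis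
        unfolding g_def f_def transport_def by blast
    qed
    have mem: "g u \<in> U'" if u: "u \<in> U" for u
    proof -
      obtain c d u1 where *: "u1 \<in> U1" "g u = comb T' m v' w' c d + g1 u1"
        using split[OF u] by blast
      have "g1 u1 \<in> U'"
        using g1(2)[OF *(1)] by (simp add: U1'_def B.cyclic_perp_mem)
      then show ?thesis
        using *(2) B.comb_mem[OF U' v' w'] subspace_add[of U'] U' by (simp add: nondeg_submodule_def)
    qed
    have \<beta>: "\<beta> (g u) (g y) = \<beta> u y" if u: "u \<in> U" and y: "y \<in> U" for u y
    proof -
      obtain c d u1 where 1: "u = comb T m v w c d + u1" "u1 \<in> U1" "g u = comb T' m v' w' c d + g1 u1"
        using split[OF u] by blast
      obtain e f y1 where 2: "y = comb T m v w e f + y1" "y1 \<in> U1" "g y = comb T' m v' w' e f + g1 y1"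
        using split[OF y] by blast
      have "\<beta> (comb T m v w c d) y1 = 0" "\<beta> u1 (comb T m v w e f) = 0"
        "\<beta> (comb T' m v' w' c d) (g1 y1) = 0" "\<beta> (g1 u1) (comb T' m v' w' e f) = 0"
        using A.comb_orthogonal[of _ U v w] B.comb_orthogonal[of _ U' v' w'] 1(2) 2(2) g1(2)
        by (auto simp: U1_def U1'_def beta_sym[of u1] beta_sym[of "g1 u1"])
      moreover have "\<beta> (comb T' m v' w' c d) (comb T' m v' w' e f) = \<beta> (comb T m v w c d) (comb T m v w e f)"
        by (simp only: A.comb_beta[OF hyp] B.comb_beta[OF hyp'])
      ultimately show ?thesis
        using g1(4)[OF 1(2) 2(2)] unfolding 1(3) 2(3) unfolding 1(1) 2(1) by simp
    qed
    have \<alpha>: "\<alpha>' (g u) = \<alpha> u" if u: "u \<in> U" for u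
    proof -
      obtain c d u1 where 1: "u = comb T m v w c d + u1" "u1 \<in> U1" "g u = comb T' m v' w' c d + g1 u1"
        using split[OF u] by blast
      have "T u1 \<in> U1" "T' (g1 u1) \<in> U1'"
        using U1 U1' 1(2) g1(2) by (auto simp: nondeg_submodule_def)
      then have "\<beta> (T (comb T m v w c d)) u1 = 0" "\<beta> (T' (comb T' m v' w' c d)) (g1 u1) = 0"
        using A.comb_orthogonal[of _ U v w] B.comb_orthogonal[of _ U' v' w']
        by (auto simp: U1_def U1'_def A.beta_T_sym B.beta_T_sym)
      moreover have "\<alpha> (comb T m v w c d) = \<alpha>' (comb T' m v' w' c d)"
      proof -
        have "\<alpha> (comb T m v w c d) = (\<Sum>a<m. c a ^ 2 * (if Suc a = l then 1 else 0))
            + (\<Sum>a<m. \<Sum>b<m. c a * d b * (if Suc (Suc a + b) = m then 1 else 0))"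
          using np by (intro A.comb_alpha[OF hyp]) (auto simp: A.normal_pair_def)
        also have "\<dots> = \<alpha>' (comb T' m v' w' c d)"
          using np' by (intro B.comb_alpha[OF hyp', symmetric]) (auto simp: B.normal_pair_def)
        finally show ?thesis .
      qed
      ultimately show ?thesis
        using g1(3)[OF 1(2)] unfolding 1(3) B.alpha_add unfolding 1(1) A.alpha_add by simp
    qed
    show ?thesis
      using \<open>lin g\<close> mem \<alpha> \<beta> by blast
  qed
qed

end

section \<open>The dual of the symplectic Lie algebra and quadratic forms\<close>

lemma sum_square_split:
  fixes f :: "nat \<Rightarrow> nat \<Rightarrow> 'a::comm_monoid_add"
  shows "(\<Sum>i<N. \<Sum>j<N. f i j) = (\<Sum>i<N. f i i) + (\<Sum>j<N. \<Sum>i<j. f i j + f j i)"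
  by (induction N) (simp_all add: sum.distrib algebra_simps)

context symplectic_char2
begin

abbreviation SpV where "SpV \<equiv> Sp scl \<beta>"
abbreviation spV where "spV \<equiv> sp scl \<beta>"
abbreviation spV_dual where "spV_dual \<equiv> sp_dual scl \<beta>"
abbreviation coad where "coad \<equiv> coadjoint scl \<beta>"
abbreviation alpha_form where "alpha_form \<equiv> alpha scl Basis \<beta>"
abbreviation Txi where "Txi \<equiv> T_xi scl Basis \<beta>"
abbreviation polys where "polys \<equiv> polyfun scl"
abbreviation zar where "zar \<equiv> zariski scl"

lemma gl_iff: "x \<in> gl scl \<longleftrightarrow> lin x"
  by (simp add: gl_def)

lemma isometry_bij:
  assumes "lin g" "\<And>v w. \<beta> (g v) (g w) = \<beta> v w"
  shows "bij g"
proof -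
  have "inj g"
    using assms(2) by (intro injI beta_left_cancel) metis
  then show ?thesis
    using linear_inj_imp_surj[OF assms(1)] by (simp add: bij_def)
qed

lemma Sp_iff: "g \<in> carrier SpV \<longleftrightarrow> lin g \<and> (\<forall>v w. \<beta> (g v) (g w) = \<beta> v w)"
  using isometry_bij by (auto simp: Sp_def GL_def gl_iff)

lemma Sp_mult [simp]: "g \<otimes>\<^bsub>SpV\<^esub> h = g \<circ> h" and Sp_one [simp]: "\<one>\<^bsub>SpV\<^esub> = id"
  by (simp_all add: Sp_def GL_def)

lemma Sp_lin: "g \<in> carrier SpV \<Longrightarrow> lin g"
  and Sp_isometry: "g \<in> carrier SpV \<Longrightarrow> \<beta> (g v) (g w) = \<beta> v w"
  by (auto simp: Sp_iff)

lemma Sp_bij: "g \<in> carrier SpV \<Longrightarrow> bij g"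
  using isometry_bij by (auto simp: Sp_iff)

lemma Sp_inv_right [simp]: "g \<in> carrier SpV \<Longrightarrow> g (inv_into UNIV g v) = v"
  and Sp_inv_left [simp]: "g \<in> carrier SpV \<Longrightarrow> inv_into UNIV g (g v) = v"
  using Sp_bij[of g] by (simp_all add: bij_def surj_f_inv_f)

lemma Sp_inv_closed:
  assumes g: "g \<in> carrier SpV" shows "inv_into UNIV g \<in> carrier SpV"
proof -
  have "lin (inv_into UNIV g)"
    using inj_linear_imp_inv_linear[OF Sp_lin[OF g]] Sp_bij[OF g] by (simp add: bij_def)
  moreover have "\<beta> (inv_into UNIV g v) (inv_into UNIV g w) = \<beta> v w" for v w
    using Sp_isometry[OF g, of "inv_into UNIV g v" "inv_into UNIV g w"] g by simp
  ultimately show ?thesis by (simp add: Sp_iff)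
qed

lemma group_Sp: "group SpV"
proof (rule groupI)
  fix g assume g: "g \<in> carrier SpV"
  then have "inv_into UNIV g \<otimes>\<^bsub>SpV\<^esub> g = \<one>\<^bsub>SpV\<^esub>"
    by (simp add: fun_eq_iff)
  then show "\<exists>h\<in>carrier SpV. h \<otimes>\<^bsub>SpV\<^esub> g = \<one>\<^bsub>SpV\<^esub>"
    using Sp_inv_closed[OF g] by blast
qed (auto simp: Sp_iff o_def id_def intro: lin_comp)

lemma Sp_inv_eq:
  assumes "g \<in> carrier SpV" shows "inv\<^bsub>SpV\<^esub> g = inv_into UNIV g"
  using group.inv_equality[OF group_Sp, of "inv_into UNIV g" g] assms Sp_inv_closed[OF assms]
  by (simp add: fun_eq_iff)

lemma Sp_adjoint: "g \<in> carrier SpV \<Longrightarrow> \<beta> v (g w) = \<beta> (inv_into UNIV g v) w"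
  using Sp_isometry[of g "inv_into UNIV g v" w] by simp

text \<open>
  Under \<open>x \<mapsto> \<beta>(x v, w)\<close> the Lie algebra becomes the space of symmetric bilinear forms. The
  two maps below correspond to the square of the functional \<open>\<beta>(v, _)\<close> and to the
  symmetrised product of two such functionals.
\<close>
definition sq_elem :: "'v \<Rightarrow> 'v \<Rightarrow> 'v" where
  "sq_elem v = (\<lambda>u. scl (\<beta> v u) v)"

definition pair_elem :: "'v \<Rightarrow> 'v \<Rightarrow> 'v \<Rightarrow> 'v" where
  "pair_elem v w = (\<lambda>u. scl (\<beta> v u) w + scl (\<beta> w u) v)"

lemma sp_iff: "x \<in> spV \<longleftrightarrow> lin x \<and> (\<forall>v w. \<beta> (x v) w = \<beta> v (x w))"
  by (simp add: sp_def gl_iff)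

lemma sq_elem_sp: "sq_elem v \<in> spV"
  by (simp add: sp_iff sq_elem_def linI scale_left_distrib mult.commute beta_sym[of _ v])

lemma pair_elem_sp: "pair_elem v w \<in> spV"
  unfolding sp_iff
proof (intro conjI allI)
  show "lin (pair_elem v w)"
    by (rule linI) (simp_all add: pair_elem_def scale_left_distrib scale_right_distrib algebra_simps)
  fix a b
  show "\<beta> (pair_elem v w a) b = \<beta> a (pair_elem v w b)"
    by (simp add: pair_elem_def mult.commute beta_sym[of a] add.commute)
qed

lemma sp_lincomb:
  assumes "\<And>a. a \<in> A \<Longrightarrow> x a \<in> spV"
  shows "(\<lambda>u. \<Sum>a\<in>A. scl (k a) (x a u)) \<in> spV"
  unfolding sp_iff
proof (intro conjI allI)
  have x: "lin (x a)" "\<beta> (x a v) w = \<beta> v (x a w)" if "a \<in> A" for a v w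
    using assms[OF that] by (auto simp: sp_iff)
  show "lin (\<lambda>u. \<Sum>a\<in>A. scl (k a) (x a u))"
    using x(1) by (intro linI)
      (simp_all add: lin_add lin_scale sum.distrib[symmetric] scale_sum_right scale_right_distrib mult.commute cong: sum.cong)
  show "\<beta> (\<Sum>a\<in>A. scl (k a) (x a v)) w = \<beta> v (\<Sum>a\<in>A. scl (k a) (x a w))" for v w
    using x(2) by (simp add: beta_sum_left beta_sum_right cong: sum.cong)
qed

lemma dual_add:
  "\<xi> \<in> spV_dual \<Longrightarrow> x \<in> spV \<Longrightarrow> y \<in> spV \<Longrightarrow> \<xi> (\<lambda>u. x u + y u) = \<xi> x + \<xi> y"
  and dual_scale: "\<xi> \<in> spV_dual \<Longrightarrow> x \<in> spV \<Longrightarrow> \<xi> (\<lambda>u. scl c (x u)) = c * \<xi> x"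
  by (simp_all add: sp_dual_def)

lemma dual_lincomb:
  assumes \<xi>: "\<xi> \<in> spV_dual" and "finite A" and x: "\<And>a. a \<in> A \<Longrightarrow> x a \<in> spV"
  shows "\<xi> (\<lambda>u. \<Sum>a\<in>A. scl (k a) (x a u)) = (\<Sum>a\<in>A. k a * \<xi> (x a))"
  using assms(2,3)
proof (induction A rule: finite_induct)
  case empty
  show ?case
    using dual_scale[OF \<xi> sq_elem_sp, of 0 0] by simp
next
  case (insert a A)
  have sca: "(\<lambda>u. scl (k a) (x a u)) \<in> spV"
    using sp_lincomb[of "{a}" x k] insert.prems by simp
  have rest: "(\<lambda>u. \<Sum>a\<in>A. scl (k a) (x a u)) \<in> spV"
    using sp_lincomb[of A x k] insert.prems by simp
  have "\<xi> (\<lambda>u. scl (k a) (x a u) + (\<Sum>a\<in>A. scl (k a) (x a u)))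
      = k a * \<xi> (x a) + \<xi> (\<lambda>u. \<Sum>a\<in>A. scl (k a) (x a u))"
    using \<xi> sca rest insert.prems by (simp add: sp_dual_def)
  then show ?case
    using insert by simp
qed

lemma sp_add: "x \<in> spV \<Longrightarrow> y \<in> spV \<Longrightarrow> (\<lambda>u. x u + y u) \<in> spV"
  by (simp add: sp_iff lin_plus)

text \<open>
  So \<open>\<xi>\<close> evaluated on \<open>pair_elem v w\<close> is the polarisation of \<open>v \<mapsto> \<xi>(sq_elem v)\<close>.
\<close>
lemma dual_sq_add:
  assumes "\<xi> \<in> spV_dual"
  shows "\<xi> (sq_elem (v + w)) = \<xi> (sq_elem v) + \<xi> (sq_elem w) + \<xi> (pair_elem v w)"
proof -
  have "sq_elem (v + w) = (\<lambda>u. (sq_elem v u + sq_elem w u) + pair_elem v w u)"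
    by (simp add: sq_elem_def pair_elem_def fun_eq_iff scale_left_distrib scale_right_distrib algebra_simps)
  then show ?thesis
    using dual_add[OF assms sp_add[OF sq_elem_sp sq_elem_sp] pair_elem_sp, of v w v w]
      dual_add[OF assms sq_elem_sp sq_elem_sp, of v w] by simp
qed

lemma dual_basis_exists:
  obtains D where "\<And>b u. b \<in> Basis \<Longrightarrow> \<beta> (D b) u = representation Basis u b"
proof -
  have "\<exists>d. \<forall>u. \<beta> d u = representation Basis u b" for b
  proof -
    have "lfun (\<lambda>u. representation Basis u b)"
      by (rule lfunI) (simp_all add: representation_add representation_scale independent_Basis span_Basis)
    then show ?thesis
      by (rule functional_representation) metis
  qed
  then have "\<exists>D. \<forall>b u. \<beta> (D b) u = representation Basis u b"
    by (rule choice[OF allI])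
  then show ?thesis using that by blast
qed

lemma Basis_expansion: "u = (\<Sum>b\<in>Basis. scl (representation Basis u b) b)"
  using sum_representation_eq[OF independent_Basis, of u Basis] finite_Basis span_Basis by simp

lemma lin_trace_rank_one:
  "lin_trace scl Basis (\<lambda>u. scl (\<beta> v u) w) = \<beta> v w"
proof -
  have "lin_trace scl Basis (\<lambda>u. scl (\<beta> v u) w) = (\<Sum>b\<in>Basis. \<beta> v b * representation Basis w b)"
    by (simp add: lin_trace_def representation_scale independent_Basis span_Basis)
  also have "\<dots> = \<beta> v (\<Sum>b\<in>Basis. scl (representation Basis w b) b)"
    by (simp add: beta_sum_right mult.commute)
  finally show ?thesis
    using Basis_expansion[of w] by simp
qed

lemma lin_trace_sum:
  "finite A \<Longrightarrow> lin_trace scl Basis (\<lambda>u. \<Sum>a\<in>A. scl (k a) (x a u)) = (\<Sum>a\<in>A. k a * lin_trace scl Basis (x a))"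
  unfolding lin_trace_def
  by (simp add: representation_sum representation_scale independent_Basis span_Basis sum_distrib_left)
    (rule sum.swap)

text \<open>
  The matrix expansion of \<open>x\<close> in an enumerated basis and its dual basis with respect to \<open>\<beta>\<close>. The
  coefficients form a symmetric matrix, whence \<open>x\<close> is a combination of elements \<open>sq_elem\<close> and \<open>pair_elem\<close>.
\<close>
lemma sp_decomposition:
  obtains N :: nat and e D :: "nat \<Rightarrow> 'v" where
    "\<And>i j. i < N \<Longrightarrow> j < N \<Longrightarrow> \<beta> (e i) (D j) = (if i = j then 1 else 0)"
    "\<And>x u. x \<in> spV \<Longrightarrow> x u = (\<Sum>i<N. \<Sum>j<N. scl (\<beta> (D i) (x (D j))) (scl (\<beta> (e i) u) (e j)))"
proof -
  obtain E where E: "\<And>b u. b \<in> Basis \<Longrightarrow> \<beta> (E b) u = representation Basis u b"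
    using dual_basis_exists by blast
  obtain e where e: "bij_betw e {..<card Basis} Basis"
    using ex_bij_betw_nat_finite[OF finite_Basis] by (auto simp: atLeast0LessThan)
  define N where "N = card Basis"
  define D where "D i = E (e i)" for i
  have eB: "e i \<in> Basis" if "i < N" for i
    using e that by (auto simp: N_def bij_betw_def)
  have dual: "\<beta> (e i) (D j) = (if i = j then 1 else 0)" if "i < N" "j < N" for i j
  proof -
    have "\<beta> (e i) (D j) = representation Basis (e i) (e j)"
      using E[OF eB[OF that(2)], of "e i"] by (simp add: D_def beta_sym)
    also have "\<dots> = (if e i = e j then 1 else 0)"
      using representation_basis[OF independent_Basis eB[OF that(1)]] by simp
    also have "\<dots> = (if i = j then 1 else 0)"
      using e that by (simp add: N_def bij_betw_def inj_on_eq_iff[of e "{..<card Basis}"])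
    finally show ?thesis .
  qed
  have expand: "u = (\<Sum>i<N. scl (\<beta> (D i) u) (e i))" for u
  proof -
    have "u = (\<Sum>b\<in>Basis. scl (\<beta> (E b) u) b)"
      using Basis_expansion[of u] E by simp
    also have "\<dots> = (\<Sum>i<N. scl (\<beta> (D i) u) (e i))"
      unfolding D_def N_def by (rule sum.reindex_bij_betw[OF e, symmetric])
    finally show ?thesis .
  qed
  have "x u = (\<Sum>i<N. \<Sum>j<N. scl (\<beta> (D i) (x (D j))) (scl (\<beta> (e i) u) (e j)))" if x: "x \<in> spV" for x u
  proof -
    have "x u = (\<Sum>j<N. scl (\<beta> (D j) (x u)) (e j))"
      by (rule expand)
    also have "\<dots> = (\<Sum>j<N. scl (\<beta> (x (D j)) u) (e j))"
      using x by (simp add: sp_iff)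
    also have "\<dots> = (\<Sum>j<N. scl (\<Sum>i<N. \<beta> (D i) (x (D j)) * \<beta> (e i) u) (e j))"
    proof (rule sum.cong[OF refl])
      fix j
      have "\<beta> (x (D j)) u = \<beta> (\<Sum>i<N. scl (\<beta> (D i) (x (D j))) (e i)) u"
        using expand[of "x (D j)"] by simp
      then show "scl (\<beta> (x (D j)) u) (e j) = scl (\<Sum>i<N. \<beta> (D i) (x (D j)) * \<beta> (e i) u) (e j)"
        by (simp add: beta_sum_left)
    qed
    also have "\<dots> = (\<Sum>j<N. \<Sum>i<N. scl (\<beta> (D i) (x (D j))) (scl (\<beta> (e i) u) (e j)))"
      by (simp add: scale_sum_left)
    also have "\<dots> = (\<Sum>i<N. \<Sum>j<N. scl (\<beta> (D i) (x (D j))) (scl (\<beta> (e i) u) (e j)))"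
      by (rule sum.swap)
    finally show ?thesis .
  qed
  with dual show ?thesis by (rule that)
qed

end

context symplectic_char2
begin

lemma dual_expansion:
  fixes N :: nat
  assumes \<xi>: "\<xi> \<in> spV_dual" and s: "\<And>i j. s i j = s j i"
    and x: "x = (\<lambda>u. \<Sum>i<N. \<Sum>j<N. scl (s i j) (scl (\<beta> (e i) u) (e j)))"
  shows "\<xi> x = (\<Sum>i<N. s i i * \<xi> (sq_elem (e i))) + (\<Sum>j<N. \<Sum>i<j. s i j * \<xi> (pair_elem (e i) (e j)))"
proof -
  let ?y = "\<lambda>u. \<Sum>i<N. scl (s i i) (sq_elem (e i) u)"
  let ?z = "\<lambda>j u. \<Sum>i<j. scl (s i j) (pair_elem (e i) (e j) u)"
  have x_eq: "x = (\<lambda>u. ?y u + (\<Sum>j<N. scl 1 (?z j u)))"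
  proof
    fix u
    have "scl (s i j) (scl (\<beta> (e i) u) (e j)) + scl (s j i) (scl (\<beta> (e j) u) (e i))
        = scl (s i j) (pair_elem (e i) (e j) u)" for i j
      using s[of j i] by (simp add: pair_elem_def scale_right_distrib)
    then have "(\<Sum>j<N. \<Sum>i<j. scl (s i j) (scl (\<beta> (e i) u) (e j)) + scl (s j i) (scl (\<beta> (e j) u) (e i)))
        = (\<Sum>j<N. scl 1 (?z j u))"
      by (simp only: scale_one)
    moreover have "(\<Sum>i<N. scl (s i i) (scl (\<beta> (e i) u) (e i))) = ?y u"
      by (simp only: sq_elem_def)
    ultimately show "x u = ?y u + (\<Sum>j<N. scl 1 (?z j u))"
      using sum_square_split[of "\<lambda>i j. scl (s i j) (scl (\<beta> (e i) u) (e j))" N]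
      by (simp only: x)
  qed
  have y: "?y \<in> spV"
    using sp_lincomb[of "{..<N}" "\<lambda>i. sq_elem (e i)" "\<lambda>i. s i i"] sq_elem_sp by simp
  have z: "?z j \<in> spV" for j
    using sp_lincomb[of "{..<j}" "\<lambda>i. pair_elem (e i) (e j)" "\<lambda>i. s i j"] pair_elem_sp by simp
  have "(\<lambda>u. \<Sum>j<N. scl 1 (?z j u)) \<in> spV"
    by (rule sp_lincomb) (rule z)
  then have "\<xi> x = \<xi> ?y + \<xi> (\<lambda>u. \<Sum>j<N. scl 1 (?z j u))"
    unfolding x_eq by (rule dual_add[OF \<xi> y])
  also have "\<xi> ?y = (\<Sum>i<N. s i i * \<xi> (sq_elem (e i)))"
    by (rule dual_lincomb[OF \<xi>]) (auto intro: sq_elem_sp)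
  also have "\<xi> (\<lambda>u. \<Sum>j<N. scl 1 (?z j u)) = (\<Sum>j<N. 1 * \<xi> (?z j))"
    by (rule dual_lincomb[OF \<xi>]) (auto intro: z)
  also have "\<dots> = (\<Sum>j<N. \<Sum>i<j. s i j * \<xi> (pair_elem (e i) (e j)))"
  proof (rule sum.cong[OF refl])
    fix j
    show "1 * \<xi> (?z j) = (\<Sum>i<j. s i j * \<xi> (pair_elem (e i) (e j)))"
      using dual_lincomb[OF \<xi>, of "{..<j}" "\<lambda>i. pair_elem (e i) (e j)" "\<lambda>i. s i j"] pair_elem_sp
      by simp
  qed
  finally show ?thesis .
qed

lemma sp_coeff_sym:
  "x \<in> spV \<Longrightarrow> \<beta> a (x b) = \<beta> b (x a)"
  by (metis beta_sym sp_iff)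

text \<open>
  The bilinear form \<open>\<beta>(e_i, X e_j)\<close> is prescribed on a basis as an upper triangular matrix: values of
  \<open>\<xi>\<close> on \<open>sq_elem\<close> on the diagonal and on \<open>pair_elem\<close> above it. Pairing it with a symmetric matrix
  gives \<open>\<xi>\<close> again.
\<close>
lemma dual_representation:
  assumes \<xi>: "\<xi> \<in> spV_dual"
  shows "\<exists>X. X \<in> gl scl \<and> (\<forall>x\<in>spV. \<xi> x = lin_trace scl Basis (X \<circ> x))"
proof -
  obtain N :: nat and e D :: "nat \<Rightarrow> 'v" where
    dual: "\<And>i j. i < N \<Longrightarrow> j < N \<Longrightarrow> \<beta> (e i) (D j) = (if i = j then 1 else 0)"
    and dec: "\<And>x u. x \<in> spV \<Longrightarrow> x u = (\<Sum>i<N. \<Sum>j<N. scl (\<beta> (D i) (x (D j))) (scl (\<beta> (e i) u) (e j)))"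
    using sp_decomposition by blast
  (* The entries below the diagonal are zero, so that each off-diagonal coefficient counts once. *)
  define M where "M i j = (if i = j then \<xi> (sq_elem (e i)) else if i < j then \<xi> (pair_elem (e i) (e j)) else 0)" for i j
  define X where "X u = (\<Sum>i<N. \<Sum>j<N. scl (M i j * \<beta> (D j) u) (D i))" for u
  have lin: "lin X"
    by (rule linI) (simp_all add: X_def scale_left_distrib scale_sum_right sum.distrib distrib_left ac_simps)
  have XM: "\<beta> (e i) (X (e j)) = M i j" if i: "i < N" and j: "j < N" for i j
  proof -
    have "\<beta> (e i) (X (e j)) = (\<Sum>k<N. \<Sum>l<N. M k l * \<beta> (D l) (e j) * \<beta> (e i) (D k))"
      by (simp add: X_def beta_sum_right)
    also have "\<dots> = (\<Sum>k<N. \<Sum>l<N. if k = i \<and> l = j then M i j else 0)"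
    proof (intro sum.cong refl)
      fix k l assume "k \<in> {..<N}" "l \<in> {..<N}"
      then have "\<beta> (e i) (D k) = (if i = k then 1 else 0)" "\<beta> (D l) (e j) = (if j = l then 1 else 0)"
        using dual[of i k] dual[of j l] i j beta_sym[of "D l" "e j"] by auto
      then show "M k l * \<beta> (D l) (e j) * \<beta> (e i) (D k) = (if k = i \<and> l = j then M i j else 0)"
        by auto
    qed
    also have "\<dots> = (\<Sum>k<N. if k = i then M i j else 0)"
      using j by (intro sum.cong refl) auto
    finally show ?thesis using i by simp
  qed
  have "\<xi> x = lin_trace scl Basis (X \<circ> x)" if x: "x \<in> spV" for x
  proof -
    define s where "s i j = \<beta> (D i) (x (D j))" for i j
    have s: "s i j = s j i" for i j
      unfolding s_def using sp_coeff_sym[OF x] .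
    have x_eq: "x = (\<lambda>u. \<Sum>i<N. \<Sum>j<N. scl (s i j) (scl (\<beta> (e i) u) (e j)))"
      unfolding s_def by (rule ext) (rule dec[OF x])
    have "X (x u) = (\<Sum>i<N. scl 1 (\<Sum>j<N. scl (s i j) (scl (\<beta> (e i) u) (X (e j)))))" for u
      using arg_cong[OF fun_cong[OF x_eq], of X u]
      by (simp only: lin_sum[OF lin] lin_scale[OF lin] scale_one)
    then have "X \<circ> x = (\<lambda>u. \<Sum>i<N. scl 1 (\<Sum>j<N. scl (s i j) (scl (\<beta> (e i) u) (X (e j)))))"
      by (simp add: fun_eq_iff)
    then have "lin_trace scl Basis (X \<circ> x)
        = (\<Sum>i<N. 1 * lin_trace scl Basis (\<lambda>u. \<Sum>j<N. scl (s i j) (scl (\<beta> (e i) u) (X (e j)))))"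
      using lin_trace_sum[of "{..<N}" "\<lambda>_. 1" "\<lambda>i u. \<Sum>j<N. scl (s i j) (scl (\<beta> (e i) u) (X (e j)))"]
      by (simp only: finite_lessThan simp_thms)
    also have "\<dots> = (\<Sum>i<N. \<Sum>j<N. s i j * M i j)"
    proof (rule sum.cong[OF refl])
      fix i assume i: "i \<in> {..<N}"
      have "lin_trace scl Basis (\<lambda>u. \<Sum>j<N. scl (s i j) (scl (\<beta> (e i) u) (X (e j))))
          = (\<Sum>j<N. s i j * \<beta> (e i) (X (e j)))"
        unfolding lin_trace_sum[OF finite_lessThan] lin_trace_rank_one ..
      then show "1 * lin_trace scl Basis (\<lambda>u. \<Sum>j<N. scl (s i j) (scl (\<beta> (e i) u) (X (e j))))
          = (\<Sum>j<N. s i j * M i j)"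
        using XM i by simp
    qed
    also have "\<dots> = (\<Sum>i<N. s i i * \<xi> (sq_elem (e i))) + (\<Sum>j<N. \<Sum>i<j. s i j * \<xi> (pair_elem (e i) (e j)))"
      unfolding sum_square_split[of "\<lambda>i j. s i j * M i j"]
      by (intro arg_cong2[where f = "(+)"] sum.cong refl) (auto simp: M_def)
    also have "\<dots> = \<xi> x"
      by (rule dual_expansion[OF \<xi> s x_eq, symmetric])
    finally show ?thesis ..
  qed
  then show ?thesis
    using lin by (auto simp: gl_iff)
qed

text \<open>
  The elements \<open>sq_elem v\<close> span the Lie algebra, so the quadratic form determines the functional.
\<close>
lemma dual_eqI:
  assumes \<xi>: "\<xi> \<in> spV_dual" and \<zeta>: "\<zeta> \<in> spV_dual"
    and eq: "\<And>v. \<xi> (sq_elem v) = \<zeta> (sq_elem v)"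
  shows "\<xi> = \<zeta>"
proof (rule extensionalityI)
  show "\<xi> \<in> extensional spV" "\<zeta> \<in> extensional spV"
    using \<xi> \<zeta> by (auto simp: sp_dual_def)
  have pair: "\<xi> (pair_elem v w) = \<zeta> (pair_elem v w)" for v w
  proof -
    have "\<xi> (sq_elem v) + \<xi> (sq_elem w) + \<xi> (pair_elem v w)
        = \<zeta> (sq_elem v) + \<zeta> (sq_elem w) + \<zeta> (pair_elem v w)"
      using eq[of "v + w"] unfolding dual_sq_add[OF \<xi>] dual_sq_add[OF \<zeta>] .
    then show ?thesis
      unfolding eq add_left_cancel .
  qed
  fix x assume x: "x \<in> spV"
  obtain N :: nat and e D :: "nat \<Rightarrow> 'v" where
    "\<And>i j. i < N \<Longrightarrow> j < N \<Longrightarrow> \<beta> (e i) (D j) = (if i = j then 1 else 0)"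
    and dec: "\<And>x u. x \<in> spV \<Longrightarrow> x u = (\<Sum>i<N. \<Sum>j<N. scl (\<beta> (D i) (x (D j))) (scl (\<beta> (e i) u) (e j)))"
    using sp_decomposition by blast
  have "x = (\<lambda>u. \<Sum>i<N. \<Sum>j<N. scl (\<beta> (D i) (x (D j))) (scl (\<beta> (e i) u) (e j)))"
    by (rule ext) (rule dec[OF x])
  from dual_expansion[OF \<xi> sp_coeff_sym[OF x] this] dual_expansion[OF \<zeta> sp_coeff_sym[OF x] this]
  show "\<xi> x = \<zeta> x"
    unfolding eq pair by (rule trans[OF _ sym])
qed

text \<open>
  The choice of \<open>X\<close> in the definition of \<open>\<alpha>\<close> is immaterial because the trace of \<open>X \<circ> sq_elem v\<close> is
  \<open>\<beta>(v, X v)\<close>.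
\<close>
lemma alpha_eq:
  assumes \<xi>: "\<xi> \<in> spV_dual"
  shows "alpha_form \<xi> v = \<xi> (sq_elem v)"
proof -
  define X where "X = (SOME X. X \<in> gl scl \<and> (\<forall>x\<in>spV. \<xi> x = lin_trace scl Basis (X \<circ> x)))"
  have X: "X \<in> gl scl \<and> (\<forall>x\<in>spV. \<xi> x = lin_trace scl Basis (X \<circ> x))"
    unfolding X_def by (rule someI_ex[OF dual_representation[OF \<xi>]])
  have "X \<circ> sq_elem v = (\<lambda>u. scl (\<beta> v u) (X v))"
    using X by (auto simp: gl_iff sq_elem_def lin_scale)
  then have "\<xi> (sq_elem v) = \<beta> v (X v)"
    using X sq_elem_sp[of v] lin_trace_rank_one by simp
  then show ?thesis
    by (simp add: alpha_def X_def)
qed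

lemma beta_xi_eq:
  "\<xi> \<in> spV_dual \<Longrightarrow> beta_xi scl Basis \<beta> \<xi> v w = \<xi> (pair_elem v w)"
  by (simp add: beta_xi_def alpha_eq dual_sq_add ac_simps)

lemma dual_pair_lfun: "\<xi> \<in> spV_dual \<Longrightarrow> lfun (\<lambda>w. \<xi> (pair_elem v w))"
proof (rule lfunI)
  assume \<xi>: "\<xi> \<in> spV_dual"
  have "pair_elem v (x + y) = (\<lambda>u. pair_elem v x u + pair_elem v y u)" for x y
    by (simp add: pair_elem_def fun_eq_iff scale_left_distrib scale_right_distrib algebra_simps)
  then show "\<xi> (pair_elem v (x + y)) = \<xi> (pair_elem v x) + \<xi> (pair_elem v y)" for x y
    using dual_add[OF \<xi> pair_elem_sp pair_elem_sp] by metis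
  have "pair_elem v (scl c x) = (\<lambda>u. scl c (pair_elem v x u))" for c x
    by (simp add: pair_elem_def fun_eq_iff scale_right_distrib mult.commute)
  then show "\<xi> (pair_elem v (scl c x)) = c * \<xi> (pair_elem v x)" for c x
    using dual_scale[OF \<xi> pair_elem_sp] by metis
qed

lemma pair_elem_sym: "pair_elem v w = pair_elem w v"
  by (simp add: pair_elem_def add.commute)

lemma T_xi_eq:
  assumes \<xi>: "\<xi> \<in> spV_dual"
  shows "\<beta> (Txi \<xi> v) w = \<xi> (pair_elem v w)"
proof -
  obtain u where u: "\<And>w. \<xi> (pair_elem v w) = \<beta> u w"
    using functional_representation[OF dual_pair_lfun[OF \<xi>]] by metis
  have "Txi \<xi> v = u"
    unfolding T_xi_def beta_xi_eq[OF \<xi>] u by (rule the_equality) (auto intro: beta_left_cancel)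
  then show ?thesis using u by simp
qed

lemma T_xi_lin:
  assumes \<xi>: "\<xi> \<in> spV_dual" shows "lin (Txi \<xi>)"
proof (rule linI)
  have sym: "\<xi> (pair_elem v w) = \<xi> (pair_elem w v)" for v w
    using pair_elem_sym by simp
  show "Txi \<xi> (x + y) = Txi \<xi> x + Txi \<xi> y" for x y
  proof (rule beta_left_cancel)
    fix w show "\<beta> (Txi \<xi> (x + y)) w = \<beta> (Txi \<xi> x + Txi \<xi> y) w"
      using lfun_add[OF dual_pair_lfun[OF \<xi>], of w x y]
      by (simp add: T_xi_eq[OF \<xi>] sym[of _ w])
  qed
  show "Txi \<xi> (scl c x) = scl c (Txi \<xi> x)" for c x
  proof (rule beta_left_cancel)
    fix w show "\<beta> (Txi \<xi> (scl c x)) w = \<beta> (scl c (Txi \<xi> x)) w"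
      using lfun_scale[OF dual_pair_lfun[OF \<xi>], of w c x]
      by (simp add: T_xi_eq[OF \<xi>] sym[of _ w])
  qed
qed

lemma dual_form_module:
  assumes \<xi>: "\<xi> \<in> spV_dual" and nil: "\<exists>N. \<forall>v. (Txi \<xi> ^^ N) v = 0"
  shows "form_module scl Basis \<beta> (alpha_form \<xi>) (Txi \<xi>)"
  unfolding form_module_def form_module_axioms_def
proof (intro conjI allI)
  show "alpha_form \<xi> (scl c v) = c\<^sup>2 * alpha_form \<xi> v" for c v
  proof -
    have "sq_elem (scl c v) = (\<lambda>u. scl (c\<^sup>2) (sq_elem v u))"
      by (simp add: sq_elem_def fun_eq_iff power2_eq_square ac_simps)
    then show ?thesis
      using dual_scale[OF \<xi> sq_elem_sp] by (simp add: alpha_eq[OF \<xi>])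
  qed
  show "alpha_form \<xi> (v + w)
      = alpha_form \<xi> v + alpha_form \<xi> w + \<beta> (Txi \<xi> v) w" for v w
    by (simp add: alpha_eq[OF \<xi>] T_xi_eq[OF \<xi>] dual_sq_add[OF \<xi>])
qed (rule symplectic_char2_axioms T_xi_lin[OF \<xi>] nil)+

lemma conj_sp:
  assumes g: "g \<in> carrier SpV" and x: "x \<in> spV"
  shows "inv_into UNIV g \<circ> x \<circ> g \<in> spV"
proof -
  have "lin (inv_into UNIV g \<circ> x \<circ> g)"
    using Sp_lin[OF g] Sp_lin[OF Sp_inv_closed[OF g]] x unfolding o_def by (auto simp: sp_iff intro: lin_comp)
  moreover have "\<beta> ((inv_into UNIV g \<circ> x \<circ> g) v) w = \<beta> v ((inv_into UNIV g \<circ> x \<circ> g) w)" for v w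
  proof -
    have "\<beta> (inv_into UNIV g (x (g v))) w = \<beta> (x (g v)) (g w)"
      using Sp_adjoint[OF g] by simp
    also have "\<dots> = \<beta> (g v) (x (g w))"
      using x by (simp add: sp_iff)
    also have "\<dots> = \<beta> v (inv_into UNIV g (x (g w)))"
      using Sp_isometry[OF g, of v "inv_into UNIV g (x (g w))"] g by simp
    finally show ?thesis by simp
  qed
  ultimately show ?thesis by (simp add: sp_iff)
qed

lemma coadjoint_dual:
  assumes g: "g \<in> carrier SpV" and \<xi>: "\<xi> \<in> spV_dual"
  shows "coad g \<xi> \<in> spV_dual"
proof -
  note lg = Sp_lin[OF Sp_inv_closed[OF g]]
  have "\<xi> (inv_into UNIV g \<circ> (\<lambda>v. x v + y v) \<circ> g) = \<xi> (inv_into UNIV g \<circ> x \<circ> g) + \<xi> (inv_into UNIV g \<circ> y \<circ> g)"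
    if "x \<in> spV" "y \<in> spV" for x y
    using dual_add[OF \<xi> conj_sp[OF g that(1)] conj_sp[OF g that(2)]] by (simp add: o_def lin_add[OF lg])
  moreover have "\<xi> (inv_into UNIV g \<circ> (\<lambda>v. scl c (x v)) \<circ> g) = c * \<xi> (inv_into UNIV g \<circ> x \<circ> g)"
    if "x \<in> spV" for c x
    using dual_scale[OF \<xi> conj_sp[OF g that]] by (simp add: o_def lin_scale[OF lg])
  moreover have "(\<lambda>v. scl c (x v)) \<in> spV" if "x \<in> spV" for c x
    using sp_lincomb[of "{()}" "\<lambda>_. x" "\<lambda>_. c"] that by simp
  ultimately show ?thesis
    by (auto simp: sp_dual_def coadjoint_def sp_add)
qed

lemma coadjoint_apply:
  "x \<in> spV \<Longrightarrow> coad g \<xi> x = \<xi> (inv_into UNIV g \<circ> x \<circ> g)"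
  by (simp add: coadjoint_def)

lemma conj_sq_elem:
  assumes g: "g \<in> carrier SpV"
  shows "inv_into UNIV g \<circ> sq_elem v \<circ> g = sq_elem (inv_into UNIV g v)"
  using Sp_adjoint[OF g] Sp_lin[OF Sp_inv_closed[OF g]] by (auto simp: sq_elem_def fun_eq_iff lin_scale)

lemma conj_pair_elem:
  assumes g: "g \<in> carrier SpV"
  shows "inv_into UNIV g \<circ> pair_elem v w \<circ> g = pair_elem (inv_into UNIV g v) (inv_into UNIV g w)"
  using Sp_adjoint[OF g] Sp_lin[OF Sp_inv_closed[OF g]]
  by (auto simp: pair_elem_def fun_eq_iff lin_scale lin_add)

lemma alpha_coadjoint:
  assumes g: "g \<in> carrier SpV" and \<xi>: "\<xi> \<in> spV_dual"
  shows "alpha_form (coad g \<xi>) v = alpha_form \<xi> (inv_into UNIV g v)"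
  unfolding alpha_eq[OF coadjoint_dual[OF g \<xi>]] alpha_eq[OF \<xi>] coadjoint_apply[OF sq_elem_sp]
    conj_sq_elem[OF g] ..

lemma T_xi_coadjoint:
  assumes g: "g \<in> carrier SpV" and \<xi>: "\<xi> \<in> spV_dual"
  shows "Txi (coad g \<xi>) = g \<circ> Txi \<xi> \<circ> inv_into UNIV g"
proof
  fix v
  show "Txi (coad g \<xi>) v = (g \<circ> Txi \<xi> \<circ> inv_into UNIV g) v"
  proof (rule beta_left_cancel)
    fix w
    have "\<beta> (Txi (coad g \<xi>) v) w
        = \<beta> (Txi \<xi> (inv_into UNIV g v)) (inv_into UNIV g w)"
      unfolding T_xi_eq[OF coadjoint_dual[OF g \<xi>]] T_xi_eq[OF \<xi>] coadjoint_apply[OF pair_elem_sp]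
        conj_pair_elem[OF g] ..
    also have "\<dots> = \<beta> (g (Txi \<xi> (inv_into UNIV g v))) w"
      using Sp_isometry[OF g, of _ "inv_into UNIV g w"] g by simp
    finally show "\<beta> (Txi (coad g \<xi>) v) w
        = \<beta> ((g \<circ> Txi \<xi> \<circ> inv_into UNIV g) v) w" by simp
  qed
qed

lemma conj_funpow:
  assumes h: "bij h"
  shows "((h \<circ> S \<circ> inv_into UNIV h) ^^ i) v = h ((S ^^ i) (inv_into UNIV h v))"
  using h by (induction i) (simp_all add: bij_def surj_f_inv_f)

lemma nondeg_submodule_UNIV: "nondeg_submodule T UNIV"
  using nondegenerate by (auto simp: nondeg_submodule_def)

lemma index_fun_eq: "index_fun scl Basis \<beta> \<xi> m = index_on (alpha_form \<xi>) (Txi \<xi>) UNIV m"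
  by (simp add: index_fun_def index_on_def)

text \<open>
  From left to right, conjugation transports \<open>T\<close> and \<open>\<alpha>\<close>. From right to left, conjugate operators
  have powers of equal rank, so the classification applies with both submodules equal to \<open>V\<close>; the isometry it
  yields is the required group element.
\<close>
theorem orbit_iff:
  assumes \<xi>: "\<xi> \<in> spV_dual" and nil_\<xi>: "\<exists>N. \<forall>v. (Txi \<xi> ^^ N) v = 0"
    and \<zeta>: "\<zeta> \<in> spV_dual" and nil_\<zeta>: "\<exists>N. \<forall>v. (Txi \<zeta> ^^ N) v = 0"
  shows "\<zeta> \<in> orbit SpV (coad) \<xi> \<longleftrightarrow>
    GL_conjugate scl (Txi \<xi>) (Txi \<zeta>) \<and>
    index_fun scl Basis \<beta> \<xi> = index_fun scl Basis \<beta> \<zeta>"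
proof (intro iffI conjI)
  assume "\<zeta> \<in> orbit SpV (coad) \<xi>"
  then obtain g where g: "g \<in> carrier SpV" and \<zeta>_eq: "\<zeta> = coad g \<xi>"
    by (auto simp: orbit_def)
  have gGL: "g \<in> carrier (GL scl)"
    using g by (simp add: Sp_def)
  then show "GL_conjugate scl (Txi \<xi>) (Txi \<zeta>)"
    using T_xi_coadjoint[OF g \<xi>] by (auto simp: GL_conjugate_def \<zeta>_eq)
  have bij: "bij g" by (rule Sp_bij[OF g])
  have g0: "g z = 0 \<longleftrightarrow> z = 0" for z
    using Sp_bij[OF g] lin_0[OF Sp_lin[OF g]] by (metis Sp_inv_left[OF g])
  have "(\<forall>v. (Txi \<zeta> ^^ m) v = 0 \<longrightarrow> alpha_form \<zeta> ((Txi \<zeta> ^^ i) v) = 0)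
      \<longleftrightarrow> (\<forall>v. (Txi \<xi> ^^ m) v = 0 \<longrightarrow> alpha_form \<xi> ((Txi \<xi> ^^ i) v) = 0)"
    for m i
  proof -
    have "(\<forall>v. (Txi \<zeta> ^^ m) v = 0 \<longrightarrow> alpha_form \<zeta> ((Txi \<zeta> ^^ i) v) = 0)
      \<longleftrightarrow> (\<forall>v. (Txi \<xi> ^^ m) (inv_into UNIV g v) = 0
        \<longrightarrow> alpha_form \<xi> ((Txi \<xi> ^^ i) (inv_into UNIV g v)) = 0)"
      unfolding \<zeta>_eq T_xi_coadjoint[OF g \<xi>] alpha_coadjoint[OF g \<xi>] conj_funpow[OF bij] g0 Sp_inv_left[OF g] ..
    also have "\<dots> \<longleftrightarrow> (\<forall>v. (Txi \<xi> ^^ m) v = 0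
        \<longrightarrow> alpha_form \<xi> ((Txi \<xi> ^^ i) v) = 0)"
      by (metis Sp_inv_left[OF g])
    finally show ?thesis .
  qed
  then show "index_fun scl Basis \<beta> \<xi> = index_fun scl Basis \<beta> \<zeta>"
    by (simp add: index_fun_def fun_eq_iff)
next
  let ?T = "Txi \<xi>" and ?T' = "Txi \<zeta>"
  assume "GL_conjugate scl ?T ?T' \<and> index_fun scl Basis \<beta> \<xi> = index_fun scl Basis \<beta> \<zeta>"
  then have index: "index_fun scl Basis \<beta> \<xi> = index_fun scl Basis \<beta> \<zeta>"
    and "\<exists>h. lin h \<and> bij h \<and> ?T' = h \<circ> ?T \<circ> inv_into UNIV h"
    by (auto simp: GL_conjugate_def GL_def gl_iff)
  then obtain h where h: "lin h" "bij h" "?T' = h \<circ> ?T \<circ> inv_into UNIV h" by blast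
  have "dim (range (?T ^^ j)) = dim (range (?T' ^^ j))" for j
  proof -
    have "range (?T' ^^ j) = h ` range (?T ^^ j)"
      unfolding h(3) using h(2) by (auto simp: conj_funpow image_iff bij_def surj_f_inv_f) (metis inv_f_f)
    moreover have "inj_on h (span (range (?T ^^ j)))"
      using h(2) by (meson bij_def inj_on_subset subset_UNIV)
    ultimately show ?thesis
      using endo.dim_image_eq[OF h(1), of "range (?T ^^ j)"] by simp
  qed
  then obtain g where g: "lin g" "\<And>u. alpha_form \<zeta> (g u) = alpha_form \<xi> u"
    "\<And>u y. \<beta> (g u) (g y) = \<beta> u y"
    using form_modules_isometric[OF dual_form_module[OF \<xi> nil_\<xi>] dual_form_module[OF \<zeta> nil_\<zeta>]
        nondeg_submodule_UNIV nondeg_submodule_UNIV] fun_cong[OF index]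
    unfolding index_fun_eq by auto
  then have gSp: "g \<in> carrier SpV"
    by (simp add: Sp_iff)
  have "\<zeta> = coad g \<xi>"
  proof (rule dual_eqI[OF \<zeta> coadjoint_dual[OF gSp \<xi>]])
    fix v
    have "alpha_form \<zeta> v = alpha_form (coad g \<xi>) v"
      using g(2)[of "inv_into UNIV g v"] gSp by (simp add: alpha_coadjoint[OF gSp \<xi>])
    then show "\<zeta> (sq_elem v) = coad g \<xi> (sq_elem v)"
      by (simp add: alpha_eq \<zeta> coadjoint_dual[OF gSp \<xi>])
  qed
  then show "\<zeta> \<in> orbit SpV (coad) \<xi>"
    using gSp by (auto simp: orbit_def)
qed

end

section \<open>Zariski connectedness and polynomial functions with finitely many values\<close>

context symplectic_char2
begin

text \<open>
  The only consequence of connectedness that the Lie-Kolchin argument uses. Unlike connectedness itself it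
  passes to derived subgroups by pure algebra.
\<close>
definition rigid :: "('v \<Rightarrow> 'v) set \<Rightarrow> bool" where
  "rigid H \<longleftrightarrow> (\<forall>f\<in>polys. finite (f ` H) \<longrightarrow> (\<forall>g\<in>H. \<forall>h\<in>H. f g = f h))"

lemma polyfun_sum: "finite A \<Longrightarrow> (\<And>a. a \<in> A \<Longrightarrow> f a \<in> polys) \<Longrightarrow> (\<lambda>x. \<Sum>a\<in>A. f a x) \<in> polys"
  by (induction A rule: finite_induct) (auto intro: polyfun.intros)

lemma polyfun_prod: "finite A \<Longrightarrow> (\<And>a. a \<in> A \<Longrightarrow> f a \<in> polys) \<Longrightarrow> (\<lambda>x. \<Prod>a\<in>A. f a x) \<in> polys"
  by (induction A rule: finite_induct) (auto intro: polyfun.intros)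

lemma lfun_comp: "lfun \<phi> \<Longrightarrow> lin a \<Longrightarrow> lfun (\<lambda>x. \<phi> (a x))"
  by (rule lfunI) (simp_all add: lfun_add lfun_scale lin_add lin_scale)

lemma polyfun_beta:
  assumes "lin h" shows "(\<lambda>x. \<beta> (x u) (h (x y))) \<in> polys"
proof -
  obtain E where E: "\<And>b u. b \<in> Basis \<Longrightarrow> \<beta> (E b) u = representation Basis u b"
    using dual_basis_exists by blast
  have "\<beta> (x u) (h (x y)) = (\<Sum>b\<in>Basis. \<beta> (E b) (h (x y)) * \<beta> (x u) b)" for x :: "'v \<Rightarrow> 'v"
  proof -
    have "h (x y) = (\<Sum>b\<in>Basis. scl (\<beta> (E b) (h (x y))) b)"
      using Basis_expansion[of "h (x y)"] E by simp
    then have "\<beta> (x u) (h (x y)) = \<beta> (x u) (\<Sum>b\<in>Basis. scl (\<beta> (E b) (h (x y))) b)"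
      by simp
    then show ?thesis
      by (simp add: beta_sum_right)
  qed
  moreover have "(\<lambda>x. \<Sum>b\<in>Basis. \<beta> (E b) (h (x y)) * \<beta> (x u) b) \<in> polys"
    by (intro polyfun_sum finite_Basis polyfun.mult
        polyfun.entry[of _ "\<lambda>z. \<beta> (E _) (h z)"] polyfun.entry[of _ "\<lambda>z. \<beta> z _"]
        lfun_comp[OF beta_lfun(1) assms] beta_lfun(2))
  ultimately show ?thesis by simp
qed

lemma polyfun_translate: "f \<in> polys \<Longrightarrow> lin a \<Longrightarrow> (\<lambda>x. f (a \<circ> x)) \<in> polys"
proof (induction rule: polyfun.induct)
  case (entry \<phi> v)
  then show ?case
    using polyfun.entry[of scl "\<lambda>z. \<phi> (a z)" v] lfun_comp by (simp add: o_def)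
qed (auto intro: polyfun.intros)

text \<open>
  Inversion is polynomial on the symplectic group, since \<open>\<beta>(u, g\<^sup>-\<^sup>1 z) = \<beta>(g u, z)\<close>. Hence
  \<open>g \<mapsto> f (g\<^sup>-\<^sup>1 y g a)\<close> is polynomial for fixed \<open>y\<close> and \<open>a\<close>.
\<close>
lemma polyfun_conjugate:
  assumes "f \<in> polys" and y: "lin y"
  shows "\<exists>F\<in>polys. \<forall>x\<in>carrier SpV. F x = f (inv_into UNIV x \<circ> y \<circ> x \<circ> a)"
  using assms(1)
proof (induction rule: polyfun.induct)
  case (const c)
  then show ?case by (auto intro: polyfun.const)
next
  case (entry \<phi> v)
  obtain u where u: "\<And>v. \<phi> v = \<beta> u v"
    using functional_representation[OF entry] by metis
  have *: "\<beta> (x u) (y (x (a v))) = \<phi> ((inv_into UNIV x \<circ> y \<circ> x \<circ> a) v)" if "x \<in> carrier SpV" for x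
    using Sp_isometry[OF that, of u "inv_into UNIV x (y (x (a v)))"] that by (simp add: u)
  show ?case
    by (rule bexI[OF _ polyfun_beta[OF y, of u "a v"]]) (use * in blast)
next
  case (add f h)
  from add.IH obtain F G where F: "F \<in> polys" and G: "G \<in> polys"
    and FG: "\<And>x. x \<in> carrier SpV \<Longrightarrow> F x = f (inv_into UNIV x \<circ> y \<circ> x \<circ> a)"
      "\<And>x. x \<in> carrier SpV \<Longrightarrow> G x = h (inv_into UNIV x \<circ> y \<circ> x \<circ> a)" by blast
  show ?case
    by (rule bexI[OF _ polyfun.add[OF F G]], rule ballI) (simp only: FG)
next
  case (mult f h)
  from mult.IH obtain F G where F: "F \<in> polys" and G: "G \<in> polys"
    and FG: "\<And>x. x \<in> carrier SpV \<Longrightarrow> F x = f (inv_into UNIV x \<circ> y \<circ> x \<circ> a)"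
      "\<And>x. x \<in> carrier SpV \<Longrightarrow> G x = h (inv_into UNIV x \<circ> y \<circ> x \<circ> a)" by blast
  show ?case
    by (rule bexI[OF _ polyfun.mult[OF F G]], rule ballI) (simp only: FG)
qed

lemma zariski_open: "f \<in> polys \<Longrightarrow> openin zar {x \<in> gl scl. f x \<noteq> 0}"
  unfolding zariski_def by (rule topology_generated_by_Basis) blast

lemma topspace_zariski: "topspace zar = gl scl"
proof -
  have "gl scl \<in> {{x \<in> gl scl. f x \<noteq> 0} |f. f \<in> polys}"
    using polyfun.const[of 1 scl] by (intro CollectI exI[of _ "\<lambda>_. 1"]) auto
  then show ?thesis
    unfolding zariski_def topology_generated_by_topspace by auto
qed

text \<open>
  The level sets of a polynomial function with finitely many values are closed and open.
\<close>
lemma connected_imp_rigid: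
  assumes "connectedin zar H"
  shows "rigid H"
  unfolding rigid_def
proof (intro ballI impI, rule ccontr)
  fix f g h assume f: "f \<in> polys" and fin: "finite (f ` H)" and g: "g \<in> H" and h: "h \<in> H" and ne: "f g \<noteq> f h"
  have H: "H \<subseteq> gl scl"
    using connectedin_subset_topspace[OF assms] by (simp add: topspace_zariski)
  define E1 where "E1 = {x \<in> gl scl. f x + f g \<noteq> 0}"
  define E2 where "E2 = {x \<in> gl scl. (\<Prod>d\<in>f ` H - {f g}. f x + d) \<noteq> 0}"
  have "openin zar E1" "openin zar E2"
    unfolding E1_def E2_def
    by (intro zariski_open polyfun.add f polyfun.const polyfun_prod finite_Diff fin)+
  moreover have E1: "x \<in> E1 \<longleftrightarrow> f x \<noteq> f g" and E2: "x \<in> E2 \<longleftrightarrow> f x = f g" if "x \<in> H" for x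
    using that H fin by (auto simp: E1_def E2_def)
  moreover have "H \<subseteq> E1 \<union> E2" "E1 \<inter> E2 \<inter> H = {}"
    using E1 E2 by auto
  ultimately have "E1 \<inter> H = {} \<or> E2 \<inter> H = {}"
    using connectedinD[OF assms] by blast
  then show False
    using E1[OF h] E2[OF g] g h ne by auto
qed

interpretation Sp: group SpV
  by (rule group_Sp)

text \<open>
  If \<open>f\<close> has finitely many values on the derived group, then for fixed \<open>s\<close> and \<open>y\<close> the function
  \<open>z \<mapsto> f (s z\<^sup>-\<^sup>1 y z y\<^sup>-\<^sup>1)\<close> has finitely many values on \<open>H\<close>, hence equals its value \<open>f s\<close>
  at the identity. So multiplication by commutators does not change \<open>f\<close>.
\<close>
lemma rigid_derived:
  assumes H: "subgroup H SpV" and rigid: "rigid H"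
  shows "rigid (derived SpV H)"
  unfolding rigid_def
proof (intro ballI impI)
  let ?D = "derived SpV H"
  have HS: "H \<subseteq> carrier SpV"
    by (rule subgroup.subset[OF H])
  have D: "subgroup ?D SpV"
    by (rule Sp.derived_is_subgroup[OF HS])
  note DS = subgroup.subset[OF D]
  fix f g h assume f: "f \<in> polys" and fin: "finite (f ` ?D)" and g: "g \<in> ?D" and h: "h \<in> ?D"
  have comm: "f (s \<circ> c) = f s" if s: "s \<in> ?D" and c: "c \<in> derived_set SpV H" for s c
  proof -
    obtain x y where x: "x \<in> H" and y: "y \<in> H"
      and c_eq: "c = x \<otimes>\<^bsub>SpV\<^esub> y \<otimes>\<^bsub>SpV\<^esub> inv\<^bsub>SpV\<^esub> x \<otimes>\<^bsub>SpV\<^esub> inv\<^bsub>SpV\<^esub> y"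
      using c by blast
    have yS: "y \<in> carrier SpV" and xS: "x \<in> carrier SpV" using x y HS by auto
    have "(\<lambda>z. f (s \<circ> z)) \<in> polys"
      using polyfun_translate[OF f] Sp_lin s DS by blast
    then obtain F where F: "F \<in> polys"
      "\<And>z. z \<in> carrier SpV \<Longrightarrow> F z = f (s \<circ> (inv_into UNIV z \<circ> y \<circ> z \<circ> inv_into UNIV y))"
      using polyfun_conjugate[of "\<lambda>z. f (s \<circ> z)" y "inv_into UNIV y"] Sp_lin[OF yS] by blast
    have "F z \<in> f ` ?D" if z: "z \<in> H" for z
    proof -
      have zS: "z \<in> carrier SpV" using z HS by auto
      have "inv\<^bsub>SpV\<^esub> z \<in> H"
        by (rule subgroup.m_inv_closed[OF H z])
      moreover have "inv_into UNIV z \<circ> y \<circ> z \<circ> inv_into UNIV y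
          = inv\<^bsub>SpV\<^esub> z \<otimes>\<^bsub>SpV\<^esub> y \<otimes>\<^bsub>SpV\<^esub> inv\<^bsub>SpV\<^esub> (inv\<^bsub>SpV\<^esub> z) \<otimes>\<^bsub>SpV\<^esub> inv\<^bsub>SpV\<^esub> y"
        using Sp.inv_inv[OF zS] Sp_inv_eq[OF zS] Sp_inv_eq[OF yS] by simp
      ultimately have "inv_into UNIV z \<circ> y \<circ> z \<circ> inv_into UNIV y \<in> derived_set SpV H"
        using y by blast
      then have "inv_into UNIV z \<circ> y \<circ> z \<circ> inv_into UNIV y \<in> ?D"
        unfolding derived_def by (rule generate.incl)
      then have "s \<circ> (inv_into UNIV z \<circ> y \<circ> z \<circ> inv_into UNIV y) \<in> ?D"
        using subgroup.m_closed[OF D s] by simp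
      then show ?thesis
        using F(2)[OF zS] by blast
    qed
    then have "finite (F ` H)"
      using fin by (meson finite_subset image_subsetI)
    moreover have x': "inv_into UNIV x \<in> H"
      using subgroup.m_inv_closed[OF H x] Sp_inv_eq[OF xS] by simp
    moreover have one: "id \<in> H"
      using subgroup.one_closed[OF H] by simp
    ultimately have "F (inv_into UNIV x) = F id"
      using rigid F(1) unfolding rigid_def by blast
    moreover have "F id = f s"
      using F(2)[of id] one HS yS by (auto simp: o_def fun_eq_iff)
    moreover have "F (inv_into UNIV x) = f (s \<circ> c)"
    proof -
      have "inv_into UNIV (inv_into UNIV x) = x"
        using Sp_bij[OF xS] by (simp add: inv_inv_eq)
      then have "inv_into UNIV (inv_into UNIV x) \<circ> y \<circ> inv_into UNIV x \<circ> inv_into UNIV y = c"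
        using c_eq Sp_inv_eq[OF xS] Sp_inv_eq[OF yS] by simp
      then show ?thesis
        using F(2)[OF Sp_inv_closed[OF xS]] by simp
    qed
    ultimately show ?thesis by simp
  qed
  have gen: "f (s \<circ> g) = f s" if "g \<in> generate SpV (derived_set SpV H)" "s \<in> ?D" for g s
    using that
  proof (induction arbitrary: s rule: generate.induct)
    case one
    then show ?case by simp
  next
    case (incl h)
    then show ?case using comm by blast
  next
    case (inv h)
    have hD: "h \<in> ?D"
      unfolding derived_def using inv.hyps by (rule generate.incl)
    then have hS: "h \<in> carrier SpV" using DS by blast
    have "inv\<^bsub>SpV\<^esub> h \<in> ?D"
      by (rule subgroup.m_inv_closed[OF D hD])
    then have "s \<circ> inv\<^bsub>SpV\<^esub> h \<in> ?D"
      using subgroup.m_closed[OF D inv.prems] by simp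
    then have "f (s \<circ> inv\<^bsub>SpV\<^esub> h \<circ> h) = f (s \<circ> inv\<^bsub>SpV\<^esub> h)"
      using comm inv.hyps by blast
    moreover have "s \<circ> inv\<^bsub>SpV\<^esub> h \<circ> h = s"
      using hS by (simp add: Sp_inv_eq fun_eq_iff)
    ultimately show ?case by (simp only:)
  next
    case (eng h1 h2)
    have "h1 \<in> ?D"
      unfolding derived_def using eng.hyps(1) .
    then have "s \<circ> h1 \<in> ?D"
      using subgroup.m_closed[OF D eng.prems] by simp
    then show ?case
      using eng.IH(1)[OF eng.prems] eng.IH(2)[of "s \<circ> h1"] by (simp only: o_assoc Sp_mult)
  qed
  have "f k = f id" if "k \<in> ?D" for k
    using gen[of k id] that subgroup.one_closed[OF D] by (simp add: derived_def)
  then show "f g = f h"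
    using g h by simp
qed

end

section \<open>Eigenvectors modulo a subspace\<close>

context symplectic_char2
begin

text \<open>
  The value at \<open>w\<close> of the polynomial \<open>p\<close> in the operator \<open>h\<close>, by Horner's scheme.
\<close>
definition poly_map :: "('v \<Rightarrow> 'v) \<Rightarrow> 'k poly \<Rightarrow> 'v \<Rightarrow> 'v" where
  "poly_map h p w = fold_coeffs (\<lambda>a v. scl a w + h v) p 0"

lemma poly_map_0 [simp]: "poly_map h 0 w = 0"
  by (simp add: poly_map_def)

lemma poly_map_pCons: "lin h \<Longrightarrow> poly_map h (pCons a p) w = scl a w + h (poly_map h p w)"
  by (cases "p = 0 \<and> a = 0") (auto simp: poly_map_def lin_0)

lemma poly_map_add: "lin h \<Longrightarrow> poly_map h (p + q) w = poly_map h p w + poly_map h q w"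
  by (induction p q rule: poly_induct2)
    (simp_all add: poly_map_pCons lin_add scale_left_distrib algebra_simps)

lemma poly_map_smult: "lin h \<Longrightarrow> poly_map h (smult c p) w = scl c (poly_map h p w)"
  by (induction p) (simp_all add: poly_map_pCons lin_scale scale_right_distrib)

lemma lin_poly_map: "lin h \<Longrightarrow> lin (poly_map h p)"
proof (induction p)
  case 0
  then show ?case by (auto intro: linI)
next
  case (pCons a p)
  have "poly_map h (pCons a p) = (\<lambda>w. scl a w + h (poly_map h p w))"
    using poly_map_pCons[OF pCons.prems] by blast
  moreover have "lin (\<lambda>w. scl a w)"
    by (rule linI) (simp_all add: scale_right_distrib mult.commute)
  ultimately show ?case
    using lin_plus[OF _ lin_comp[OF pCons.prems pCons.IH[OF pCons.prems]]] by simp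
qed

lemma poly_map_commute: "lin h \<Longrightarrow> h (poly_map h p w) = poly_map h p (h w)"
  by (induction p) (simp_all add: poly_map_pCons lin_0 lin_add lin_scale)

lemma poly_map_linear_factor:
  assumes h: "lin h" shows "poly_map h ([:- a, 1:] * q) w = poly_map h q (h w + scl a w)"
proof -
  have "[:- a, 1:] * q = smult a q + pCons 0 q"
    by simp
  then have "poly_map h ([:- a, 1:] * q) w = scl a (poly_map h q w) + h (poly_map h q w)"
    using h by (simp only: poly_map_add poly_map_smult poly_map_pCons scale_zero_left add_0_left)
  also have "\<dots> = poly_map h q (h w + scl a w)"
    using lin_poly_map[OF h, of q] h by (simp add: poly_map_commute lin_add lin_scale add.commute)
  finally show ?thesis .
qed

text \<open>
  Among the iterates of \<open>h\<close> on \<open>w\<close>, some one lies in the span of its predecessors.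
\<close>
lemma annihilating_poly:
  assumes h: "lin h"
  obtains p where "p \<noteq> 0" "poly_map h p w = 0"
proof -
  let ?K = "\<lambda>i. (\<lambda>j. (h ^^ j) w) ` {..<i}"
  have "\<exists>i. (h ^^ i) w \<in> span (?K i)"
  proof (rule ccontr)
    assume neg: "\<nexists>i. (h ^^ i) w \<in> span (?K i)"
    have "dim (?K i) = i" for i
    proof (induction i)
      case (Suc i)
      then show ?case
        using neg by (simp add: lessThan_Suc dim_insert)
    qed simp
    then show False
      using dim_subset_UNIV[of "?K (Suc (card Basis))"] by (simp add: dimension_def)
  qed
  then obtain i where i: "(h ^^ i) w \<in> span (?K i)" by blast
  have monom: "poly_map h (monom 1 j) w = (h ^^ j) w" for j
    by (induction j) (simp_all add: monom_0 monom_Suc poly_map_pCons[OF h] lin_0[OF h] del: monom_eq_1_iff)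
  let ?S = "{x. \<exists>p. coeff p i = 0 \<and> x = poly_map h p w}"
  have "subspace ?S"
  proof (rule subspaceI)
    show "0 \<in> ?S" by (auto intro!: exI[of _ 0])
    show "x + y \<in> ?S" if xy: "x \<in> ?S" "y \<in> ?S" for x y
    proof -
      obtain p q where "coeff p i = 0" "x = poly_map h p w" "coeff q i = 0" "y = poly_map h q w"
        using xy by blast
      then show ?thesis by (auto intro!: exI[of _ "p + q"] simp: poly_map_add[OF h])
    qed
    show "scl c x \<in> ?S" if x: "x \<in> ?S" for c x
    proof -
      obtain p where "coeff p i = 0" "x = poly_map h p w"
        using x by blast
      then show ?thesis by (auto intro!: exI[of _ "smult c p"] simp: poly_map_smult[OF h])
    qed
  qed
  moreover have "?K i \<subseteq> ?S"
    using monom by (auto intro!: exI[of _ "monom 1 _"])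
  ultimately have "(h ^^ i) w \<in> ?S"
    using i span_minimal by blast
  then obtain p where p: "coeff p i = 0" "(h ^^ i) w = poly_map h p w" by blast
  have "poly_map h (monom 1 i + p) w = 0"
    using p(2) by (simp add: poly_map_add[OF h] monom)
  moreover have "monom 1 i + p \<noteq> 0"
  proof
    assume "monom 1 i + p = 0"
    then have "coeff (monom 1 i + p) i = 0" by simp
    then show False using p(1) by simp
  qed
  ultimately show ?thesis using that by blast
qed

text \<open>
  Split off linear factors from an annihilating polynomial of \<open>w\<close> until the image of \<open>w\<close> falls into
  \<open>U\<close>. Eigenvectors modulo \<open>U\<close> take the place of eigenvectors on a quotient space.
\<close>
lemma eigenvector_mod:
  assumes h: "lin h" and U: "subspace U" and W: "subspace W" and stable: "\<And>w. w \<in> W \<Longrightarrow> h w \<in> W"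
    and w: "w \<in> W" "w \<notin> U"
  obtains e a where "e \<in> W" "e \<notin> U" "h e + scl a e \<in> U"
proof -
  have "\<exists>e a. e \<in> W \<and> e \<notin> U \<and> h e + scl a e \<in> U" if "p \<noteq> 0" "poly_map h p w \<in> U" "w \<in> W" "w \<notin> U" for p w
    using that
  proof (induction "degree p" arbitrary: p w rule: less_induct)
    case less
    show ?case
    proof (cases "degree p = 0")
      case True
      then obtain c where c: "p = [:c:]"
        by (rule degree_eq_zeroE)
      then have cw: "scl c w \<in> U"
        using less.prems(2) by (simp add: poly_map_pCons[OF h] lin_0[OF h])
      have "c \<noteq> 0"
        using c less.prems(1) by simp
      then have "w \<in> U"
        using subspace_scale[OF U cw, of "inverse c"] by simp
      then show ?thesis
        using less.prems by simp
    next
      case False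
      then obtain a where "poly p a = 0"
        using alg_closed_imp_poly_has_root[of p] by auto
      then obtain q where q: "p = [:- a, 1:] * q"
        by (metis poly_eq_0_iff_dvd dvdE)
      have q0: "q \<noteq> 0" using q less.prems(1) by auto
      have deg: "degree p = Suc (degree q)"
        unfolding q using q0 by (subst degree_mult_eq) auto
      let ?w = "h w + scl a w"
      show ?thesis
      proof (cases "?w \<in> U")
        case True
        then show ?thesis using less.prems by blast
      next
        case False
        moreover have "poly_map h q ?w \<in> U"
          using less.prems(2) unfolding q poly_map_linear_factor[OF h] .
        moreover have "?w \<in> W"
          using stable less.prems(3) subspace_add[OF W] subspace_scale[OF W] by blast
        ultimately show ?thesis
          using less.hyps[of q ?w] deg q0 by auto
      qed
    qed
  qed
  moreover obtain p where "p \<noteq> 0" "poly_map h p w = 0"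
    using annihilating_poly[OF h] by blast
  ultimately show ?thesis
    using w that subspace_0[OF U] by metis
qed

text \<open>
  For a finite set \<open>F\<close> of eigenvalues let \<open>f\<close> be the product of the operators \<open>h + c\<close> with \<open>c\<close> in
  \<open>F\<close>. The subspaces of vectors mapped into \<open>U\<close> by \<open>f\<close> grow strictly with \<open>F\<close>, so \<open>F\<close>
  has at most as many elements as the dimension.
\<close>
lemma finite_eigenvalues_mod:
  assumes h: "lin h" and U: "subspace U" and stable: "\<And>u. u \<in> U \<Longrightarrow> h u \<in> U"
  shows "finite {c. \<exists>w. w \<notin> U \<and> h w + scl c w \<in> U}" (is "finite ?E")
proof (rule ccontr)
  assume "infinite ?E"
  then obtain F where F: "finite F" "card F = Suc (dim UNIV)" "F \<subseteq> ?E"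
    by (meson infinite_arbitrarily_large)
  have "\<exists>f. lin f \<and> (\<forall>u\<in>U. f u \<in> U) \<and> card F \<le> dim {w. f w \<in> U} \<and>
      (\<forall>d w. h w + scl d w \<in> U \<longrightarrow> f w + scl (\<Prod>c\<in>F. d + c) w \<in> U)"
    using F(1,3)
  proof (induction F rule: finite_induct)
    case empty
    then show ?case
      using subspace_0[OF U] by (intro exI[of _ "\<lambda>x. x"]) auto
  next
    case (insert c F)
    then obtain f where f: "lin f" "\<And>u. u \<in> U \<Longrightarrow> f u \<in> U" "card F \<le> dim {w. f w \<in> U}"
      and eig: "\<And>d w. h w + scl d w \<in> U \<Longrightarrow> f w + scl (\<Prod>c\<in>F. d + c) w \<in> U" by blast
    let ?f = "\<lambda>w. h (f w) + scl c (f w)"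
    have lin: "lin ?f"
    proof (rule lin_plus[OF lin_comp[OF h f(1)]])
      show "lin (\<lambda>w. scl c (f w))"
        by (rule linI) (simp_all add: lin_add[OF f(1)] lin_scale[OF f(1)] scale_right_distrib mult.commute)
    qed
    have fU: "?f u \<in> U" if "f u \<in> U" for u
      using that stable subspace_add[OF U] subspace_scale[OF U] by blast
    have eig': "?f w + scl (\<Prod>c\<in>insert c F. d + c) w \<in> U" if w: "h w + scl d w \<in> U" for d w
    proof -
      let ?P = "\<Prod>c\<in>F. d + c"
      have 1: "f w + scl ?P w \<in> U"
        by (rule eig[OF w])
      have "h (f w + scl ?P w) + scl c (f w + scl ?P w) + scl ?P (h w + scl d w) \<in> U"
        using stable[OF 1] 1 w subspace_add[OF U] subspace_scale[OF U] by blast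
      also have "h (f w + scl ?P w) + scl c (f w + scl ?P w) + scl ?P (h w + scl d w)
          = ?f w + scl ((d + c) * ?P) w"
        using h by (simp add: lin_add lin_scale scale_right_distrib scale_left_distrib algebra_simps)
      finally show ?thesis
        using insert.hyps by simp
    qed
    obtain w where w: "w \<notin> U" "h w + scl c w \<in> U"
      using insert.prems by blast
    have "?f w \<in> U"
      using eig'[OF w(2)] insert.hyps by simp
    moreover have "f w \<notin> U"
    proof
      assume "f w \<in> U"
      then have "f w + (f w + scl (\<Prod>c'\<in>F. c + c') w) \<in> U"
        using eig[OF w(2)] subspace_add[OF U] by blast
      then have mem: "scl (\<Prod>c'\<in>F. c + c') w \<in> U"
        by simp
      have "(\<Prod>c'\<in>F. c + c') \<noteq> 0"
        using insert.hyps by auto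
      then show False
        using subspace_scale[OF U mem, of "inverse (\<Prod>c'\<in>F. c + c')"] w(1) by simp
    qed
    ultimately have "{w. f w \<in> U} \<subset> {w. ?f w \<in> U}"
      using fU by blast
    moreover have sub: "subspace {w. g w \<in> U}" if "lin g" for g
      using that U by (auto simp: subspace_def lin_add lin_scale lin_0)
    ultimately have "dim {w. f w \<in> U} < dim {w. ?f w \<in> U}"
      using dim_psubset sub[OF f(1)] sub[OF lin] by (metis span_eq_iff)
    then have "card (insert c F) \<le> dim {w. ?f w \<in> U}"
      using f(3) insert.hyps by simp
    moreover have "\<forall>u\<in>U. ?f u \<in> U"
      using f(2) fU by blast
    ultimately show ?case
      using lin eig' by (intro exI[of _ ?f]) blast
  qed
  then show False
    using F(2) dim_subset_UNIV by (metis Suc_n_not_le_n dim_UNIV dimension_def le_trans)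
qed

end

section \<open>Common eigenvectors of connected solvable groups\<close>

context symplectic_char2
begin

interpretation Sp: group SpV
  by (rule group_Sp)

lemma Sp_inv_inv: "x \<in> carrier SpV \<Longrightarrow> inv\<^bsub>SpV\<^esub> (inv_into UNIV x) = x"
  using Sp.inv_inv[of x] by (simp add: Sp_inv_eq)

definition stable :: "('v \<Rightarrow> 'v) set \<Rightarrow> 'v set \<Rightarrow> bool" where
  "stable H U \<longleftrightarrow> (\<forall>h\<in>H. \<forall>u\<in>U. h u \<in> U)"

lemma stableD: "stable H U \<Longrightarrow> h \<in> H \<Longrightarrow> u \<in> U \<Longrightarrow> h u \<in> U"
  by (simp add: stable_def)

lemma rigid_constant:
  assumes rigid: "rigid H" and HS: "H \<subseteq> carrier SpV" and y: "lin y" and fin: "finite S"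
    and vals: "\<And>x. x \<in> H \<Longrightarrow> \<beta> u (inv_into UNIV x (y (x z))) \<in> S" and g: "g \<in> H" "h \<in> H"
  shows "\<beta> u (inv_into UNIV g (y (g z))) = \<beta> u (inv_into UNIV h (y (h z)))"
proof -
  have eq: "\<beta> (x u) (y (x z)) = \<beta> u (inv_into UNIV x (y (x z)))" if "x \<in> H" for x
  proof -
    have x: "x \<in> carrier SpV" using that HS by blast
    show ?thesis
      using Sp_isometry[OF x, of u "inv_into UNIV x (y (x z))"] x by simp
  qed
  have "(\<lambda>x. \<beta> (x u) (y (x z))) ` H \<subseteq> S"
    using eq vals by auto
  then have "finite ((\<lambda>x. \<beta> (x u) (y (x z))) ` H)"
    by (rule finite_subset[OF _ fin])
  with rigid[unfolded rigid_def, rule_format, OF polyfun_beta[OF y, of u z] _ g]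
  have "\<beta> (g u) (y (g z)) = \<beta> (h u) (y (h z))" .
  then show ?thesis
    unfolding eq[OF g(1)] eq[OF g(2)] .
qed

text \<open>
  The theorem of Lie and Kolchin, for subquotients \<open>W / U\<close>. After shrinking \<open>W\<close> to \<open>W0\<close> one may assume
  that \<open>W0 / U\<close> is irreducible. By induction the derived group \<open>D\<close> has a weight \<open>\<chi>\<close> on \<open>W0 / U\<close>. The value
  \<open>\<chi>(x\<^sup>-\<^sup>1 h x)\<close> is an eigenvalue of \<open>h\<close> and polynomial in \<open>x\<close>, so it is constant; thus the weight
  space is stable and \<open>D\<close> acts by scalars. The same argument for the commutator of \<open>x\<close> and \<open>g\<close>, whose scalar is a
  quotient of eigenvalues of \<open>g\<close>, shows that the scalars are \<open>1\<close>, so \<open>H\<close> acts on \<open>W0 / U\<close> through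
  commuting operators. Then eigenspaces of each single element are stable, and \<open>H\<close> acts by scalars.
\<close>
theorem common_eigenvector:
  assumes "subgroup H SpV" "rigid H" "(derived SpV ^^ n) H = {id}"
    and "subspace U" "subspace W" "U \<subseteq> W" "U \<noteq> W" "stable H U" "stable H W"
  shows "\<exists>w\<in>W. w \<notin> U \<and> (\<forall>h\<in>H. \<exists>c. h w + scl c w \<in> U)"
  using assms
proof (induction n arbitrary: H W)
  case 0
  then obtain w where "w \<in> W" "w \<notin> U" by blast
  moreover have "\<exists>c. h w + scl c w \<in> U" if "h \<in> H" for h
    using 0(3) that subspace_0[OF 0(4)] by (intro exI[of _ 1]) (simp add: id_def)
  ultimately show ?case by blast
next
  case (Suc n)
  note H = Suc.prems(1) and rigid = Suc.prems(2) and U = Suc.prems(4) and UH = Suc.prems(8)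
  note HS = subgroup.subset[OF H]
  define D where "D = derived SpV H"
  have D: "subgroup D SpV"
    unfolding D_def by (rule Sp.derived_is_subgroup[OF HS])
  note DS = subgroup.subset[OF D]
  have DH: "D \<subseteq> H"
    unfolding D_def by (rule Sp.derived_incl[OF subset_refl H])
  have inv: "inv_into UNIV x \<in> H" if "x \<in> H" for x
    using subgroup.m_inv_closed[OF H that] Sp_inv_eq[of x] that HS by auto
  have one: "id \<in> H"
    using subgroup.one_closed[OF H] by simp
  have lin: "lin x" if "x \<in> H" for x
    using that HS Sp_lin by blast
  have xinv: "x (inv_into UNIV x v) = v" "inv_into UNIV x (x v) = v" if "x \<in> H" for x v
    using that HS by auto
  define good where "good W' \<longleftrightarrow> subspace W' \<and> U \<subseteq> W' \<and> U \<noteq> W' \<and> stable H W' \<and> W' \<subseteq> W" for W'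
  have "good W"
    using Suc.prems by (simp add: good_def)
  then obtain W0 where W0: "good W0" and least: "\<And>W'. good W' \<Longrightarrow> dim W0 \<le> dim W'"
    using ex_has_least_nat[of good W dim] by blast
  have W0s: "subspace W0" and UW0: "U \<subseteq> W0" and W0H: "stable H W0" and W0ne: "U \<noteq> W0"
    using W0 by (auto simp: good_def)
  have minimal: "W' = W0" if "subspace W'" "U \<subseteq> W'" "stable H W'" "W' \<subseteq> W0" "w \<in> W'" "w \<notin> U" for W' w
  proof -
    have "good W'"
      using that W0 by (auto simp: good_def)
    then show ?thesis
      using least subspace_dim_equal[OF that(1) W0s that(4)] by blast
  qed
  have "stable D U" "stable D W0"
    using UH W0H DH by (auto simp: stable_def)
  moreover have "(derived SpV ^^ n) D = {id}"
    using Suc.prems(3) by (simp add: D_def funpow_swap1 id_def)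
  ultimately obtain w0 where w0: "w0 \<in> W0" "w0 \<notin> U" "\<And>h. h \<in> D \<Longrightarrow> \<exists>c. h w0 + scl c w0 \<in> U"
    using Suc.IH[OF D _ _ U W0s UW0 W0ne] rigid_derived[OF H rigid] unfolding D_def by blast
  obtain u0 where u0: "\<And>x. x \<in> U \<Longrightarrow> \<beta> u0 x = 0" "\<beta> u0 w0 = 1"
    using separating_vector[OF U w0(2)] by blast
  (* The weight is read off by a functional that vanishes on U and is 1 at w0, which shows that
     it is a polynomial function. *)
  define \<chi> where "\<chi> h = \<beta> u0 (h w0)" for h
  have \<chi>: "h w0 + scl (\<chi> h) w0 \<in> U" if h: "h \<in> D" for h
  proof -
    obtain c where c: "h w0 + scl c w0 \<in> U"
      using w0(3)[OF h] by blast
    have "\<chi> h = c"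
      using u0(1)[OF c] u0(2) by (simp add: \<chi>_def)
    then show ?thesis using c by simp
  qed
  define E where "E g = {c. \<exists>w. w \<notin> U \<and> g w + scl c w \<in> U}" for g
  have finE: "finite (E g)" if "g \<in> H" for g
    unfolding E_def by (rule finite_eigenvalues_mod[OF lin[OF that] U]) (rule stableD[OF UH that])
  have notU: "x w \<notin> U" if "x \<in> H" "w \<notin> U" for x w
    using stableD[OF UH inv[OF that(1)], of "x w"] xinv(2)[OF that(1)] that(2) by auto
  have conjD: "inv_into UNIV x \<circ> h \<circ> x \<in> D" if x: "x \<in> H" and h: "h \<in> D" for x h
  proof -
    have hH: "h \<in> H" using h DH by blast
    have xS: "x \<in> carrier SpV" and hS: "h \<in> carrier SpV"
      using x h HS DS by auto
    have "inv_into UNIV x \<circ> h \<circ> x \<circ> inv_into UNIV h \<in> D"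
    proof -
      have "inv_into UNIV x \<circ> h \<circ> x \<circ> inv_into UNIV h
          = inv_into UNIV x \<otimes>\<^bsub>SpV\<^esub> h \<otimes>\<^bsub>SpV\<^esub> inv\<^bsub>SpV\<^esub> (inv_into UNIV x) \<otimes>\<^bsub>SpV\<^esub> inv\<^bsub>SpV\<^esub> h"
        by (simp add: Sp_inv_inv[OF xS] Sp_inv_eq[OF hS])
      then show ?thesis
        unfolding D_def derived_def using inv[OF x] hH by (blast intro: generate.incl)
    qed
    then have "inv_into UNIV x \<circ> h \<circ> x \<circ> inv_into UNIV h \<circ> h \<in> D"
      using subgroup.m_closed[OF D _ h] by simp
    moreover have "inv_into UNIV x \<circ> h \<circ> x \<circ> inv_into UNIV h \<circ> h = inv_into UNIV x \<circ> h \<circ> x"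
      using xinv(2)[OF hH] by (simp add: fun_eq_iff)
    ultimately show ?thesis by simp
  qed
  have \<chi>_conj: "\<chi> (inv_into UNIV x \<circ> h \<circ> x) = \<chi> h" if x: "x \<in> H" and h: "h \<in> D" for x h
  proof -
    have hH: "h \<in> H" using h DH by blast
    have "\<beta> u0 (inv_into UNIV z (h (z w0))) \<in> E h" if z: "z \<in> H" for z
    proof -
      let ?k = "inv_into UNIV z \<circ> h \<circ> z"
      have "z (?k w0 + scl (\<chi> ?k) w0) \<in> U"
        by (rule stableD[OF UH z \<chi>[OF conjD[OF z h]]])
      then have "h (z w0) + scl (\<chi> ?k) (z w0) \<in> U"
        using z by (simp add: lin_add[OF lin[OF z]] lin_scale[OF lin[OF z]] xinv(1))
      then show ?thesis
        using notU[OF z w0(2)] by (auto simp: E_def \<chi>_def)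
    qed
    then have "\<beta> u0 (inv_into UNIV x (h (x w0))) = \<beta> u0 (inv_into UNIV id (h (id w0)))"
      by (rule rigid_constant[OF rigid HS lin[OF hH] finE[OF hH] _ x one])
    then show ?thesis
      by (simp add: \<chi>_def)
  qed
  define W1 where "W1 = {w \<in> W0. \<forall>h\<in>D. h w + scl (\<chi> h) w \<in> U}"
  have "W1 = W0"
  proof (rule minimal)
    show "subspace W1"
    proof (rule subspaceI)
      show "0 \<in> W1"
      proof -
        have "h 0 + scl (\<chi> h) 0 \<in> U" if h: "h \<in> D" for h
        proof -
          have "h 0 = 0"
            using lin_0[OF lin] h DH by blast
          then show ?thesis
            using subspace_0[OF U] by simp
        qed
        then show ?thesis
          using subspace_0[OF W0s] unfolding W1_def by blast
      qed
      show "x + y \<in> W1" if xy: "x \<in> W1" "y \<in> W1" for x y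
      proof -
        have "h (x + y) + scl (\<chi> h) (x + y) \<in> U" if h: "h \<in> D" for h
        proof -
          have "(h x + scl (\<chi> h) x) + (h y + scl (\<chi> h) y) \<in> U"
            by (rule subspace_add[OF U]) (use xy h in \<open>auto simp: W1_def\<close>)
          moreover have "h (x + y) = h x + h y"
            using lin_add[OF lin] h DH by blast
          ultimately show ?thesis
            by (simp add: scale_right_distrib algebra_simps)
        qed
        then show ?thesis
          using xy by (auto simp: W1_def intro: subspace_add[OF W0s])
      qed
      show "scl c x \<in> W1" if x: "x \<in> W1" for c x
      proof -
        have "h (scl c x) + scl (\<chi> h) (scl c x) \<in> U" if h: "h \<in> D" for h
        proof -
          have "scl c (h x + scl (\<chi> h) x) \<in> U"
            by (rule subspace_scale[OF U]) (use x h in \<open>auto simp: W1_def\<close>)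
          moreover have "h (scl c x) = scl c (h x)"
            using lin_scale[OF lin] h DH by blast
          ultimately show ?thesis
            by (simp add: scale_right_distrib mult.commute)
        qed
        then show ?thesis
          using x by (auto simp: W1_def intro: subspace_scale[OF W0s])
      qed
    qed
    show "U \<subseteq> W1"
    proof
      fix u assume u: "u \<in> U"
      have "h u + scl (\<chi> h) u \<in> U" if "h \<in> D" for h
        using that DH stableD[OF UH _ u] subspace_add[OF U] subspace_scale[OF U u] by blast
      then show "u \<in> W1"
        using u UW0 by (auto simp: W1_def)
    qed
    show "stable H W1"
      unfolding stable_def
    proof (intro ballI)
      fix x w assume x: "x \<in> H" and w: "w \<in> W1"
      have "h (x w) + scl (\<chi> h) (x w) \<in> U" if h: "h \<in> D" for h
      proof -
        have "x ((inv_into UNIV x \<circ> h \<circ> x) w + scl (\<chi> (inv_into UNIV x \<circ> h \<circ> x)) w) \<in> U"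
          using stableD[OF UH x] w conjD[OF x h] unfolding W1_def by blast
        then show ?thesis
          unfolding \<chi>_conj[OF x h] using x
          by (simp add: lin_add[OF lin[OF x]] lin_scale[OF lin[OF x]] xinv(1))
      qed
      then show "x w \<in> W1"
        using w stableD[OF W0H x] by (auto simp: W1_def)
    qed
    show "w0 \<in> W1"
      using w0(1) \<chi> by (auto simp: W1_def)
  qed (use w0(2) in \<open>auto simp: W1_def\<close>)
  then have scalar: "h w + scl (\<chi> h) w \<in> U" if "w \<in> W0" "h \<in> D" for h w
    using that by (auto simp: W1_def)
  have commute: "g (x w) + x (g w) \<in> U" if g: "g \<in> H" and x: "x \<in> H" and w: "w \<in> W0" for g x w
  proof -
    obtain e a where e: "e \<in> W0" "e \<notin> U" "g e + scl a e \<in> U"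
      using eigenvector_mod[OF lin[OF g] U W0s _ w0(1,2)] stableD[OF W0H g] by blast
    have ge: "g e \<notin> U"
      by (rule notU[OF g e(2)])
    have a: "a \<noteq> 0"
      using e(3) ge by auto
    let ?k = "\<lambda>z. inv_into UNIV z \<circ> g \<circ> z \<circ> inv_into UNIV g"
    have kD: "?k z \<in> D" if z: "z \<in> H" for z
    proof -
      have zS: "z \<in> carrier SpV" and gS: "g \<in> carrier SpV"
        using z g HS by auto
      have "?k z = inv_into UNIV z \<otimes>\<^bsub>SpV\<^esub> g \<otimes>\<^bsub>SpV\<^esub> inv\<^bsub>SpV\<^esub> (inv_into UNIV z) \<otimes>\<^bsub>SpV\<^esub> inv\<^bsub>SpV\<^esub> g"
        by (simp add: Sp_inv_inv[OF zS] Sp_inv_eq[OF gS])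
      then show ?thesis
        unfolding D_def derived_def using inv[OF z] g by (blast intro: generate.incl)
    qed
    have val: "\<beta> u0 (inv_into UNIV z (g (z (inv_into UNIV g w0)))) \<in> (\<lambda>c. c / a) ` E g" if z: "z \<in> H" for z
    proof -
      have "?k z (g e) + scl (\<chi> (?k z)) (g e) \<in> U"
        by (rule scalar[OF stableD[OF W0H g e(1)] kD[OF z]])
      moreover have "scl (\<chi> (?k z)) (g e + scl a e) \<in> U"
        by (rule subspace_scale[OF U e(3)])
      ultimately have "(?k z (g e) + scl (\<chi> (?k z)) (g e)) + scl (\<chi> (?k z)) (g e + scl a e) \<in> U"
        by (rule subspace_add[OF U])
      then have "inv_into UNIV z (g (z e)) + scl (\<chi> (?k z) * a) e \<in> U"
        using xinv(2)[OF g] by (simp add: scale_right_distrib add.assoc)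
      then have "z (inv_into UNIV z (g (z e)) + scl (\<chi> (?k z) * a) e) \<in> U"
        by (rule stableD[OF UH z])
      then have "g (z e) + scl (\<chi> (?k z) * a) (z e) \<in> U"
        using z by (simp add: lin_add[OF lin[OF z]] lin_scale[OF lin[OF z]] xinv(1))
      then have "\<chi> (?k z) * a \<in> E g"
        using notU[OF z e(2)] by (auto simp: E_def)
      then have "\<chi> (?k z) \<in> (\<lambda>c. c / a) ` E g"
        using a by (intro image_eqI[of _ _ "\<chi> (?k z) * a"]) auto
      then show ?thesis
        by (simp add: \<chi>_def)
    qed
    have "\<beta> u0 (inv_into UNIV x (g (x (inv_into UNIV g w0)))) = \<beta> u0 (inv_into UNIV id (g (id (inv_into UNIV g w0))))"
      by (rule rigid_constant[OF rigid HS lin[OF g] finite_imageI[OF finE[OF g]] val x one])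
    then have "\<chi> (?k x) = 1"
      using u0(2) xinv(1)[OF g] by (simp add: \<chi>_def)
    then have "?k x (g w) + scl 1 (g w) \<in> U"
      using scalar[OF stableD[OF W0H g w] kD[OF x]] by simp
    then have "inv_into UNIV x (g (x w)) + g w \<in> U"
      using xinv(2)[OF g] by simp
    then have "x (inv_into UNIV x (g (x w)) + g w) \<in> U"
      by (rule stableD[OF UH x])
    then show ?thesis
      using x by (simp add: lin_add[OF lin[OF x]] xinv(1))
  qed
  have "\<exists>c. g w0 + scl c w0 \<in> U" if g: "g \<in> H" for g
  proof -
    obtain e a where e: "e \<in> W0" "e \<notin> U" "g e + scl a e \<in> U"
      using eigenvector_mod[OF lin[OF g] U W0s _ w0(1,2)] stableD[OF W0H g] by blast
    define W2 where "W2 = {w \<in> W0. g w + scl a w \<in> U}"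
    have "W2 = W0"
    proof (rule minimal)
      show "subspace W2"
      proof (rule subspaceI)
        show "0 \<in> W2"
          using subspace_0[OF W0s] subspace_0[OF U] lin_0[OF lin[OF g]] by (auto simp: W2_def)
        show "x + y \<in> W2" if xy: "x \<in> W2" "y \<in> W2" for x y
        proof -
          have "(g x + scl a x) + (g y + scl a y) \<in> U"
            by (rule subspace_add[OF U]) (use xy in \<open>auto simp: W2_def\<close>)
          then have "g (x + y) + scl a (x + y) \<in> U"
            by (simp add: lin_add[OF lin[OF g]] scale_right_distrib algebra_simps)
          then show ?thesis
            using xy by (auto simp: W2_def intro: subspace_add[OF W0s])
        qed
        show "scl c x \<in> W2" if x: "x \<in> W2" for c x
        proof -
          have "scl c (g x + scl a x) \<in> U"
            by (rule subspace_scale[OF U]) (use x in \<open>auto simp: W2_def\<close>)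
          then have "g (scl c x) + scl a (scl c x) \<in> U"
            by (simp add: lin_scale[OF lin[OF g]] scale_right_distrib mult.commute)
          then show ?thesis
            using x by (auto simp: W2_def intro: subspace_scale[OF W0s])
        qed
      qed
      show "U \<subseteq> W2"
      proof
        fix u assume u: "u \<in> U"
        have "g u + scl a u \<in> U"
          using stableD[OF UH g u] subspace_add[OF U] subspace_scale[OF U u] by blast
        then show "u \<in> W2"
          using u UW0 by (auto simp: W2_def)
      qed
      show "stable H W2"
        unfolding stable_def
      proof (intro ballI)
        fix x w assume x: "x \<in> H" and w: "w \<in> W2"
        then have w': "w \<in> W0" "g w + scl a w \<in> U"
          by (auto simp: W2_def)
        have "(g (x w) + x (g w)) + x (g w + scl a w) \<in> U"
          using commute[OF g x w'(1)] stableD[OF UH x w'(2)] subspace_add[OF U] by blast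
        then have "g (x w) + scl a (x w) \<in> U"
          by (simp add: lin_add[OF lin[OF x]] lin_scale[OF lin[OF x]] add.assoc)
        then show "x w \<in> W2"
          using w' stableD[OF W0H x] by (auto simp: W2_def)
      qed
      show "e \<in> W2"
        using e by (auto simp: W2_def)
    qed (use e(2) in \<open>auto simp: W2_def\<close>)
    then show ?thesis
      using w0(1) by (auto simp: W2_def)
  qed
  moreover have "w0 \<in> W"
    using w0(1) W0 by (auto simp: good_def)
  ultimately show ?case
    using w0(2) by blast
qed

end

section \<open>Stabilisers of Lagrangian flags\<close>

context symplectic_char2
begin

interpretation Sp: group SpV
  by (rule group_Sp)

text \<open>
  A flag is given by a list of vectors; its members are the spans of the initial segments. Indices beyond the
  length of the list give the span of the whole list.
\<close>
definition prefix_span :: "'v list \<Rightarrow> nat \<Rightarrow> 'v set" where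
  "prefix_span es i = span (set (take i es))"

definition flag_stabiliser :: "'v list \<Rightarrow> ('v \<Rightarrow> 'v) set" where
  "flag_stabiliser es = {g \<in> carrier SpV. \<forall>i<length es. g (es ! i) \<in> prefix_span es (Suc i)}"

definition isotropic :: "'v list \<Rightarrow> bool" where
  "isotropic es \<longleftrightarrow> (\<forall>x\<in>set es. \<forall>y\<in>set es. \<beta> x y = 0)"

lemma subspace_prefix_span: "subspace (prefix_span es i)"
  by (simp add: prefix_span_def)

lemma prefix_span_mono: "i \<le> j \<Longrightarrow> prefix_span es i \<subseteq> prefix_span es j"
  unfolding prefix_span_def by (intro span_mono set_take_subset_set_take)

lemma prefix_span_mem: "j < i \<Longrightarrow> j < length es \<Longrightarrow> es ! j \<in> prefix_span es i"
  unfolding prefix_span_def by (rule span_base) (auto simp: in_set_conv_nth intro!: exI[of _ j])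

lemma prefix_span_subsetI:
  assumes "subspace S" "\<And>j. j < i \<Longrightarrow> j < length es \<Longrightarrow> es ! j \<in> S"
  shows "prefix_span es i \<subseteq> S"
  unfolding prefix_span_def using assms by (intro span_minimal) (auto simp: in_set_conv_nth)

lemma prefix_span_induct_lin:
  assumes f: "lin f" and S: "subspace S" and base: "\<And>j. j < i \<Longrightarrow> j < length es \<Longrightarrow> f (es ! j) \<in> S"
    and v: "v \<in> prefix_span es i"
  shows "f v \<in> S"
proof -
  have "subspace {v. f v \<in> S}"
    using f S by (auto simp: subspace_def lin_add lin_scale lin_0)
  then have "prefix_span es i \<subseteq> {v. f v \<in> S}"
    using base by (intro prefix_span_subsetI) auto
  then show ?thesis using v by blast
qed

lemma isotropic_span: "isotropic es \<Longrightarrow> x \<in> span (set es) \<Longrightarrow> y \<in> span (set es) \<Longrightarrow> \<beta> x y = 0"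
proof -
  assume iso: "isotropic es" and x: "x \<in> span (set es)" and y: "y \<in> span (set es)"
  have "span (set es) \<subseteq> {y. \<beta> e y = 0}" if "e \<in> set es" for e
    using iso that by (intro span_minimal) (auto simp: isotropic_def subspace_def)
  then have "span (set es) \<subseteq> {x. \<beta> x y = 0}"
    using y by (intro span_minimal) (auto simp: subspace_def)
  then show "\<beta> x y = 0" using x by blast
qed

lemma dim_independent_list:
  assumes "\<And>i. i < length es \<Longrightarrow> es ! i \<notin> prefix_span es i"
  shows "i \<le> length es \<Longrightarrow> dim (set (take i es)) = i"
proof (induction i)
  case (Suc i)
  then show ?case
    using assms[of i] by (simp add: take_Suc_conv_app_nth dim_insert prefix_span_def)
qed simp

lemma stable_span: "(\<And>h. h \<in> H \<Longrightarrow> lin h) \<Longrightarrow> (\<And>h i. h \<in> H \<Longrightarrow> i < length es \<Longrightarrow> h (es ! i) \<in> span (set es))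
   \<Longrightarrow> stable H (span (set es))"
  unfolding stable_def
proof (intro ballI)
  fix h u assume lin: "\<And>h. h \<in> H \<Longrightarrow> lin h" and H: "\<And>h i. h \<in> H \<Longrightarrow> i < length es \<Longrightarrow> h (es ! i) \<in> span (set es)"
    and h: "h \<in> H" and u: "u \<in> span (set es)"
  show "h u \<in> span (set es)"
    by (rule prefix_span_induct_lin[OF lin[OF h] subspace_span, of "length es" es]) (use H[OF h] u in \<open>auto simp: prefix_span_def\<close>)
qed

text \<open>
  A stable isotropic flag of maximal length is Lagrangian: otherwise a common eigenvector in
  \<open>U\<^sup>\<bottom> / U\<close>, for \<open>U\<close> the last member of the flag, would prolong it.
\<close>
theorem Lagrangian_flag_exists:
  assumes H: "subgroup H SpV" and rigid: "rigid H" and solv: "(derived SpV ^^ n) H = {id}"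
  obtains es where "isotropic es" "H \<subseteq> flag_stabiliser es" "perp (span (set es)) \<subseteq> span (set es)"
proof -
  note HS = subgroup.subset[OF H]
  define good where "good es \<longleftrightarrow> isotropic es \<and> H \<subseteq> flag_stabiliser es \<and>
    (\<forall>i<length es. es ! i \<notin> prefix_span es i)" for es
  have "good []"
    using HS by (auto simp: good_def isotropic_def flag_stabiliser_def)
  (* Independence of the vectors bounds the length of the list. *)
  moreover have "length es < Suc (dim UNIV)" if "good es" for es
  proof -
    have "dim (set (take (length es) es)) = length es"
      using that dim_independent_list[of es "length es"] by (simp add: good_def)
    then show ?thesis
      using dim_subset[of "set es" UNIV] by simp
  qed
  ultimately obtain es where es: "good es" and max: "\<And>es'. good es' \<Longrightarrow> length es' \<le> length es"
    using ex_has_greatest_nat[of good "[]" length "Suc (dim UNIV)"] by blast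
  have iso: "isotropic es" and stab: "H \<subseteq> flag_stabiliser es" and ind: "\<And>i. i < length es \<Longrightarrow> es ! i \<notin> prefix_span es i"
    using es by (auto simp: good_def)
  let ?U = "span (set es)"
  have "perp ?U \<subseteq> ?U"
  proof (rule ccontr)
    assume "\<not> perp ?U \<subseteq> ?U"
    then have ne: "?U \<noteq> perp ?U" by auto
    have sub: "?U \<subseteq> perp ?U"
      using isotropic_span[OF iso] by (auto simp: perp_def)
    have stU: "stable H ?U"
    proof (rule stable_span)
      show "lin h" if "h \<in> H" for h using that HS Sp_lin by blast
      show "h (es ! i) \<in> ?U" if "h \<in> H" "i < length es" for h i
        using that stab prefix_span_mono[of "Suc i" "length es" es] by (auto simp: flag_stabiliser_def prefix_span_def)
    qed
    have "stable H (perp ?U)"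
      unfolding stable_def
    proof (intro ballI)
      fix h w assume h: "h \<in> H" and w: "w \<in> perp ?U"
      have hS: "h \<in> carrier SpV" using h HS by blast
      have "\<beta> (h w) u = 0" if u: "u \<in> ?U" for u
      proof -
        have "inv_into UNIV h \<in> H"
          using subgroup.m_inv_closed[OF H h] Sp_inv_eq[OF hS] by simp
        then have "inv_into UNIV h u \<in> ?U"
          using stableD[OF stU] u by blast
        then have "\<beta> w (inv_into UNIV h u) = 0"
          using w by (simp add: perp_def)
        then show ?thesis
          using Sp_isometry[OF hS, of w "inv_into UNIV h u"] hS by simp
      qed
      then show "h w \<in> perp ?U" by (simp add: perp_def)
    qed
    then obtain w where w: "w \<in> perp ?U" "w \<notin> ?U" and eig: "\<And>h. h \<in> H \<Longrightarrow> \<exists>c. h w + scl c w \<in> ?U"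
      using common_eigenvector[OF H rigid solv subspace_span subspace_perp sub ne stU] by blast
    have "good (es @ [w])"
      unfolding good_def
    proof (intro conjI allI impI)
      have "\<beta> w x = 0" "\<beta> x w = 0" if "x \<in> set es" for x
        using w(1) span_base[OF that] beta_sym[of x w] by (auto simp: perp_def)
      then show "isotropic (es @ [w])"
        using iso by (auto simp: isotropic_def)
      show "H \<subseteq> flag_stabiliser (es @ [w])"
      proof
        fix h assume h: "h \<in> H"
        have "h ((es @ [w]) ! i) \<in> prefix_span (es @ [w]) (Suc i)" if i: "i < length (es @ [w])" for i
        proof (cases "i < length es")
          case True
          then show ?thesis
            using stab h by (auto simp: flag_stabiliser_def prefix_span_def nth_append)
        next
          case False
          then have i: "i = length es" using i by simp
          obtain c where "h w + scl c w \<in> ?U"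
            using eig[OF h] by blast
          then have "h w - scl c w \<in> span (set es)"
            by simp
          then have "h w \<in> span (insert w (set es))"
            using span_breakdown_eq by blast
          then show ?thesis
            by (simp add: i prefix_span_def)
        qed
        then show "h \<in> flag_stabiliser (es @ [w])"
          using h HS by (auto simp: flag_stabiliser_def)
      qed
      fix i assume "i < length (es @ [w])"
      then show "(es @ [w]) ! i \<notin> prefix_span (es @ [w]) i"
        using ind[of i] w(2) by (cases "i < length es") (auto simp: prefix_span_def nth_append less_Suc_eq)
    qed
    then show False
      using max by fastforce
  qed
  then show ?thesis using that iso stab by blast
qed

lemma stabiliser_prefix:
  assumes g: "g \<in> flag_stabiliser es" and v: "v \<in> prefix_span es i"
  shows "g v \<in> prefix_span es i"
proof (rule prefix_span_induct_lin[OF _ subspace_prefix_span _ v])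
  show "lin g" using g Sp_lin by (auto simp: flag_stabiliser_def)
  fix j assume j: "j < i" "j < length es"
  then have "g (es ! j) \<in> prefix_span es (Suc j)"
    using g by (auto simp: flag_stabiliser_def)
  then show "g (es ! j) \<in> prefix_span es i"
    using prefix_span_mono[of "Suc j" i es] j by auto
qed

lemma stabiliser_inv_prefix:
  assumes g: "g \<in> flag_stabiliser es" and v: "v \<in> prefix_span es i"
  shows "inv_into UNIV g v \<in> prefix_span es i"
proof -
  have gS: "g \<in> carrier SpV" using g by (simp add: flag_stabiliser_def)
  let ?F = "prefix_span es i"
  have "inj_on g (span ?F)"
    using Sp_bij[OF gS] by (meson bij_def inj_on_subset subset_UNIV)
  then have "dim (g ` ?F) = dim ?F"
    by (rule endo.dim_image_eq[OF Sp_lin[OF gS]])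
  moreover have "g ` ?F \<subseteq> ?F"
    using stabiliser_prefix[OF g] by blast
  moreover have "subspace (g ` ?F)"
    by (rule subspace_lin_image[OF Sp_lin[OF gS] subspace_prefix_span])
  ultimately have "g ` ?F = ?F"
    using subspace_dim_equal[OF _ subspace_prefix_span] by simp
  then obtain u where "u \<in> ?F" "v = g u" using v by blast
  then show ?thesis using gS by simp
qed

lemma subgroup_flag_stabiliser: "subgroup (flag_stabiliser es) SpV"
proof (rule Sp.subgroupI)
  show "flag_stabiliser es \<subseteq> carrier SpV"
    by (auto simp: flag_stabiliser_def)
  show "flag_stabiliser es \<noteq> {}"
    using Sp.one_closed by (auto simp: flag_stabiliser_def intro!: exI[of _ id] prefix_span_mem)
  fix g assume g: "g \<in> flag_stabiliser es"
  then have gS: "g \<in> carrier SpV" by (simp add: flag_stabiliser_def)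
  show "inv\<^bsub>SpV\<^esub> g \<in> flag_stabiliser es"
    using stabiliser_inv_prefix[OF g prefix_span_mem] Sp_inv_closed[OF gS]
    by (simp add: Sp_inv_eq[OF gS] flag_stabiliser_def)
  fix h assume h: "h \<in> flag_stabiliser es"
  then show "g \<otimes>\<^bsub>SpV\<^esub> h \<in> flag_stabiliser es"
    using g Sp.m_closed[of g h] stabiliser_prefix[OF g stabiliser_prefix[OF h prefix_span_mem]]
    by (simp add: flag_stabiliser_def)
qed

text \<open>
  The filtration of the stabiliser by the depth to which \<open>g - 1\<close> lowers the flag. Depth \<open>0\<close> gives the whole
  stabiliser, and truncated subtraction of indices is correct since the span of the empty list is zero.
\<close>
definition unipotent_step :: "'v list \<Rightarrow> nat \<Rightarrow> ('v \<Rightarrow> 'v) set" where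
  "unipotent_step es k = {g \<in> flag_stabiliser es. \<forall>i. \<forall>v\<in>prefix_span es i. g v + v \<in> prefix_span es (i - k)}"

lemma subgroup_unipotent_step: "subgroup (unipotent_step es k) SpV"
proof (rule Sp.subgroupI)
  show "unipotent_step es k \<subseteq> carrier SpV"
    by (auto simp: unipotent_step_def flag_stabiliser_def)
  have "id \<in> unipotent_step es k"
    using subgroup.one_closed[OF subgroup_flag_stabiliser, of es] subspace_0[OF subspace_prefix_span]
    by (simp add: unipotent_step_def)
  then show "unipotent_step es k \<noteq> {}" by blast
  fix g assume g: "g \<in> unipotent_step es k"
  then have gF: "g \<in> flag_stabiliser es" by (simp add: unipotent_step_def)
  then have gS: "g \<in> carrier SpV" by (simp add: flag_stabiliser_def)
  have "inv_into UNIV g v + v \<in> prefix_span es (i - k)" if v: "v \<in> prefix_span es i" for i v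
  proof -
    have "g v + v \<in> prefix_span es (i - k)"
      using g v by (simp add: unipotent_step_def)
    then have "inv_into UNIV g (g v + v) \<in> prefix_span es (i - k)"
      by (rule stabiliser_inv_prefix[OF gF])
    then show ?thesis
      using gS by (simp add: lin_add[OF Sp_lin[OF Sp_inv_closed[OF gS]]] add.commute)
  qed
  then show "inv\<^bsub>SpV\<^esub> g \<in> unipotent_step es k"
    using subgroup.m_inv_closed[OF subgroup_flag_stabiliser gF]
    by (simp add: unipotent_step_def Sp_inv_eq[OF gS])
  fix h assume h: "h \<in> unipotent_step es k"
  have "g (h v) + v \<in> prefix_span es (i - k)" if v: "v \<in> prefix_span es i" for i v
  proof -
    have "h v + v \<in> prefix_span es (i - k)" "g v + v \<in> prefix_span es (i - k)"
      using g h v by (auto simp: unipotent_step_def)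
    then have "g (h v + v) + (g v + v) \<in> prefix_span es (i - k)"
      using stabiliser_prefix[OF gF] subspace_add[OF subspace_prefix_span] by blast
    then show ?thesis
      by (simp add: lin_add[OF Sp_lin[OF gS]] add.assoc)
  qed
  then show "g \<otimes>\<^bsub>SpV\<^esub> h \<in> unipotent_step es k"
    using subgroup.m_closed[OF subgroup_flag_stabiliser gF, of h] h
    by (simp add: unipotent_step_def)
qed

text \<open>
  For depth at least \<open>1\<close> the commutator \<open>g h - h g\<close> equals that of \<open>g - 1\<close> and \<open>h - 1\<close>. For depth
  \<open>0\<close> it is used that \<open>g\<close> and \<open>h\<close> act by scalars on the one-dimensional quotients of the flag.
\<close>
lemma commutator_step:
  assumes g: "g \<in> unipotent_step es k" and h: "h \<in> unipotent_step es k" and v: "v \<in> prefix_span es i"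
  shows "g (h v) + h (g v) \<in> prefix_span es (i - Suc k)"
proof (cases k)
  case (Suc k')
  have gF: "g \<in> flag_stabiliser es" and hF: "h \<in> flag_stabiliser es"
    using g h by (auto simp: unipotent_step_def)
  then have lin: "lin g" "lin h"
    using Sp_lin by (auto simp: flag_stabiliser_def)
  have step: "a (b v + v) + (b v + v) \<in> prefix_span es (i - Suc k)"
    if "a \<in> unipotent_step es k" "b \<in> unipotent_step es k" for a b
  proof -
    have a: "a v + v \<in> prefix_span es (i - k)" if "v \<in> prefix_span es i" for i v
      using \<open>a \<in> _\<close> that unfolding unipotent_step_def by blast
    have "b v + v \<in> prefix_span es (i - k)"
      using that(2) v unfolding unipotent_step_def by blast
    then have "a (b v + v) + (b v + v) \<in> prefix_span es (i - k - k)"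
      by (rule a)
    moreover have "i - k - k \<le> i - Suc k"
      using Suc by simp
    ultimately show ?thesis
      using prefix_span_mono[of "i - k - k" "i - Suc k" es] by blast
  qed
  have "(g (h v + v) + (h v + v)) + (h (g v + v) + (g v + v)) \<in> prefix_span es (i - Suc k)"
    using step[OF g h] step[OF h g] subspace_add[OF subspace_prefix_span] by blast
  also have "(g (h v + v) + (h v + v)) + (h (g v + v) + (g v + v)) = g (h v) + h (g v)"
    by (simp add: lin_add[OF lin(1)] lin_add[OF lin(2)] ac_simps)
  finally show ?thesis .
next
  case 0
  have gF: "g \<in> flag_stabiliser es" and hF: "h \<in> flag_stabiliser es"
    using g h by (auto simp: unipotent_step_def)
  then have lin: "lin g" "lin h"
    using Sp_lin by (auto simp: flag_stabiliser_def)
  have "g (h v) + h (g v) \<in> prefix_span es (i - 1)"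
  proof (rule prefix_span_induct_lin[where f = "\<lambda>v. g (h v) + h (g v)", OF _ subspace_prefix_span _ v])
    show "lin (\<lambda>v. g (h v) + h (g v))"
      by (rule lin_plus[OF lin_comp[OF lin] lin_comp[OF lin(2,1)]])
    fix j assume j: "j < i" "j < length es"
    let ?e = "es ! j" and ?F = "prefix_span es j"
    have diag: "\<exists>a. x ?e + scl a ?e \<in> ?F" if x: "x \<in> flag_stabiliser es" for x
    proof -
      have "x ?e \<in> span (insert ?e (set (take j es)))"
        using x j(2) by (simp add: flag_stabiliser_def prefix_span_def take_Suc_conv_app_nth)
      then show ?thesis
        unfolding span_breakdown_eq by (simp add: prefix_span_def)
    qed
    obtain a b where a: "g ?e + scl a ?e \<in> ?F" and b: "h ?e + scl b ?e \<in> ?F"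
      using diag[OF gF] diag[OF hF] by blast
    have "g (h ?e + scl b ?e) + h (g ?e + scl a ?e) + (scl b (g ?e + scl a ?e) + scl a (h ?e + scl b ?e)) \<in> ?F"
      by (intro subspace_add[OF subspace_prefix_span] subspace_scale[OF subspace_prefix_span]
          stabiliser_prefix[OF gF] stabiliser_prefix[OF hF] a b)
    also have "g (h ?e + scl b ?e) + h (g ?e + scl a ?e) + (scl b (g ?e + scl a ?e) + scl a (h ?e + scl b ?e))
        = g (h ?e) + h (g ?e)"
      by (simp add: lin_add[OF lin(1)] lin_add[OF lin(2)] lin_scale[OF lin(1)] lin_scale[OF lin(2)]
          scale_right_distrib mult.commute ac_simps)
    finally have "g (h ?e) + h (g ?e) \<in> ?F" .
    moreover have "j \<le> i - 1"
      using j by simp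
    ultimately show "g (h ?e) + h (g ?e) \<in> prefix_span es (i - 1)"
      using prefix_span_mono[of j "i - 1" es] by blast
  qed
  then show ?thesis using 0 by simp
qed

lemma derived_unipotent_step:
  "derived SpV (unipotent_step es k) \<subseteq> unipotent_step es (Suc k)"
  unfolding derived_def
proof (rule Sp.generate_subgroup_incl[OF _ subgroup_unipotent_step], rule subsetI)
  fix c assume "c \<in> derived_set SpV (unipotent_step es k)"
  then obtain g h where g: "g \<in> unipotent_step es k" and h: "h \<in> unipotent_step es k"
    and c: "c = g \<otimes>\<^bsub>SpV\<^esub> h \<otimes>\<^bsub>SpV\<^esub> inv\<^bsub>SpV\<^esub> g \<otimes>\<^bsub>SpV\<^esub> inv\<^bsub>SpV\<^esub> h" by blast
  have gF: "g \<in> flag_stabiliser es" and hF: "h \<in> flag_stabiliser es"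
    using g h by (auto simp: unipotent_step_def)
  then have gS: "g \<in> carrier SpV" and hS: "h \<in> carrier SpV"
    by (auto simp: flag_stabiliser_def)
  have "c \<in> flag_stabiliser es"
    unfolding c using gF hF subgroup.m_closed[OF subgroup_flag_stabiliser]
      subgroup.m_inv_closed[OF subgroup_flag_stabiliser] by blast
  moreover have "c v + v \<in> prefix_span es (i - Suc k)" if v: "v \<in> prefix_span es i" for i v
  proof -
    define u where "u = inv_into UNIV g (inv_into UNIV h v)"
    have "u \<in> prefix_span es i"
      unfolding u_def by (rule stabiliser_inv_prefix[OF gF stabiliser_inv_prefix[OF hF v]])
    then have "g (h u) + h (g u) \<in> prefix_span es (i - Suc k)"
      by (rule commutator_step[OF g h])
    moreover have "h (g u) = v" "g (h u) = c v"
      using gS hS by (simp_all add: u_def c Sp_inv_eq)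
    ultimately show ?thesis by simp
  qed
  ultimately show "c \<in> unipotent_step es (Suc k)"
    by (simp add: unipotent_step_def)
qed

text \<open>
  After as many steps as the flag has members, the elements fix the Lagrangian subspace \<open>L\<close> pointwise.
  Being isometries they move every vector by an element of \<open>L\<^sup>\<bottom> = L\<close>, and such elements commute.
\<close>
lemma derived_seq_flag_stabiliser:
  assumes lag: "perp (span (set es)) \<subseteq> span (set es)"
  shows "(derived SpV ^^ Suc (length es)) (flag_stabiliser es) \<subseteq> {id}"
proof -
  have step: "(derived SpV ^^ k) (flag_stabiliser es) \<subseteq> unipotent_step es k" for k
  proof (induction k)
    case 0
    then show ?case
      using stabiliser_prefix subspace_add[OF subspace_prefix_span] by (auto simp: unipotent_step_def)
  next
    case (Suc k)
    then have "(derived SpV ^^ Suc k) (flag_stabiliser es) \<subseteq> derived SpV (unipotent_step es k)"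
      using Sp.mono_derived by simp
    then show ?case
      using derived_unipotent_step by blast
  qed
  let ?N = "unipotent_step es (length es)" and ?F = "span (set es)"
  have fix_F: "g v = v" if "g \<in> ?N" "v \<in> ?F" for g v
  proof -
    have "v \<in> prefix_span es (length es)"
      using that(2) by (simp add: prefix_span_def)
    then have "g v + v \<in> prefix_span es (length es - length es)"
      using that(1) unfolding unipotent_step_def by blast
    then show ?thesis by (simp add: prefix_span_def)
  qed
  have into_F: "g v + v \<in> ?F" if g: "g \<in> ?N" for g v
  proof -
    have gS: "g \<in> carrier SpV" using g by (auto simp: unipotent_step_def flag_stabiliser_def)
    have "\<beta> (g v + v) f = 0" if "f \<in> ?F" for f
      using Sp_isometry[OF gS, of v f] fix_F[OF g that] by simp
    then show ?thesis using lag by (auto simp: perp_def)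
  qed
  have commute: "g (h v) = h (g v)" if g: "g \<in> ?N" and h: "h \<in> ?N" for g h v
  proof -
    have lin: "lin g" "lin h"
      using g h Sp_lin by (auto simp: unipotent_step_def flag_stabiliser_def)
    have "g (h v + v) = h v + v" "h (g v + v) = g v + v"
      using fix_F[OF g into_F[OF h]] fix_F[OF h into_F[OF g]] .
    then have "g (h v) + g v = h v + v" "h (g v) + h v = g v + v"
      by (simp_all add: lin_add[OF lin(1)] lin_add[OF lin(2)])
    moreover have "x = z + y" if "x + y = z" for x y z :: 'v
      using that by (auto simp: add.assoc)
    ultimately have "g (h v) = (h v + v) + g v" "h (g v) = (g v + v) + h v"
      by blast+
    then show ?thesis by (simp add: ac_simps)
  qed
  have "derived SpV ?N \<subseteq> {id}"
    unfolding derived_def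
  proof (rule Sp.generate_subgroup_incl)
    show "subgroup {id} SpV"
      using Sp.triv_subgroup by simp
    show "derived_set SpV ?N \<subseteq> {id}"
    proof
      fix c assume "c \<in> derived_set SpV ?N"
      then obtain g h where g: "g \<in> ?N" and h: "h \<in> ?N"
        and c: "c = g \<otimes>\<^bsub>SpV\<^esub> h \<otimes>\<^bsub>SpV\<^esub> inv\<^bsub>SpV\<^esub> g \<otimes>\<^bsub>SpV\<^esub> inv\<^bsub>SpV\<^esub> h" by blast
      have gS: "g \<in> carrier SpV" and hS: "h \<in> carrier SpV"
        using g h by (auto simp: unipotent_step_def flag_stabiliser_def)
      have "c v = v" for v
        using commute[OF g h] gS hS by (simp add: c Sp_inv_eq)
      then show "c \<in> {id}" by auto
    qed
  qed
  moreover have "(derived SpV ^^ Suc (length es)) (flag_stabiliser es) \<subseteq> derived SpV ?N"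
    using Sp.mono_derived[OF step[of "length es"]] by simp
  ultimately show ?thesis by blast
qed

lemma solvable_restrict_iff:
  assumes C: "subgroup C SpV"
  shows "solvable (SpV\<lparr>carrier := C\<rparr>) \<longleftrightarrow> (\<exists>n. (derived SpV ^^ n) C = {id})"
proof -
  let ?G = "SpV\<lparr>carrier := C\<rparr>"
  interpret G: group ?G
    by (rule subgroup.subgroup_is_group[OF C group_Sp])
  have "(derived ?G ^^ n) C = (derived SpV ^^ n) C \<and> (derived SpV ^^ n) C \<subseteq> C" for n
    by (induction n) (auto simp: Sp.derived_consistent[OF _ C] dest: Sp.derived_incl[OF _ C])
  then show ?thesis
    using G.solvable_iff_trivial_derived_seq by (simp add: Sp_one)
qed

end

section \<open>Rational curves and tangent vectors\<close>

context symplectic_char2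
begin

interpretation Sp: group SpV
  by (rule group_Sp)

text \<open>
  Membership in a subspace is expressed by the linear equations given by its orthogonal.
\<close>
lemma closed_flag_stabiliser:
  "closedin (subtopology zar (carrier SpV)) (flag_stabiliser es)"
proof -
  define Z where "Z = {x \<in> gl scl. \<forall>i<length es. \<forall>z\<in>perp (prefix_span es (Suc i)). \<beta> z (x (es ! i)) = 0}"
  define \<U> where "\<U> = {{x \<in> gl scl. \<beta> z (x (es ! i)) \<noteq> 0} |i z. i < length es \<and> z \<in> perp (prefix_span es (Suc i))}"
  have "topspace zar - Z = \<Union>\<U>"
    unfolding Z_def \<U>_def topspace_zariski by blast
  moreover have "openin zar O'" if O': "O' \<in> \<U>" for O'
  proof -
    obtain i z where "O' = {x \<in> gl scl. \<beta> z (x (es ! i)) \<noteq> 0}"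
      using O' unfolding \<U>_def by blast
    then show ?thesis
      using zariski_open[OF polyfun.entry[OF beta_lfun(1), of z "es ! i"]] by simp
  qed
  ultimately have "openin zar (topspace zar - Z)"
    using openin_Union[of \<U>] by simp
  moreover have "Z \<subseteq> topspace zar"
    unfolding Z_def topspace_zariski by blast
  ultimately have "closedin zar Z"
    by (simp add: closedin_def)
  moreover have "flag_stabiliser es = Z \<inter> carrier SpV"
  proof -
    have "(\<forall>z\<in>perp (prefix_span es (Suc i)). \<beta> z u = 0) \<longleftrightarrow> u \<in> prefix_span es (Suc i)" for i u
    proof -
      have "(\<forall>z\<in>perp (prefix_span es (Suc i)). \<beta> z u = 0) \<longleftrightarrow> u \<in> perp (perp (prefix_span es (Suc i)))"
        unfolding perp_def[of "perp (prefix_span es (Suc i))"] mem_Collect_eq beta_sym[of u] ..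
      then show ?thesis
        unfolding perp_perp[OF subspace_prefix_span] .
    qed
    then show ?thesis
      using Sp_lin by (auto simp: flag_stabiliser_def Z_def gl_iff)
  qed
  ultimately show ?thesis
    by (auto simp: closedin_subtopology)
qed

lemma continuous_left_translation:
  assumes a: "lin a"
  shows "continuous_map zar zar (\<lambda>x. a \<circ> x)"
  unfolding zariski_def
proof (rule continuous_on_generated_topo)
  fix O' assume "O' \<in> {{x \<in> gl scl. f x \<noteq> 0} |f. f \<in> polys}"
  then obtain f where f: "f \<in> polys" and O': "O' = {x \<in> gl scl. f x \<noteq> 0}" by blast
  have "(\<lambda>x. a \<circ> x) -` O' \<inter> gl scl = {x \<in> gl scl. f (a \<circ> x) \<noteq> 0}"
    using a lin_comp[OF a] by (auto simp: O' gl_iff o_def)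
  then have "openin zar ((\<lambda>x. a \<circ> x) -` O' \<inter> gl scl)"
    using zariski_open[OF polyfun_translate[OF f a]] by simp
  then show "openin (topology_generated_by {{x \<in> gl scl. f x \<noteq> 0} |f. f \<in> polys})
      ((\<lambda>x. a \<circ> x) -` O' \<inter> topspace (topology_generated_by {{x \<in> gl scl. f x \<noteq> 0} |f. f \<in> polys}))"
    using topspace_zariski by (simp add: zariski_def)
next
  show "(\<lambda>x. a \<circ> x) ` topspace (topology_generated_by {{x \<in> gl scl. f x \<noteq> 0} |f. f \<in> polys})
      \<subseteq> \<Union> {{x \<in> gl scl. f x \<noteq> 0} |f. f \<in> polys}"
    using topspace_zariski lin_comp[OF a] unfolding zariski_def topology_generated_by_topspace
    by (auto simp: gl_iff o_def)
qed

definition identity_component :: "('v \<Rightarrow> 'v) set \<Rightarrow> ('v \<Rightarrow> 'v) set" where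
  "identity_component H = connected_component_of_set (subtopology zar H) id"

lemma identity_component_properties:
  assumes H: "subgroup H SpV"
  shows "connectedin zar (identity_component H)" "identity_component H \<subseteq> H"
    and "\<And>S. connectedin zar S \<Longrightarrow> id \<in> S \<Longrightarrow> S \<subseteq> H \<Longrightarrow> S \<subseteq> identity_component H"
    and "closedin (subtopology zar H) (identity_component H)"
    and "id \<in> identity_component H"
proof -
  have "connectedin (subtopology zar H) (identity_component H)"
    unfolding identity_component_def by (rule connectedin_connected_component_of)
  then show "connectedin zar (identity_component H)" "identity_component H \<subseteq> H"
    by (auto simp: connectedin_subtopology)
  show max: "S \<subseteq> identity_component H" if "connectedin zar S" "id \<in> S" "S \<subseteq> H" for S
    unfolding identity_component_def
    using that by (intro connected_component_of_maximal) (auto simp: connectedin_subtopology)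
  show "closedin (subtopology zar H) (identity_component H)"
    unfolding identity_component_def by (rule closedin_connected_component_of)
  have "connectedin zar {id}"
    by (simp add: topspace_zariski gl_iff)
  then show "id \<in> identity_component H"
    using max[of "{id}"] subgroup.one_closed[OF H] by auto
qed

text \<open>
  Left translations are continuous, so \<open>a\<^sup>-\<^sup>1 C\<close> is connected and contains the identity for every \<open>a\<close>
  in the component \<open>C\<close>.
\<close>
lemma subgroup_identity_component:
  assumes H: "subgroup H SpV"
  shows "subgroup (identity_component H) SpV"
proof -
  let ?C = "identity_component H"
  note props = identity_component_properties[OF H]
  note HS = subgroup.subset[OF H]
  have CS: "?C \<subseteq> carrier SpV"
    using props(2) HS by blast
  have div: "inv_into UNIV a \<circ> b \<in> ?C" if a: "a \<in> ?C" and b: "b \<in> ?C" for a b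
  proof -
    have aS: "a \<in> carrier SpV" using a CS by blast
    let ?t = "\<lambda>x. inv_into UNIV a \<circ> x"
    have "connectedin zar (?t ` ?C)"
      by (rule connectedin_continuous_map_image[OF continuous_left_translation props(1)])
        (rule Sp_lin[OF Sp_inv_closed[OF aS]])
    moreover have "?t a = id"
      using aS by (simp add: fun_eq_iff)
    then have "id \<in> ?t ` ?C"
      using a by (metis image_eqI)
    moreover have "?t x \<in> H" if "x \<in> ?C" for x
      using subgroup.m_closed[OF H subgroup.m_inv_closed[OF H], of a x] a that props(2)
      by (auto simp: Sp_inv_eq[OF aS])
    ultimately have "?t ` ?C \<subseteq> ?C"
      using props(3)[of "?t ` ?C"] by blast
    then show ?thesis using b by blast
  qed
  have inv: "inv_into UNIV a \<in> ?C" if "a \<in> ?C" for a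
    using div[OF that props(5)] by simp
  show ?thesis
  proof (rule Sp.subgroupI[OF CS])
    show "?C \<noteq> {}" using props(5) by blast
    fix a assume a: "a \<in> ?C"
    then have aS: "a \<in> carrier SpV" using CS by blast
    show "inv\<^bsub>SpV\<^esub> a \<in> ?C"
      using inv[OF a] by (simp add: Sp_inv_eq[OF aS])
    fix b assume b: "b \<in> ?C"
    have "inv_into UNIV (inv_into UNIV a) = a"
      using Sp_bij[OF aS] by (simp add: inv_inv_eq)
    then show "a \<otimes>\<^bsub>SpV\<^esub> b \<in> ?C"
      using div[OF inv[OF a] b] by simp
  qed
qed

text \<open>
  A rational curve through the identity whose tangent vector there is \<open>pair_elem v w\<close>. The coefficient
  \<open>s = t / (1 + \<beta>(v,w) t)\<close> solves \<open>t + s + t s \<beta>(v,w) = 0\<close>, which by \<open>transvection_pair_beta\<close> makes the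
  map an isometry. For orthogonal \<open>v\<close> and \<open>w\<close> this is a unipotent one-parameter group; if \<open>\<beta>(v,w) = 1\<close>, it is the
  torus that scales \<open>v\<close> and \<open>w\<close> inversely, with parameter \<open>1 + t\<close>.
\<close>
definition curve :: "'v \<Rightarrow> 'v \<Rightarrow> 'k \<Rightarrow> 'v \<Rightarrow> 'v" where
  "curve v w t = (\<lambda>u. u + scl (t * \<beta> w u) v + scl (t / (1 + \<beta> v w * t) * \<beta> v u) w)"

lemma transvection_pair_lin: "lin (\<lambda>u. u + scl (t * \<beta> w u) v + scl (s * \<beta> v u) w)"
  by (rule linI)
    (simp_all add: scale_left_distrib scale_right_distrib distrib_left ac_simps)

lemma transvection_pair_beta:
  "\<beta> (x + scl (t * \<beta> w x) v + scl (s * \<beta> v x) w) (y + scl (t * \<beta> w y) v + scl (s * \<beta> v y) w)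
    = \<beta> x y + (\<beta> w x * \<beta> v y + \<beta> v x * \<beta> w y) * (t + s + t * s * \<beta> v w)"
  by (simp add: beta_sym[of x] beta_sym[of w v] algebra_simps)

lemma curve_lin: "lin (curve v w t)"
  unfolding curve_def by (rule transvection_pair_lin)

lemma curve_Sp:
  assumes "1 + \<beta> v w * t \<noteq> 0"
  shows "curve v w t \<in> carrier SpV"
proof -
  define s where "s = t / (1 + \<beta> v w * t)"
  have "s * (1 + \<beta> v w * t) = t"
    using assms by (simp add: s_def)
  moreover have "t + s + t * s * \<beta> v w = t + s * (1 + \<beta> v w * t)"
    by (simp add: algebra_simps)
  ultimately have "t + s + t * s * \<beta> v w = 0"
    by simp
  then have "\<beta> (curve v w t x) (curve v w t y) = \<beta> x y" for x y
    unfolding curve_def s_def[symmetric] transvection_pair_beta by simp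
  then show ?thesis
    using curve_lin by (simp add: Sp_iff)
qed

lemma curve_zero: "curve v w 0 = id"
  by (simp add: curve_def fun_eq_iff)

text \<open>
  Along the curve, \<open>f\<close> is a quotient \<open>q / d\<close> of polynomials, and \<open>p\<close> is its restriction to the tangent line.
  The last equation says that \<open>q / d\<close> and \<open>p\<close> agree to first order at \<open>0\<close>.
\<close>
lemma polyfun_along_curve:
  assumes "f \<in> polys"
  shows "\<exists>d q p. (\<forall>t. 1 + \<beta> v w * t \<noteq> 0 \<longrightarrow> poly d t \<noteq> 0 \<and> poly d t * f (curve v w t) = poly q t) \<and>
    (\<forall>t. f (\<lambda>u. u + scl t (pair_elem v w u)) = poly p t) \<and> poly d 0 = 1 \<and> poly q 0 = poly p 0 \<and>
    poly (pderiv q) 0 = poly (pderiv p) 0 + poly (pderiv d) 0 * poly p 0"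
  using assms
proof (induction rule: polyfun.induct)
  case (const c)
  show ?case
    by (rule exI[of _ 1], rule exI[of _ "[:c:]"], rule exI[of _ "[:c:]"]) (simp add: pderiv_pCons)
next
  case (entry \<phi> u)
  define k where "k = \<beta> v w"
  define A where "A = \<beta> w u * \<phi> v"
  define B where "B = \<beta> v u * \<phi> w"
  define C where "C = \<phi> u"
  note \<phi> = lfun_add[OF entry] lfun_scale[OF entry]
  have 1: "(1 + k * t) * \<phi> (curve v w t u) = poly [:C, A + k * C + B, k * A:] t" if "1 + k * t \<noteq> 0" for t
  proof -
    have "(1 + k * t) * (t / (1 + k * t)) = t"
      using that by simp
    then have "(1 + k * t) * (t / (1 + k * t) * B) = t * B"
      by (simp only: mult.assoc[symmetric])
    then show ?thesis
      by (simp only: curve_def \<phi> k_def[symmetric] A_def[symmetric] B_def[symmetric] C_def[symmetric]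
          mult.assoc distrib_left) (simp add: A_def B_def C_def algebra_simps)
  qed
  have 2: "\<phi> (u + scl t (pair_elem v w u)) = poly [:C, A + B:] t" for t
    by (simp add: pair_elem_def \<phi> A_def B_def C_def algebra_simps)
  show ?case
    by (rule exI[of _ "[:1, k:]"], rule exI[of _ "[:C, A + k * C + B, k * A:]"], rule exI[of _ "[:C, A + B:]"])
      (use 1 2 in \<open>simp add: k_def[symmetric] pderiv_pCons mult.commute ac_simps\<close>)
next
  case (add f h)
  from add.IH obtain d1 q1 p1 d2 q2 p2 where
    1: "\<forall>t. 1 + \<beta> v w * t \<noteq> 0 \<longrightarrow> poly d1 t \<noteq> 0 \<and> poly d1 t * f (curve v w t) = poly q1 t"
      "\<forall>t. f (\<lambda>u. u + scl t (pair_elem v w u)) = poly p1 t" "poly d1 0 = 1" "poly q1 0 = poly p1 0"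
      "poly (pderiv q1) 0 = poly (pderiv p1) 0 + poly (pderiv d1) 0 * poly p1 0"
    and 2: "\<forall>t. 1 + \<beta> v w * t \<noteq> 0 \<longrightarrow> poly d2 t \<noteq> 0 \<and> poly d2 t * h (curve v w t) = poly q2 t"
      "\<forall>t. h (\<lambda>u. u + scl t (pair_elem v w u)) = poly p2 t" "poly d2 0 = 1" "poly q2 0 = poly p2 0"
      "poly (pderiv q2) 0 = poly (pderiv p2) 0 + poly (pderiv d2) 0 * poly p2 0"
    by blast
  have "poly (d1 * d2) t * (f (curve v w t) + h (curve v w t)) = poly (q1 * d2 + q2 * d1) t"
    if t: "1 + \<beta> v w * t \<noteq> 0" for t
  proof -
    have "poly d1 t * f (curve v w t) = poly q1 t" "poly d2 t * h (curve v w t) = poly q2 t"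
      using 1(1) 2(1) t by blast+
    moreover have "poly (d1 * d2) t * (f (curve v w t) + h (curve v w t))
        = (poly d1 t * f (curve v w t)) * poly d2 t + (poly d2 t * h (curve v w t)) * poly d1 t"
      by (simp add: algebra_simps)
    ultimately show ?thesis
      by (simp only: poly_add poly_mult)
  qed
  moreover have "poly (pderiv (q1 * d2 + q2 * d1)) 0
      = poly (pderiv (p1 + p2)) 0 + poly (pderiv (d1 * d2)) 0 * poly (p1 + p2) 0"
    by (simp add: pderiv_add pderiv_mult 1(3-5) 2(3-5) algebra_simps)
  ultimately show ?case
    using 1 2 by (intro exI[of _ "d1 * d2"] exI[of _ "q1 * d2 + q2 * d1"] exI[of _ "p1 + p2"]) simp
next
  case (mult f h)
  from mult.IH obtain d1 q1 p1 d2 q2 p2 where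
    1: "\<forall>t. 1 + \<beta> v w * t \<noteq> 0 \<longrightarrow> poly d1 t \<noteq> 0 \<and> poly d1 t * f (curve v w t) = poly q1 t"
      "\<forall>t. f (\<lambda>u. u + scl t (pair_elem v w u)) = poly p1 t" "poly d1 0 = 1" "poly q1 0 = poly p1 0"
      "poly (pderiv q1) 0 = poly (pderiv p1) 0 + poly (pderiv d1) 0 * poly p1 0"
    and 2: "\<forall>t. 1 + \<beta> v w * t \<noteq> 0 \<longrightarrow> poly d2 t \<noteq> 0 \<and> poly d2 t * h (curve v w t) = poly q2 t"
      "\<forall>t. h (\<lambda>u. u + scl t (pair_elem v w u)) = poly p2 t" "poly d2 0 = 1" "poly q2 0 = poly p2 0"
      "poly (pderiv q2) 0 = poly (pderiv p2) 0 + poly (pderiv d2) 0 * poly p2 0"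
    by blast
  have "poly (d1 * d2) t * (f (curve v w t) * h (curve v w t)) = poly (q1 * q2) t"
    if t: "1 + \<beta> v w * t \<noteq> 0" for t
  proof -
    have "poly d1 t * f (curve v w t) = poly q1 t" "poly d2 t * h (curve v w t) = poly q2 t"
      using 1(1) 2(1) t by blast+
    moreover have "poly (d1 * d2) t * (f (curve v w t) * h (curve v w t))
        = (poly d1 t * f (curve v w t)) * (poly d2 t * h (curve v w t))"
      by (simp add: algebra_simps)
    ultimately show ?thesis
      by (simp only: poly_mult)
  qed
  moreover have "poly (pderiv (q1 * q2)) 0
      = poly (pderiv (p1 * p2)) 0 + poly (pderiv (d1 * d2)) 0 * poly (p1 * p2) 0"
    by (simp add: pderiv_mult 1(3-5) 2(3-5) algebra_simps)
  ultimately show ?case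
    using 1 2 by (intro exI[of _ "d1 * d2"] exI[of _ "q1 * q2"] exI[of _ "p1 * p2"]) simp
qed

lemma finite_curve_poles: "finite {t. 1 + \<beta> v w * t = 0}"
  using poly_roots_finite[of "[:1, \<beta> v w:]"] by (simp add: mult.commute)

definition curve_image :: "'v \<Rightarrow> 'v \<Rightarrow> ('v \<Rightarrow> 'v) set" where
  "curve_image v w = curve v w ` {t. 1 + \<beta> v w * t \<noteq> 0}"

text \<open>
  The preimage under the curve of an open set is empty or cofinite in the infinite field, so two
  nonempty open subsets of the image intersect.
\<close>
lemma curve_image_connected: "connectedin zar (curve_image v w)"
proof -
  let ?D = "{t. 1 + \<beta> v w * t \<noteq> 0}"
  let ?\<S> = "{{x \<in> gl scl. f x \<noteq> 0} |f. f \<in> polys}"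
  have cofinite: "{t \<in> ?D. curve v w t \<in> O'} = {} \<or> finite (?D - {t. curve v w t \<in> O'})"
    if "generate_topology_on ?\<S> O'" for O'
    using that
  proof (induction rule: generate_topology_on.induct)
    case Empty
    then show ?case by simp
  next
    case (Int a b)
    have "?D - {t. curve v w t \<in> a \<inter> b} = (?D - {t. curve v w t \<in> a}) \<union> (?D - {t. curve v w t \<in> b})"
      by blast
    then show ?case using Int.IH by auto
  next
    case (UN K)
    show ?case
    proof (cases "\<exists>k\<in>K. finite (?D - {t. curve v w t \<in> k})")
      case True
      then obtain k where k: "k \<in> K" "finite (?D - {t. curve v w t \<in> k})" by blast
      have "?D - {t. curve v w t \<in> \<Union>K} \<subseteq> ?D - {t. curve v w t \<in> k}"
        using k(1) by blast
      then show ?thesis using k(2) finite_subset by blast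
    next
      case False
      then show ?thesis using UN.IH by blast
    qed
  next
    case (Basis s)
    then obtain f where f: "f \<in> polys" and s: "s = {x \<in> gl scl. f x \<noteq> 0}" by blast
    obtain d q where dq: "\<And>t. t \<in> ?D \<Longrightarrow> poly d t \<noteq> 0 \<and> poly d t * f (curve v w t) = poly q t"
      using polyfun_along_curve[OF f, of v w] by blast
    have mem: "curve v w t \<in> s \<longleftrightarrow> poly q t \<noteq> 0" if "t \<in> ?D" for t
      using dq[OF that] curve_lin by (auto simp: s gl_iff)
    show ?case
    proof (cases "q = 0")
      case True
      then show ?thesis using mem by auto
    next
      case False
      have "?D - {t. curve v w t \<in> s} \<subseteq> {t. poly q t = 0}"
        using mem by blast
      then show ?thesis using poly_roots_finite[OF False] finite_subset by blast
    qed
  qed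
  show ?thesis
    unfolding connectedin
  proof (intro conjI notI)
    show "curve_image v w \<subseteq> topspace zar"
      using curve_lin by (auto simp: curve_image_def topspace_zariski gl_iff)
    assume "\<exists>E1 E2. openin zar E1 \<and> openin zar E2 \<and> curve_image v w \<subseteq> E1 \<union> E2 \<and>
      E1 \<inter> E2 \<inter> curve_image v w = {} \<and> E1 \<inter> curve_image v w \<noteq> {} \<and> E2 \<inter> curve_image v w \<noteq> {}"
    then obtain E1 E2 where E: "openin zar E1" "openin zar E2"
      "E1 \<inter> E2 \<inter> curve_image v w = {}" "E1 \<inter> curve_image v w \<noteq> {}" "E2 \<inter> curve_image v w \<noteq> {}" by blast
    have fin: "finite (?D - {t. curve v w t \<in> E'})" if "openin zar E'" "E' \<inter> curve_image v w \<noteq> {}" for E'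
    proof -
      have "{t \<in> ?D. curve v w t \<in> E'} \<noteq> {}"
        using that(2) by (auto simp: curve_image_def)
      then show ?thesis
        using cofinite[of E'] that(1) unfolding zariski_def openin_topology_generated_by_iff by blast
    qed
    have "?D \<subseteq> (?D - {t. curve v w t \<in> E1}) \<union> (?D - {t. curve v w t \<in> E2})"
      using E(3) by (auto simp: curve_image_def)
    then have "finite ?D"
      using fin[OF E(1,4)] fin[OF E(2,5)] by (meson finite_UnI finite_subset)
    moreover have "UNIV = ?D \<union> {t. 1 + \<beta> v w * t = 0}" by blast
    ultimately show False
      using finite_curve_poles[of v w] infinite_UNIV_alg_closed by (metis finite_UnI)
  qed
qed

text \<open>
  If \<open>f\<close> vanishes on the curve, then \<open>q\<close> in \<open>polyfun_along_curve\<close> is zero, and so are the value and the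
  derivative of \<open>p\<close> at \<open>0\<close>.
\<close>
lemma pair_elem_Lie:
  assumes "curve_image v w \<subseteq> B"
  shows "pair_elem v w \<in> Lie scl B"
  unfolding Lie_def
proof (intro CollectI conjI ballI impI allI)
  show "pair_elem v w \<in> gl scl"
    using pair_elem_sp by (simp add: sp_def)
  fix f p assume f: "f \<in> polys" and van: "\<forall>h\<in>B. f h = 0"
    and p: "\<forall>t. f (\<lambda>u. u + scl t (pair_elem v w u)) = poly p t"
  obtain d q p' where 1: "\<forall>t. 1 + \<beta> v w * t \<noteq> 0 \<longrightarrow> poly d t \<noteq> 0 \<and> poly d t * f (curve v w t) = poly q t"
    and p': "\<forall>t. f (\<lambda>u. u + scl t (pair_elem v w u)) = poly p' t" and q0: "poly q 0 = poly p' 0"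
    and der: "poly (pderiv q) 0 = poly (pderiv p') 0 + poly (pderiv d) 0 * poly p' 0"
    using polyfun_along_curve[OF f, of v w] by blast
  have "p' = p"
    using p p' by (intro poly_eq_if_cofinite[of "{}"]) auto
  have "poly q t = poly 0 t" if "t \<notin> {t. 1 + \<beta> v w * t = 0}" for t
  proof -
    have "curve v w t \<in> B"
      using that assms by (auto simp: curve_image_def)
    then show ?thesis
      using 1 van that by auto
  qed
  then have "q = 0"
    by (rule poly_eq_if_cofinite[OF finite_curve_poles])
  then show "poly (pderiv p) 0 = 0"
    using q0 der \<open>p' = p\<close> by simp
qed

end

section \<open>Borel subgroups and nilpotency\<close>

context symplectic_char2
begin

interpretation Sp: group SpV
  by (rule group_Sp)

text \<open>
  Vectors of the flag before \<open>es ! i\<close> are fixed by the curve, and all the others are changed by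
  multiples of \<open>es ! i\<close>.
\<close>
lemma curve_image_stabiliser:
  assumes iso: "isotropic es" and i: "i < length es" and w: "w \<in> perp (prefix_span es i)"
  shows "curve_image (es ! i) w \<subseteq> flag_stabiliser es"
proof
  fix g assume "g \<in> curve_image (es ! i) w"
  then obtain t where t: "1 + \<beta> (es ! i) w * t \<noteq> 0" and g: "g = curve (es ! i) w t"
    by (auto simp: curve_image_def)
  have "g (es ! j) \<in> prefix_span es (Suc j)" if j: "j < length es" for j
  proof -
    have "\<beta> (es ! i) (es ! j) = 0"
      using iso i j by (simp add: isotropic_def)
    then have eq: "g (es ! j) = es ! j + scl (t * \<beta> w (es ! j)) (es ! i)"
      by (simp add: g curve_def)
    have ej: "es ! j \<in> prefix_span es (Suc j)"
      by (rule prefix_span_mem[OF lessI j])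
    show ?thesis
    proof (cases "j < i")
      case True
      then have "\<beta> w (es ! j) = 0"
        using w prefix_span_mem[OF True j] by (simp add: perp_def)
      then show ?thesis using eq ej by simp
    next
      case False
      then have "es ! i \<in> prefix_span es (Suc j)"
        using prefix_span_mem[of i "Suc j" es] i by simp
      then show ?thesis
        unfolding eq by (intro subspace_add[OF subspace_prefix_span] subspace_scale[OF subspace_prefix_span] ej)
    qed
  qed
  then show "g \<in> flag_stabiliser es"
    using curve_Sp[OF t] by (simp add: flag_stabiliser_def g)
qed

text \<open>
  The identity component of the stabiliser of a flag fixed by \<open>B\<close> is closed, connected and solvable and
  contains \<open>B\<close>, so it equals \<open>B\<close> by maximality.
\<close>
theorem borel_eq_identity_component:
  assumes B: "borel_subgroup scl \<beta> B"
  obtains es where "isotropic es" "perp (span (set es)) \<subseteq> span (set es)"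
    "B = identity_component (flag_stabiliser es)"
proof -
  have BB: "subgroup B SpV" "connectedin zar B" "solvable (SpV\<lparr>carrier := B\<rparr>)"
    and max: "\<And>H. closed_connected_solvable scl \<beta> H \<Longrightarrow> B \<subseteq> H \<Longrightarrow> H = B"
    using B by (auto simp: borel_subgroup_def closed_connected_solvable_def)
  obtain n where n: "(derived SpV ^^ n) B = {id}"
    using BB(3) solvable_restrict_iff[OF BB(1)] by blast
  obtain es where iso: "isotropic es" and sub: "B \<subseteq> flag_stabiliser es"
    and lag: "perp (span (set es)) \<subseteq> span (set es)"
    using Lagrangian_flag_exists[OF BB(1) connected_imp_rigid[OF BB(2)] n] by blast
  let ?P = "flag_stabiliser es" and ?C = "identity_component (flag_stabiliser es)"
  note props = identity_component_properties[OF subgroup_flag_stabiliser[of es]]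
  have C: "subgroup ?C SpV"
    by (rule subgroup_identity_component[OF subgroup_flag_stabiliser])
  have "closedin (subtopology zar (carrier SpV)) ?C"
  proof (rule closedin_trans_full[OF _ closed_flag_stabiliser[of es]])
    have "carrier SpV \<inter> ?P = ?P"
      using subgroup.subset[OF subgroup_flag_stabiliser[of es]] by blast
    then show "closedin (subtopology (subtopology zar (carrier SpV)) ?P) ?C"
      using props(4) by (simp add: subtopology_subtopology)
  qed
  moreover have "solvable (SpV\<lparr>carrier := ?C\<rparr>)"
  proof -
    have "(derived SpV ^^ Suc (length es)) ?C \<subseteq> {id}"
      using Sp.mono_exp_of_derived[OF props(2), of "Suc (length es)"] derived_seq_flag_stabiliser[OF lag]
      by blast
    moreover have "id \<in> (derived SpV ^^ Suc (length es)) ?C"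
      using subgroup.one_closed[OF Sp.exp_of_derived_is_subgroup[OF C, of "Suc (length es)"]] by simp
    ultimately have "(derived SpV ^^ Suc (length es)) ?C = {id}"
      by blast
    then show ?thesis
      using solvable_restrict_iff[OF C] by blast
  qed
  ultimately have "closed_connected_solvable scl \<beta> ?C"
    using C props(1) by (simp add: closed_connected_solvable_def)
  moreover have "B \<subseteq> ?C"
    using props(3)[OF BB(2) _ sub] subgroup.one_closed[OF BB(1)] by simp
  ultimately have "B = ?C"
    using max by blast
  then show ?thesis using that iso lag by blast
qed

lemma T_xi_sym:
  assumes \<xi>: "\<xi> \<in> spV_dual"
  shows "\<beta> (Txi \<xi> v) w = \<beta> v (Txi \<xi> w)"
  unfolding beta_sym[of v] T_xi_eq[OF \<xi>] pair_elem_sym[of w] ..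

text \<open>
  Vanishing on the tangent vectors \<open>pair_elem (es ! i) w\<close> says that \<open>T (es ! i)\<close> is orthogonal to everything
  orthogonal to the preceding vectors, that is, lies in their span. So a power of \<open>T\<close> kills the Lagrangian \<open>L\<close>;
  as \<open>T\<close> is self-adjoint, the same power maps \<open>V\<close> into \<open>L\<^sup>\<bottom> = L\<close>.
\<close>
lemma nilpotent_if_vanishes_on_Lie:
  assumes B: "borel_subgroup scl \<beta> B" and \<eta>: "\<eta> \<in> spV_dual"
    and van: "\<And>x. x \<in> Lie scl B \<Longrightarrow> \<eta> x = 0"
  shows "\<exists>N. \<forall>v. (Txi \<eta> ^^ N) v = 0"
proof -
  obtain es where iso: "isotropic es" and lag: "perp (span (set es)) \<subseteq> span (set es)"
    and Beq: "B = identity_component (flag_stabiliser es)"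
    using borel_eq_identity_component[OF B] by blast
  define T where "T = Txi \<eta>"
  have linT: "lin T" unfolding T_def by (rule T_xi_lin[OF \<eta>])
  have base: "T (es ! i) \<in> prefix_span es i" if i: "i < length es" for i
  proof -
    have "\<beta> (T (es ! i)) w = 0" if w: "w \<in> perp (prefix_span es i)" for w
    proof -
      have "id \<in> curve_image (es ! i) w"
        unfolding curve_image_def by (rule image_eqI[of _ _ 0]) (simp_all add: curve_zero)
      then have "curve_image (es ! i) w \<subseteq> B"
        unfolding Beq
        by (rule identity_component_properties(3)[OF subgroup_flag_stabiliser curve_image_connected])
          (rule curve_image_stabiliser[OF iso i w])
      then show ?thesis
        unfolding T_def T_xi_eq[OF \<eta>] by (rule van[OF pair_elem_Lie])
    qed
    then have "T (es ! i) \<in> perp (perp (prefix_span es i))"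
      unfolding perp_def[of "perp _"] by blast
    then show ?thesis
      unfolding perp_perp[OF subspace_prefix_span] .
  qed
  have down: "T v \<in> prefix_span es i" if v: "v \<in> prefix_span es (Suc i)" for v i
  proof (rule prefix_span_induct_lin[OF linT subspace_prefix_span _ v])
    fix j assume "j < Suc i" "j < length es"
    then show "T (es ! j) \<in> prefix_span es i"
      using base[of j] prefix_span_mono[of j i es] by auto
  qed
  have zero: "(T ^^ i) v = 0" if "v \<in> prefix_span es i" for i v
    using that
  proof (induction i arbitrary: v)
    case 0
    then show ?case by (simp add: prefix_span_def)
  next
    case (Suc i)
    then show ?case using down by (simp add: funpow_swap1)
  qed
  let ?N = "length es"
  have kill: "(T ^^ ?N) v = 0" if "v \<in> span (set es)" for v
    using zero[of v ?N] that by (simp add: prefix_span_def)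
  have sym: "\<beta> ((T ^^ i) v) w = \<beta> v ((T ^^ i) w)" for i v w
  proof (induction i arbitrary: w)
    case (Suc i)
    have "\<beta> (T ((T ^^ i) v)) w = \<beta> v ((T ^^ i) (T w))"
      unfolding Suc[symmetric] unfolding T_def by (rule T_xi_sym[OF \<eta>])
    also have "(T ^^ i) (T w) = (T ^^ Suc i) w"
      by (simp add: funpow_swap1)
    finally show ?case by simp
  qed simp
  have "(T ^^ ?N) v \<in> perp (span (set es))" for v
    unfolding perp_def mem_Collect_eq sym using kill by simp
  then have "(T ^^ ?N) ((T ^^ ?N) v) = 0" for v
    using lag kill by blast
  then have "(T ^^ (?N + ?N)) v = 0" for v
    by (simp add: funpow_add)
  then show ?thesis
    unfolding T_def by blast
qed

text \<open>
  The operator of a conjugate functional is the conjugate operator.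
\<close>
theorem nilpotent_dual_imp_nilpotent:
  assumes B: "borel_subgroup scl \<beta> B" and \<xi>: "\<xi> \<in> spV_dual" and nil: "nilpotent_dual scl \<beta> B \<xi>"
  shows "\<exists>N. \<forall>v. (Txi \<xi> ^^ N) v = 0"
proof -
  obtain g where g: "g \<in> carrier SpV" and van: "\<And>x. x \<in> Lie scl B \<Longrightarrow> coad g \<xi> x = 0"
    using nil by (auto simp: nilpotent_dual_def)
  obtain N where N: "\<And>v. (Txi (coad g \<xi>) ^^ N) v = 0"
    using nilpotent_if_vanishes_on_Lie[OF B coadjoint_dual[OF g \<xi>] van] by blast
  have "(Txi \<xi> ^^ N) v = 0" for v
  proof -
    have "g ((Txi \<xi> ^^ N) v) = 0"
      using N[of "g v"] unfolding T_xi_coadjoint[OF g \<xi>] conj_funpow[OF Sp_bij[OF g]] Sp_inv_left[OF g] .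
    then show ?thesis
      using Sp_inv_left[OF g, of "(Txi \<xi> ^^ N) v"] lin_0[OF Sp_lin[OF Sp_inv_closed[OF g]]]
      by simp
  qed
  then show ?thesis by blast
qed

end

theorem proposition2p11:
  fixes scl :: "'k::alg_closed_field \<Rightarrow> 'v::ab_group_add \<Rightarrow> 'v"
    and Basis :: "'v set"
    and \<beta> :: "'v \<Rightarrow> 'v \<Rightarrow> 'k"
    and n :: nat
    and B :: "('v \<Rightarrow> 'v) set"
    and \<xi> \<zeta> :: "('v \<Rightarrow> 'v) \<Rightarrow> 'k"
  assumes "CHAR('k) = 2"
    and "finite_dimensional_vector_space scl Basis"
    and "vector_space.dim scl (UNIV :: 'v set) = 2 * n"
    and "symplectic_form scl \<beta>"
    and "borel_subgroup scl \<beta> B"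
    and "\<xi> \<in> sp_dual scl \<beta>" and "nilpotent_dual scl \<beta> B \<xi>"
    and "\<zeta> \<in> sp_dual scl \<beta>" and "nilpotent_dual scl \<beta> B \<zeta>"
  shows "\<zeta> \<in> orbit (Sp scl \<beta>) (coadjoint scl \<beta>) \<xi> \<longleftrightarrow>
    GL_conjugate scl (T_xi scl Basis \<beta> \<xi>) (T_xi scl Basis \<beta> \<zeta>) \<and>
    index_fun scl Basis \<beta> \<xi> = index_fun scl Basis \<beta> \<zeta>"
proof -
  interpret symplectic_char2 scl Basis \<beta>
    using assms(1,2,4) by (simp add: symplectic_char2_def symplectic_char2_axioms_def)
  show ?thesis
    using orbit_iff nilpotent_dual_imp_nilpotent[OF assms(5)] assms(6-9) by blast
qed

end
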